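(* Let $S$ be a compact Lie group endowed with a bi-invariant Riemannian metric $g_0$ and a non-trivial left-invariant one-form $\omega$. Then the Kropina metric $K(v)=-\frac{g_0(v,v)}{2\omega(v)}$ on $S$ admits at least two closed (non-trivial) geodesics.
   Context: $S$ is connected of dimension at least $2$. The Kropina metric $K(v)=-\frac{g_0(v,v)}{2\omega(v)}$ is defined (and positive) on $\mathcal A=\{v\in TS:\ -\omega(v)>0\}$. $\Omega(\mathcal A)$ is the set of continuous, piecewise smooth curves $\gamma:[0,1]\to S$ with $\gamma(0)=\gamma(1)$ whose left and right derivatives belong to $\mathcal A$ for every $s\in[0,1]$ (at $s=0$ and $s=1$ understood periodically). A closed geodesic of $(S,K)$ is a critical point of the energy $E(\gamma)=\frac12\int_0^1K^2(\dot\gamma)\,ds$ on $\Omega(\mathcal A)$. Two closed geodesics that differ only by a reparametrization are not counted as different. *)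

theory Defs
  imports "HOL-Analysis.Analysis" "HOL-Algebra.Group"
begin

section \<open>Smooth maps between Euclidean spaces\<close>

primrec Ck_on :: "nat \<Rightarrow> ('a::real_normed_vector \<Rightarrow> 'b::real_normed_vector) \<Rightarrow> 'a set \<Rightarrow> bool" where
  "Ck_on 0 f U \<longleftrightarrow> continuous_on U f"
| "Ck_on (Suc k) f U \<longleftrightarrow> (\<forall>x\<in>U. f differentiable (at x)) \<and>
     (\<forall>v. Ck_on k (\<lambda>x. frechet_derivative f (at x) v) U)"

text \<open>On a set that need not be open, smooth means: locally the restriction of a smooth function
  on an open set.\<close>

definition smooth_on :: "'a::real_normed_vector set \<Rightarrow> ('a \<Rightarrow> 'b::real_normed_vector) \<Rightarrow> bool" where
  "smooth_on D f \<longleftrightarrow> (\<forall>x\<in>D. \<exists>U F. open U \<and> x \<in> U \<and> (\<forall>k. Ck_on k F U) \<and> (\<forall>y\<in>D \<inter> U. F y = f y))"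


section \<open>Smooth manifolds and Lie groups\<close>

text \<open>A chart is a pair of its domain \<open>U\<close> and a coordinate map, whose values outside \<open>U\<close> are
  irrelevant. The manifold is \<open>topspace T\<close>; its dimension is \<open>DIM('e)\<close>.\<close>

type_synonym ('a, 'e) chart = "'a set \<times> ('a \<Rightarrow> 'e)"

definition chart_inv :: "('a, 'e) chart \<Rightarrow> 'e \<Rightarrow> 'a" where
  "chart_inv c = inv_into (fst c) (snd c)"

locale smooth_manifold =
  fixes T :: "'a topology" and \<A> :: "('a, 'e::euclidean_space) chart set"
  assumes hausdorff: "Hausdorff_space T"
    and second_countable: "second_countable T"
    and chart_cover: "(\<Union>c\<in>\<A>. fst c) = topspace T"
    and chart_domain_open: "c \<in> \<A> \<Longrightarrow> openin T (fst c)"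
    and chart_image_open: "c \<in> \<A> \<Longrightarrow> open (snd c ` fst c)"
    and chart_homeomorphic: "c \<in> \<A> \<Longrightarrow>
      homeomorphic_map (subtopology T (fst c)) (top_of_set (snd c ` fst c)) (snd c)"
    and transition_smooth: "c \<in> \<A> \<Longrightarrow> d \<in> \<A> \<Longrightarrow>
      smooth_on (snd c ` (fst c \<inter> fst d)) (snd d \<circ> chart_inv c)"

definition smooth_map ::
  "'a topology \<Rightarrow> ('a, 'e::euclidean_space) chart set \<Rightarrow> 'b topology \<Rightarrow>
    ('b, 'f::euclidean_space) chart set \<Rightarrow> ('a \<Rightarrow> 'b) \<Rightarrow> bool" where
  "smooth_map T \<A> T' \<B> f \<longleftrightarrow> continuous_map T T' f \<and>
     (\<forall>c\<in>\<A>. \<forall>d\<in>\<B>. smooth_on (snd c ` {p \<in> fst c. f p \<in> fst d}) (snd d \<circ> f \<circ> chart_inv c))"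

definition smooth_map_from ::
  "'b::euclidean_space set \<Rightarrow> 'a topology \<Rightarrow> ('a, 'e::euclidean_space) chart set \<Rightarrow> ('b \<Rightarrow> 'a) \<Rightarrow> bool" where
  "smooth_map_from D T \<A> f \<longleftrightarrow> continuous_map (top_of_set D) T f \<and>
     (\<forall>c\<in>\<A>. smooth_on {x \<in> D. f x \<in> fst c} (snd c \<circ> f))"

definition prod_atlas ::
  "('a, 'e) chart set \<Rightarrow> ('b, 'f) chart set \<Rightarrow> ('a \<times> 'b, 'e \<times> 'f) chart set" where
  "prod_atlas \<A> \<B> = (\<lambda>(c, d). (fst c \<times> fst d, map_prod (snd c) (snd d))) ` (\<A> \<times> \<B>)"

locale Lie_group = group G + smooth_manifold T \<A>
  for G :: "('a, 'm) monoid_scheme" (structure)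
    and T :: "'a topology" and \<A> :: "('a, 'e::euclidean_space) chart set" +
  assumes carrier_topspace: "carrier G = topspace T"
    and mult_smooth:
      "smooth_map (prod_topology T T) (prod_atlas \<A> \<A>) T \<A> (\<lambda>(x, y). x \<otimes> y)"
    and inv_smooth: "smooth_map T \<A> T \<A> (\<lambda>x. inv\<^bsub>G\<^esub> x)"


section \<open>Tangent vectors\<close>

text \<open>A tangent vector at \<open>p\<close> is the family of its coordinate vectors in all charts around \<open>p\<close>,
  related by the derivatives of the transition maps (and set to \<open>0\<close> in the charts of the atlas not
  around \<open>p\<close>, and outside the atlas). The vector space operations are pointwise.\<close>

type_synonym ('a, 'e) tvec = "('a, 'e) chart \<Rightarrow> 'e"

definition charts_at :: "('a, 'e) chart set \<Rightarrow> 'a \<Rightarrow> ('a, 'e) chart set" where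
  "charts_at \<A> p = {c \<in> \<A>. p \<in> fst c}"

definition transition_deriv ::
  "('a, 'e::euclidean_space) chart \<Rightarrow> ('a, 'e) chart \<Rightarrow> 'a \<Rightarrow> 'e \<Rightarrow> 'e" where
  "transition_deriv c d p = frechet_derivative (snd d \<circ> chart_inv c) (at (snd c p))"

definition tangent_space ::
  "('a, 'e::euclidean_space) chart set \<Rightarrow> 'a \<Rightarrow> ('a, 'e) tvec set" where
  "tangent_space \<A> p = {v.
     (\<forall>c\<in>charts_at \<A> p. \<forall>d\<in>charts_at \<A> p. v d = transition_deriv c d p (v c)) \<and>
     (\<forall>c. c \<notin> charts_at \<A> p \<longrightarrow> v c = 0)}"

definition tvec_lincomb ::
  "real \<Rightarrow> ('a, 'e::real_vector) tvec \<Rightarrow> real \<Rightarrow> ('a, 'e) tvec \<Rightarrow> ('a, 'e) tvec" where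
  "tvec_lincomb a v b w = (\<lambda>c. a *\<^sub>R v c + b *\<^sub>R w c)"

text \<open>The tangent vector at \<open>p\<close> with coordinate vector \<open>e\<close> in the chart \<open>c\<close> around \<open>p\<close>.\<close>

definition tvec_of_coords ::
  "('a, 'e::euclidean_space) chart set \<Rightarrow> ('a, 'e) chart \<Rightarrow> 'a \<Rightarrow> 'e \<Rightarrow> ('a, 'e) tvec" where
  "tvec_of_coords \<A> c p e = (\<lambda>d. if d \<in> charts_at \<A> p then transition_deriv c d p e else 0)"

text \<open>The differential of a smooth map at \<open>p\<close>; on tangent vectors at \<open>p\<close> it does not depend on the
  chart chosen around \<open>p\<close>.\<close>

definition differential ::
  "('a, 'e::euclidean_space) chart set \<Rightarrow> ('b, 'f::euclidean_space) chart set \<Rightarrow> ('a \<Rightarrow> 'b) \<Rightarrow>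
    'a \<Rightarrow> ('a, 'e) tvec \<Rightarrow> ('b, 'f) tvec" where
  "differential \<A> \<B> f p v = (\<lambda>d. if d \<in> charts_at \<B> (f p) then
     (let c = SOME c. c \<in> charts_at \<A> p
      in frechet_derivative (snd d \<circ> f \<circ> chart_inv c) (at (snd c p)) (v c)) else 0)"

text \<open>The velocity of a curve along a filter: \<open>at_right s\<close> gives its right derivative at \<open>s\<close>,
  \<open>at_left s\<close> its left derivative.\<close>

definition velocity ::
  "('a, 'e::euclidean_space) chart set \<Rightarrow> (real \<Rightarrow> 'a) \<Rightarrow> real \<Rightarrow> real filter \<Rightarrow> ('a, 'e) tvec" where
  "velocity \<A> \<gamma> s F =
     (\<lambda>c. if c \<in> charts_at \<A> (\<gamma> s) then vector_derivative (snd c \<circ> \<gamma>) F else 0)"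


section \<open>One-forms and Riemannian metrics\<close>

definition one_form ::
  "'a topology \<Rightarrow> ('a, 'e::euclidean_space) chart set \<Rightarrow> ('a \<Rightarrow> ('a, 'e) tvec \<Rightarrow> real) \<Rightarrow> bool" where
  "one_form T \<A> \<omega> \<longleftrightarrow>
     (\<forall>p\<in>topspace T. \<forall>v\<in>tangent_space \<A> p. \<forall>w\<in>tangent_space \<A> p. \<forall>a b.
        \<omega> p (tvec_lincomb a v b w) = a * \<omega> p v + b * \<omega> p w) \<and>
     (\<forall>c\<in>\<A>. \<forall>e. smooth_on (snd c ` fst c)
        (\<lambda>x. \<omega> (chart_inv c x) (tvec_of_coords \<A> c (chart_inv c x) e)))"

definition riemannian_metric ::
  "'a topology \<Rightarrow> ('a, 'e::euclidean_space) chart set \<Rightarrow>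
    ('a \<Rightarrow> ('a, 'e) tvec \<Rightarrow> ('a, 'e) tvec \<Rightarrow> real) \<Rightarrow> bool" where
  "riemannian_metric T \<A> g \<longleftrightarrow>
     (\<forall>p\<in>topspace T. \<forall>u\<in>tangent_space \<A> p. \<forall>v\<in>tangent_space \<A> p. \<forall>w\<in>tangent_space \<A> p. \<forall>a b.
        g p (tvec_lincomb a u b v) w = a * g p u w + b * g p v w) \<and>
     (\<forall>p\<in>topspace T. \<forall>v\<in>tangent_space \<A> p. \<forall>w\<in>tangent_space \<A> p. g p v w = g p w v) \<and>
     (\<forall>p\<in>topspace T. \<forall>v\<in>tangent_space \<A> p. v \<noteq> (\<lambda>_. 0) \<longrightarrow> g p v v > 0) \<and>
     (\<forall>c\<in>\<A>. \<forall>e e'. smooth_on (snd c ` fst c)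
        (\<lambda>x. g (chart_inv c x) (tvec_of_coords \<A> c (chart_inv c x) e)
               (tvec_of_coords \<A> c (chart_inv c x) e')))"

definition left_invariant_form ::
  "('a, 'm) monoid_scheme \<Rightarrow> ('a, 'e::euclidean_space) chart set \<Rightarrow>
    ('a \<Rightarrow> ('a, 'e) tvec \<Rightarrow> real) \<Rightarrow> bool" where
  "left_invariant_form G \<A> \<omega> \<longleftrightarrow>
     (\<forall>h\<in>carrier G. \<forall>p\<in>carrier G. \<forall>v\<in>tangent_space \<A> p.
        \<omega> (h \<otimes>\<^bsub>G\<^esub> p) (differential \<A> \<A> (\<lambda>x. h \<otimes>\<^bsub>G\<^esub> x) p v) = \<omega> p v)"

definition bi_invariant_metric ::
  "('a, 'm) monoid_scheme \<Rightarrow> ('a, 'e::euclidean_space) chart set \<Rightarrow>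
    ('a \<Rightarrow> ('a, 'e) tvec \<Rightarrow> ('a, 'e) tvec \<Rightarrow> real) \<Rightarrow> bool" where
  "bi_invariant_metric G \<A> g \<longleftrightarrow>
     (\<forall>h\<in>carrier G. \<forall>p\<in>carrier G. \<forall>v\<in>tangent_space \<A> p. \<forall>w\<in>tangent_space \<A> p.
        g (h \<otimes>\<^bsub>G\<^esub> p) (differential \<A> \<A> (\<lambda>x. h \<otimes>\<^bsub>G\<^esub> x) p v)
                    (differential \<A> \<A> (\<lambda>x. h \<otimes>\<^bsub>G\<^esub> x) p w) = g p v w \<and>
        g (p \<otimes>\<^bsub>G\<^esub> h) (differential \<A> \<A> (\<lambda>x. x \<otimes>\<^bsub>G\<^esub> h) p v)
                    (differential \<A> \<A> (\<lambda>x. x \<otimes>\<^bsub>G\<^esub> h) p w) = g p v w)"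


section \<open>Closed geodesics of a conic metric\<close>

definition kropina_domain ::
  "'a topology \<Rightarrow> ('a, 'e::euclidean_space) chart set \<Rightarrow> ('a \<Rightarrow> ('a, 'e) tvec \<Rightarrow> real) \<Rightarrow>
    ('a \<times> ('a, 'e) tvec) set" where
  "kropina_domain T \<A> \<omega> = {(p, v). p \<in> topspace T \<and> v \<in> tangent_space \<A> p \<and> - \<omega> p v > 0}"

definition kropina ::
  "('a \<Rightarrow> ('a, 'e) tvec \<Rightarrow> ('a, 'e) tvec \<Rightarrow> real) \<Rightarrow> ('a \<Rightarrow> ('a, 'e) tvec \<Rightarrow> real) \<Rightarrow>
    'a \<Rightarrow> ('a, 'e) tvec \<Rightarrow> real" where
  "kropina g \<omega> p v = - (g p v v / (2 * \<omega> p v))"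

definition partition01 :: "nat \<Rightarrow> (nat \<Rightarrow> real) \<Rightarrow> bool" where
  "partition01 n t \<longleftrightarrow> t 0 = 0 \<and> t n = 1 \<and> (\<forall>i<n. t i < t (Suc i))"

definition piecewise_smooth ::
  "'a topology \<Rightarrow> ('a, 'e::euclidean_space) chart set \<Rightarrow> (real \<Rightarrow> 'a) \<Rightarrow> bool" where
  "piecewise_smooth T \<A> \<gamma> \<longleftrightarrow>
     (\<exists>n t. partition01 n t \<and> (\<forall>i<n. smooth_map_from {t i..t (Suc i)} T \<A> \<gamma>))"

text \<open>Read periodically, the left derivative at \<open>0\<close> is the one at \<open>1\<close>, and the right derivative at
  \<open>1\<close> is the one at \<open>0\<close>. Values of \<open>\<gamma>\<close> outside \<open>{0..1}\<close> are irrelevant.\<close>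

definition admissible_loops ::
  "'a topology \<Rightarrow> ('a, 'e::euclidean_space) chart set \<Rightarrow> ('a \<times> ('a, 'e) tvec) set \<Rightarrow>
    (real \<Rightarrow> 'a) set" where
  "admissible_loops T \<A> C = {\<gamma>.
     continuous_map (top_of_set {0..1}) T \<gamma> \<and> piecewise_smooth T \<A> \<gamma> \<and> \<gamma> 0 = \<gamma> 1 \<and>
     (\<forall>s\<in>{0..<1}. (\<gamma> s, velocity \<A> \<gamma> s (at_right s)) \<in> C) \<and>
     (\<forall>s\<in>{0<..1}. (\<gamma> s, velocity \<A> \<gamma> s (at_left s)) \<in> C)}"

text \<open>On a piecewise smooth curve the right derivative is the derivative except at finitely many
  points, which the integral does not see.\<close>

definition energy ::
  "('a, 'e::euclidean_space) chart set \<Rightarrow> ('a \<Rightarrow> ('a, 'e) tvec \<Rightarrow> real) \<Rightarrow> (real \<Rightarrow> 'a) \<Rightarrow> real" where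
  "energy \<A> K \<gamma> = 1/2 * integral {0..1} (\<lambda>s. (K (\<gamma> s) (velocity \<A> \<gamma> s (at_right s)))\<^sup>2)"

text \<open>Continuous, piecewise smooth variations \<open>\<Gamma> \<tau>\<close>, \<open>\<bar>\<tau>\<bar> < \<epsilon>\<close>, of \<open>\<gamma>\<close> through admissible loops; the
  base point may move.\<close>

definition admissible_variation ::
  "'a topology \<Rightarrow> ('a, 'e::euclidean_space) chart set \<Rightarrow> ('a \<times> ('a, 'e) tvec) set \<Rightarrow>
    (real \<Rightarrow> 'a) \<Rightarrow> real \<Rightarrow> (real \<Rightarrow> real \<Rightarrow> 'a) \<Rightarrow> bool" where
  "admissible_variation T \<A> C \<gamma> \<epsilon> \<Gamma> \<longleftrightarrow> \<epsilon> > 0 \<and>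
     (\<forall>s\<in>{0..1}. \<Gamma> 0 s = \<gamma> s) \<and>
     (\<forall>\<tau>\<in>{-\<epsilon><..<\<epsilon>}. \<Gamma> \<tau> \<in> admissible_loops T \<A> C) \<and>
     continuous_map (top_of_set ({-\<epsilon><..<\<epsilon>} \<times> {0..1})) T (\<lambda>(\<tau>, s). \<Gamma> \<tau> s) \<and>
     (\<exists>n t. partition01 n t \<and>
        (\<forall>i<n. smooth_map_from ({-\<epsilon><..<\<epsilon>} \<times> {t i..t (Suc i)}) T \<A> (\<lambda>(\<tau>, s). \<Gamma> \<tau> s)))"

definition closed_geodesic ::
  "'a topology \<Rightarrow> ('a, 'e::euclidean_space) chart set \<Rightarrow> ('a \<times> ('a, 'e) tvec) set \<Rightarrow>
    ('a \<Rightarrow> ('a, 'e) tvec \<Rightarrow> real) \<Rightarrow> (real \<Rightarrow> 'a) \<Rightarrow> bool" where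
  "closed_geodesic T \<A> C K \<gamma> \<longleftrightarrow> \<gamma> \<in> admissible_loops T \<A> C \<and>
     (\<forall>\<epsilon> \<Gamma>. admissible_variation T \<A> C \<gamma> \<epsilon> \<Gamma> \<longrightarrow>
        ((\<lambda>\<tau>. energy \<A> K (\<Gamma> \<tau>)) has_real_derivative 0) (at 0))"

text \<open>A loop \<open>\<gamma>\<close> reparametrizes the loop \<open>c\<close> if it runs \<open>m \<ge> 1\<close> times along \<open>c\<close>, starting anywhere
  (\<open>frac\<close> identifies the circle with \<open>[0,1)\<close>). In particular a loop is not distinguished from its
  iterates, nor are two iterates of the same loop.\<close>

definition reparametrizes :: "(real \<Rightarrow> 'a) \<Rightarrow> (real \<Rightarrow> 'a) \<Rightarrow> bool" where
  "reparametrizes \<gamma> c \<longleftrightarrow> (\<exists>(\<phi>::real \<Rightarrow> real) (m::nat). m \<ge> 1 \<and>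
     continuous_on {0..1} \<phi> \<and> strict_mono_on {0..1} \<phi> \<and> \<phi> 1 = \<phi> 0 + real m \<and>
     (\<forall>s\<in>{0..1}. \<gamma> s = c (frac (\<phi> s))))"

definition same_up_to_reparametrization :: "(real \<Rightarrow> 'a) \<Rightarrow> (real \<Rightarrow> 'a) \<Rightarrow> bool" where
  "same_up_to_reparametrization \<gamma>\<^sub>1 \<gamma>\<^sub>2 \<longleftrightarrow> (\<exists>c. reparametrizes \<gamma>\<^sub>1 c \<and> reparametrizes \<gamma>\<^sub>2 c)"

end

theory Submission
  imports Defs
begin

text \<open>One closed geodesic suffices: left translations preserve the Kropina metric, and since the image of
  a smooth curve is negligible, some translate of it has a different image.

  The geodesic is a closed one-parameter subgroup \<open>\<gamma>\<close> with \<open>\<omega>(\<gamma>') < 0\<close> whose right translations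
  preserve \<open>\<omega>\<close>. To find it, let \<open>B\<close> be the vector dual to \<open>\<omega>\<close> at the identity. By compactness some
  \<open>exp(n B)\<close>, \<open>n \<ge> 1\<close>, is so close to the identity that it equals \<open>exp Y\<close> with \<open>Y\<close> small; as square roots
  near the identity are unique, \<open>exp(s Y)\<close> commutes with \<open>exp(t B)\<close>, so
  \<open>exp(s (Y - n B))\<close> is closed, and \<open>Ad\<close> of it fixes \<open>B\<close> and hence \<open>\<omega>\<close>.

  Criticality: write a variation of \<open>h \<gamma>\<close> as \<open>\<Gamma> \<tau> s = h \<Delta> \<tau> s \<gamma> s\<close>. By invariance \<open>K\<close> of its velocity is
  a function of the left logarithmic derivative of \<open>\<Delta> \<tau>\<close> alone, which is \<open>O(\<tau>)\<close>. To first order the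
  energy is therefore a constant plus a linear function of the integral of the coordinate velocity of
  \<open>\<Delta> \<tau>\<close>, and this integral vanishes because \<open>\<Delta> \<tau>\<close> is a loop.\<close>

section \<open>Calculus of smooth maps\<close>

text \<open>The obstacle is that \<open>exp(t B)\<close> need not close up: its closure may be a
  torus. A nearby direction that does close up must keep two properties of \<open>B\<close>, the
  sign of \<omega> and its invariance under \<open>Ad\<close>. The sign survives because Y is chosen
  small against a single multiple of \<open>B\<close>, while at least one multiple is subtracted.
  The invariance survives because the closed subgroup still commutes with \<open>exp(t B)\<close>:
  an isometry of the Lie algebra that fixes \<open>B\<close> preserves the form dual to
  \<open>B\<close>. Criticality depends on this invariance. The logarithmic derivative of a product
  is twisted by \<open>Ad\<close>, and a twist varying with s would keep the linear term from being
  the derivative of a function of s. Logarithmic derivatives replace the Euler-Lagrange equations by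
  calculus in one vector space, and they make sense one-sidedly, so corners of a variation cause no
  trouble. Of the exponential map only the homomorphism property and quantitative local bijectivity
  enter. Both come from integral curves of left-invariant fields over unit time, on a ball so small
  that the integral equation is a contraction.\<close>

lemma Ck_on_imp_continuous_on: "Ck_on k f U \<Longrightarrow> continuous_on U f"
  by (cases k) (auto intro!: continuous_at_imp_continuous_on differentiable_imp_continuous_within)

text \<open>At a successor level \<open>Ck_on\<close> speaks of \<open>f\<close> only through its
  differentiability; this is where the continuity demanded at level 0 comes from.\<close>

lemma Ck_on_SucD: "Ck_on (Suc k) f U \<Longrightarrow> Ck_on k f U"
proof (induction k arbitrary: f)
  case 0
  then show ?case using Ck_on_imp_continuous_on by (metis Ck_on.simps(1))
next
  case (Suc k)
  then show ?case by (metis Ck_on.simps(2))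
qed

lemma Ck_on_Suc_has_derivative:
  "Ck_on (Suc k) f U \<Longrightarrow> x \<in> U \<Longrightarrow> (f has_derivative frechet_derivative f (at x)) (at x)"
  by (simp add: frechet_derivative_works[symmetric])

lemma Ck_on_subset: "Ck_on k f U \<Longrightarrow> V \<subseteq> U \<Longrightarrow> Ck_on k f V"
  by (induction k arbitrary: f) (auto intro: continuous_on_subset)

text \<open>Since \<open>U\<close> is open, the derivative at a point of \<open>U\<close> sees only
  values in \<open>U\<close>, so the two choice-defined \<open>frechet_derivative\<close>s agree
  there.\<close>

lemma Ck_on_cong:
  assumes "open U" "\<And>x. x \<in> U \<Longrightarrow> f x = g x" "Ck_on k f U"
  shows "Ck_on k g U"
  using assms(2,3)
proof (induction k arbitrary: f g)
  case 0
  then show ?case by (simp cong: continuous_on_cong)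
next
  case (Suc k)
  have "g differentiable at x" "frechet_derivative f (at x) = frechet_derivative g (at x)"
    if "x \<in> U" for x
  proof -
    have f: "f differentiable at x" using Suc.prems that by simp
    show "frechet_derivative f (at x) = frechet_derivative g (at x)"
      using frechet_derivative_transform_within_open[OF f assms(1) that] Suc.prems(1) by blast
    show "g differentiable at x"
      using f has_derivative_transform_within_open[OF _ assms(1) that] Suc.prems(1)
      unfolding differentiable_def by blast
  qed
  moreover have "Ck_on k (\<lambda>x. frechet_derivative g (at x) v) U" for v
  proof (rule Suc.IH)
    show "Ck_on k (\<lambda>x. frechet_derivative f (at x) v) U" using Suc.prems(2) by simp
  qed (use calculation(2) in metis)
  ultimately show ?case by simp
qed

text \<open>Trades the choice-defined \<open>frechet_derivative\<close> for any explicit derivative,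
  so that each closure property below follows from its own differentiation rule.\<close>

lemma Ck_on_SucI:
  assumes U: "open U" and d: "\<And>x. x \<in> U \<Longrightarrow> (f has_derivative f' x) (at x)"
    and c: "\<And>v. Ck_on k (\<lambda>x. f' x v) U"
  shows "Ck_on (Suc k) f U"
proof -
  have eq: "f' x = frechet_derivative f (at x)" if "x \<in> U" for x
    using frechet_derivative_at[OF d[OF that]] .
  have "Ck_on k (\<lambda>x. frechet_derivative f (at x) v) U" for v
    by (rule Ck_on_cong[OF U _ c[of v]]) (simp add: eq)
  then show ?thesis using d by (auto simp: differentiable_def)
qed

lemma Ck_on_local:
  assumes "open U" "\<And>x. x \<in> U \<Longrightarrow> \<exists>V. open V \<and> x \<in> V \<and> Ck_on k f V"
  shows "Ck_on k f U"
  using assms(2)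
proof (induction k arbitrary: f)
  case 0
  then have "isCont f x" if "x \<in> U" for x
    using that by (metis Ck_on.simps(1) continuous_on_eq_continuous_at)
  then show ?case by (simp add: continuous_at_imp_continuous_on)
next
  case (Suc k)
  show ?case
  proof (simp, intro conjI ballI allI)
    show "f differentiable at x" if "x \<in> U" for x using Suc.prems[OF that] by auto
    show "Ck_on k (\<lambda>x. frechet_derivative f (at x) v) U" for v
      using Suc.prems by (intro Suc.IH) (metis Ck_on.simps(2))
  qed
qed

lemma Ck_on_const: "Ck_on k (\<lambda>x. c) U"
  by (induction k arbitrary: c) auto

lemma Ck_on_bounded_linear: "bounded_linear f \<Longrightarrow> Ck_on k f U"
proof (induction k arbitrary: f)
  case 0
  then show ?case by (simp add: linear_continuous_on)
next
  case (Suc k)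
  then have "(f has_derivative f) (at x)" for x using bounded_linear_imp_has_derivative by blast
  then have "frechet_derivative f (at x) = f" "f differentiable at x" for x
    using frechet_derivative_at by (metis, metis differentiable_def)
  then show ?case by (simp add: Ck_on_const)
qed

lemma Ck_on_bounded_linear_compose:
  assumes "bounded_linear L" "open U" "Ck_on k f U"
  shows "Ck_on k (\<lambda>x. L (f x)) U"
  using assms(3)
proof (induction k arbitrary: f)
  case 0
  then show ?case using assms(1) by (simp add: linear_continuous_on_compose bounded_linear.continuous_on)
next
  case (Suc k)
  have d: "((\<lambda>x. L (f x)) has_derivative (\<lambda>v. L (frechet_derivative f (at x) v))) (at x)"
    if "x \<in> U" for x
    using Ck_on_Suc_has_derivative[OF Suc.prems that] by (rule bounded_linear.has_derivative[OF assms(1)])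
  have c: "Ck_on k (\<lambda>x. L (frechet_derivative f (at x) v)) U" for v
    using Suc by simp
  show ?case by (rule Ck_on_SucI[OF assms(2) d c])
qed

lemma Ck_on_add:
  assumes "open U" "Ck_on k f U" "Ck_on k g U"
  shows "Ck_on k (\<lambda>x. f x + g x) U"
  using assms(2,3)
proof (induction k arbitrary: f g)
  case 0
  then show ?case by (simp add: continuous_on_add)
next
  case (Suc k)
  have d: "((\<lambda>x. f x + g x) has_derivative
      (\<lambda>v. frechet_derivative f (at x) v + frechet_derivative g (at x) v)) (at x)"
    if "x \<in> U" for x
    by (intro has_derivative_add Ck_on_Suc_has_derivative[OF Suc.prems(1) that]
        Ck_on_Suc_has_derivative[OF Suc.prems(2) that])
  have c: "Ck_on k (\<lambda>x. frechet_derivative f (at x) v + frechet_derivative g (at x) v) U" for v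
    using Suc by simp
  show ?case by (rule Ck_on_SucI[OF assms(1) d c])
qed

lemma Ck_on_sum:
  assumes "open U" "\<And>i. i \<in> I \<Longrightarrow> Ck_on k (f i) U"
  shows "Ck_on k (\<lambda>x. \<Sum>i\<in>I. f i x) U"
  using assms(2) by (induction I rule: infinite_finite_induct) (simp_all add: Ck_on_const Ck_on_add[OF assms(1)])

lemma Ck_on_scaleR:
  fixes f :: "'a::real_normed_vector \<Rightarrow> real"
  assumes "open U" "Ck_on k f U" "Ck_on k g U"
  shows "Ck_on k (\<lambda>x. f x *\<^sub>R g x) U"
  using assms(2,3)
proof (induction k arbitrary: f g)
  case 0
  then show ?case by (simp add: continuous_on_scaleR)
next
  case (Suc k)
  have d: "((\<lambda>x. f x *\<^sub>R g x) has_derivative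
      (\<lambda>v. f x *\<^sub>R frechet_derivative g (at x) v + frechet_derivative f (at x) v *\<^sub>R g x)) (at x)"
    if "x \<in> U" for x
    by (intro has_derivative_scaleR Ck_on_Suc_has_derivative[OF Suc.prems(1) that]
        Ck_on_Suc_has_derivative[OF Suc.prems(2) that])
  have c: "Ck_on k (\<lambda>x. f x *\<^sub>R frechet_derivative g (at x) v + frechet_derivative f (at x) v *\<^sub>R g x) U" for v
  proof -
    have "Ck_on k f U" "Ck_on k g U" using Suc.prems Ck_on_SucD by blast+
    then show ?thesis using Suc by (intro Ck_on_add[OF assms(1)] Suc.IH) auto
  qed
  show ?case by (rule Ck_on_SucI[OF assms(1) d c])
qed

lemma linear_Basis_sum:
  assumes "linear f"
  shows "f v = (\<Sum>b\<in>Basis. (v \<bullet> b) *\<^sub>R f b)"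
  using linear_sum[OF assms, of "\<lambda>b. (v \<bullet> b) *\<^sub>R b" Basis]
  by (simp add: euclidean_representation linear_scale[OF assms])

text \<open>\<open>Ck_on\<close> controls derivatives in a constant direction only, whereas the
  chain rule differentiates \<open>g\<close> in the moving direction Df(v). Expanding that direction
  in the basis of the middle space leaves a finite sum of products, to which the product rule and
  the induction hypothesis for the partial derivatives of \<open>g\<close> apply.\<close>

lemma Ck_on_compose:
  fixes f :: "'a::real_normed_vector \<Rightarrow> 'b::euclidean_space"
  assumes "open U" "open V" "f ` U \<subseteq> V" "Ck_on k f U" "Ck_on k g V"
  shows "Ck_on k (\<lambda>x. g (f x)) U"
  using assms(4,5)
proof (induction k arbitrary: g)
  case 0
  then show ?case using assms(3) by (simp add: continuous_on_compose2)
next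
  case (Suc k)
  have f: "(f has_derivative frechet_derivative f (at x)) (at x)"
    and g: "(g has_derivative frechet_derivative g (at (f x))) (at (f x))" if "x \<in> U" for x
    using Ck_on_Suc_has_derivative[OF Suc.prems(1) that] Ck_on_Suc_has_derivative[OF Suc.prems(2), of "f x"] assms(3) that by auto
  have d: "((\<lambda>x. g (f x)) has_derivative
      (\<lambda>v. \<Sum>b\<in>Basis. (frechet_derivative f (at x) v \<bullet> b) *\<^sub>R frechet_derivative g (at (f x)) b)) (at x)"
    if "x \<in> U" for x
  proof -
    have "linear (frechet_derivative g (at (f x)))" using g[OF that] has_derivative_linear by blast
    then have "frechet_derivative g (at (f x)) (\<Sum>b\<in>Basis. (frechet_derivative f (at x) v \<bullet> b) *\<^sub>R b) =
        (\<Sum>b\<in>Basis. (frechet_derivative f (at x) v \<bullet> b) *\<^sub>R frechet_derivative g (at (f x)) b)" for v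
      by (simp add: linear_sum linear_scale)
    then show ?thesis using has_derivative_compose[OF f[OF that] g[OF that]] by (simp add: euclidean_representation)
  qed
  have c: "Ck_on k (\<lambda>x. \<Sum>b\<in>Basis. (frechet_derivative f (at x) v \<bullet> b) *\<^sub>R frechet_derivative g (at (f x)) b) U" for v
  proof (intro Ck_on_sum[OF assms(1)] Ck_on_scaleR[OF assms(1)])
    show "Ck_on k (\<lambda>x. frechet_derivative f (at x) v \<bullet> b) U" for b
      using Suc.prems(1) by (intro Ck_on_bounded_linear_compose[OF bounded_linear_inner_left assms(1)]) simp
    show "Ck_on k (\<lambda>x. frechet_derivative g (at (f x)) b) U" for b
      using Suc.prems(2) by (intro Suc.IH Ck_on_SucD[OF Suc.prems(1)]) simp
  qed
  show ?case by (rule Ck_on_SucI[OF assms(1) d c])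
qed

lemma Ck_on_Pair:
  assumes "open U" "Ck_on k f U" "Ck_on k g U"
  shows "Ck_on k (\<lambda>x. (f x, g x)) U"
proof -
  have "Ck_on k (\<lambda>x. (f x, 0) + (0, g x)) U"
    by (intro Ck_on_add assms
        Ck_on_bounded_linear_compose[of "\<lambda>y. (y, 0)"] Ck_on_bounded_linear_compose[of "\<lambda>y. (0, y)"]
        bounded_linear_Pair bounded_linear_ident bounded_linear_zero)
  then show ?thesis by simp
qed

section \<open>Smoothness on sets that need not be open\<close>

lemma smooth_onI:
  assumes "\<And>x. x \<in> D \<Longrightarrow> \<exists>U F. open U \<and> x \<in> U \<and> (\<forall>k. Ck_on k F U) \<and> (\<forall>y\<in>D \<inter> U. F y = f y)"
  shows "smooth_on D f"
  unfolding smooth_on_def using assms by blast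

lemma smooth_onE:
  assumes "smooth_on D f" "x \<in> D"
  obtains U F where "open U" "x \<in> U" "\<forall>k. Ck_on k F U" "\<forall>y\<in>D \<inter> U. F y = f y"
proof -
  have "\<exists>U F. open U \<and> x \<in> U \<and> (\<forall>k. Ck_on k F U) \<and> (\<forall>y\<in>D \<inter> U. F y = f y)"
    using assms by (simp add: smooth_on_def)
  then show thesis by (elim exE conjE) (rule that)
qed

lemma smooth_on_subset:
  assumes "smooth_on D f" "D' \<subseteq> D"
  shows "smooth_on D' f"
proof (rule smooth_onI)
  fix x assume "x \<in> D'"
  then have "x \<in> D" using assms(2) by blast
  then obtain U F where "open U" "x \<in> U" "\<forall>k. Ck_on k F U" "\<forall>y\<in>D \<inter> U. F y = f y"
    by (rule smooth_onE[OF assms(1)])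
  then show "\<exists>U F. open U \<and> x \<in> U \<and> (\<forall>k. Ck_on k F U) \<and> (\<forall>y\<in>D' \<inter> U. F y = f y)"
    using assms(2) by blast
qed

lemma smooth_on_cong:
  assumes f: "smooth_on D f" and eq: "\<And>x. x \<in> D \<Longrightarrow> f x = g x"
  shows "smooth_on D g"
proof (rule smooth_onI)
  fix x assume "x \<in> D"
  then obtain U F where "open U" "x \<in> U" "\<forall>k. Ck_on k F U" "\<forall>y\<in>D \<inter> U. F y = f y"
    by (rule smooth_onE[OF f])
  then show "\<exists>U F. open U \<and> x \<in> U \<and> (\<forall>k. Ck_on k F U) \<and> (\<forall>y\<in>D \<inter> U. F y = g y)"
    using eq by (intro exI[of _ U] exI[of _ F]) simp
qed

lemma smooth_on_local:
  assumes "\<And>x. x \<in> D \<Longrightarrow> \<exists>N. open N \<and> x \<in> N \<and> smooth_on (D \<inter> N) f"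
  shows "smooth_on D f"
proof (rule smooth_onI)
  fix x assume "x \<in> D"
  then obtain N where N: "open N" "x \<in> N" "smooth_on (D \<inter> N) f" using assms by blast
  have "x \<in> D \<inter> N" using N \<open>x \<in> D\<close> by simp
  then obtain U F where "open U" "x \<in> U" "\<forall>k. Ck_on k F U" "\<forall>y\<in>D \<inter> N \<inter> U. F y = f y"
    by (rule smooth_onE[OF N(3)])
  then show "\<exists>U F. open U \<and> x \<in> U \<and> (\<forall>k. Ck_on k F U) \<and> (\<forall>y\<in>D \<inter> U. F y = f y)"
    using N Ck_on_subset[of _ F U "U \<inter> N"] by (intro exI[of _ "U \<inter> N"] exI[of _ F]) auto
qed

text \<open>On an open set a local extension agrees with \<open>f\<close> on a whole neighbourhood,
  so the witnesses \<open>F\<close> drop out.\<close>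

lemma smooth_on_open: "open U \<Longrightarrow> smooth_on U f \<longleftrightarrow> (\<forall>k. Ck_on k f U)"
proof
  assume U: "open U" and f: "smooth_on U f"
  show "\<forall>k. Ck_on k f U"
  proof (intro allI Ck_on_local[OF U])
    fix k x assume "x \<in> U"
    then obtain V F where V: "open V" "x \<in> V" "\<forall>k. Ck_on k F V" "\<forall>y\<in>U \<inter> V. F y = f y"
      by (rule smooth_onE[OF f])
    then have "Ck_on k f (U \<inter> V)"
      using U by (intro Ck_on_cong[of "U \<inter> V", OF _ _ Ck_on_subset[OF V(3)[rule_format]]]) (use V in auto)
    then show "\<exists>V. open V \<and> x \<in> V \<and> Ck_on k f V" using U V \<open>x \<in> U\<close> by blast
  qed
qed (auto simp: smooth_on_def)

lemma smooth_on_imp_continuous_on: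
  assumes "smooth_on D f"
  shows "continuous_on D f"
  unfolding continuous_on_eq_continuous_within
proof
  fix x assume x: "x \<in> D"
  obtain V F where V: "open V" "x \<in> V" "\<forall>k. Ck_on k F V" "\<forall>y\<in>D \<inter> V. F y = f y"
    by (rule smooth_onE[OF assms x])
  then have "isCont F x" using Ck_on_imp_continuous_on continuous_on_eq_continuous_at by blast
  then have "continuous (at x within D) F" by (rule continuous_at_imp_continuous_at_within)
  moreover obtain d where "d > 0" "ball x d \<subseteq> V" using V open_contains_ball by blast
  ultimately show "continuous (at x within D) f"
    using V x by (intro continuous_transform_within[of x D F d f]) (auto simp: subset_iff dist_commute)
qed

lemma smooth_on_compose:
  fixes f :: "'a::real_normed_vector \<Rightarrow> 'b::euclidean_space"
  assumes f: "smooth_on D f" and g: "smooth_on D' g" and sub: "f ` D \<subseteq> D'"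
  shows "smooth_on D (\<lambda>x. g (f x))"
proof (rule smooth_onI)
  fix x assume x: "x \<in> D"
  obtain U F where U: "open U" "x \<in> U" "\<forall>k. Ck_on k F U" "\<forall>y\<in>D \<inter> U. F y = f y"
    by (rule smooth_onE[OF f x])
  obtain V H where V: "open V" "f x \<in> V" "\<forall>k. Ck_on k H V" "\<forall>y\<in>D' \<inter> V. H y = g y"
    using sub x by (rule_tac smooth_onE[OF g, of "f x"]) auto
  have "continuous_on U F" using U Ck_on_imp_continuous_on by blast
  \<comment> \<open>The extension \<open>F\<close> may leave \<open>V\<close>; its domain is cut
    down to the part that it maps into \<open>V\<close>.\<close>
  then have o: "open (U \<inter> F -` V)" using U V continuous_open_preimage by blast
  show "\<exists>U F. open U \<and> x \<in> U \<and> (\<forall>k. Ck_on k F U) \<and> (\<forall>y\<in>D \<inter> U. F y = g (f y))"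
  proof (intro exI conjI allI ballI)
    show "open (U \<inter> F -` V)" by (fact o)
    show "x \<in> U \<inter> F -` V" using U V x by auto
    show "Ck_on k (\<lambda>x. H (F x)) (U \<inter> F -` V)" for k
      by (rule Ck_on_compose[OF o V(1) _ Ck_on_subset[OF U(3)[rule_format]] V(3)[rule_format]]) auto
    show "H (F y) = g (f y)" if "y \<in> D \<inter> (U \<inter> F -` V)" for y
      using that U(4) V(4) sub by auto
  qed
qed

lemma smooth_on_bounded_linear: "bounded_linear f \<Longrightarrow> smooth_on D f"
  by (intro smooth_onI exI[of _ UNIV] exI[of _ f]) (auto intro: Ck_on_bounded_linear)

lemma smooth_on_const: "smooth_on D (\<lambda>x. c)"
  by (intro smooth_onI exI[of _ UNIV] exI[of _ "\<lambda>x. c"]) (auto intro: Ck_on_const)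

lemma smooth_on_Pair:
  assumes "smooth_on D f" "smooth_on D g"
  shows "smooth_on D (\<lambda>x. (f x, g x))"
proof (rule smooth_onI)
  fix x assume x: "x \<in> D"
  obtain U F where U: "open U" "x \<in> U" "\<forall>k. Ck_on k F U" "\<forall>y\<in>D \<inter> U. F y = f y"
    by (rule smooth_onE[OF assms(1) x])
  obtain V H where V: "open V" "x \<in> V" "\<forall>k. Ck_on k H V" "\<forall>y\<in>D \<inter> V. H y = g y"
    by (rule smooth_onE[OF assms(2) x])
  show "\<exists>U F. open U \<and> x \<in> U \<and> (\<forall>k. Ck_on k F U) \<and> (\<forall>y\<in>D \<inter> U. F y = (f y, g y))"
    using U V Ck_on_subset[of _ F U "U \<inter> V"] Ck_on_subset[of _ H V "U \<inter> V"]
    by (intro exI[of _ "U \<inter> V"] exI[of _ "\<lambda>x. (F x, H x)"]) (auto intro!: Ck_on_Pair)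
qed

lemma smooth_on_add:
  fixes f g :: "'a::real_normed_vector \<Rightarrow> 'b::euclidean_space"
  assumes "smooth_on D f" "smooth_on D g"
  shows "smooth_on D (\<lambda>x. f x + g x)"
  using smooth_on_compose[OF smooth_on_Pair[OF assms]
      smooth_on_bounded_linear[OF bounded_linear_add[OF bounded_linear_fst bounded_linear_snd]], of UNIV]
  by simp

lemma smooth_on_frechet_derivative:
  assumes "open W" "smooth_on W f"
  shows "smooth_on W (\<lambda>z. frechet_derivative f (at z) u)"
proof -
  have "Ck_on (Suc k) f W" for k using assms smooth_on_open by blast
  then show ?thesis using assms(1) by (simp add: smooth_on_open)
qed

lemma smooth_on_open_has_derivative:
  assumes "open U" "smooth_on U f" "x \<in> U"
  shows "(f has_derivative frechet_derivative f (at x)) (at x)"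
  using assms Ck_on_Suc_has_derivative[of 0 f U x] by (simp add: smooth_on_open del: Ck_on.simps)

section \<open>Smooth maps into manifolds\<close>

lemma smooth_map_from_imp_continuous_map: "smooth_map_from D T \<A> f \<Longrightarrow> continuous_map (top_of_set D) T f"
  by (simp add: smooth_map_from_def)

lemma smooth_map_from_in_topspace: "smooth_map_from D T \<A> f \<Longrightarrow> x \<in> D \<Longrightarrow> f x \<in> topspace T"
  by (auto simp: smooth_map_from_def continuous_map_def)

lemma smooth_map_from_smooth_on:
  "smooth_map_from D T \<A> f \<Longrightarrow> c \<in> \<A> \<Longrightarrow> smooth_on {x \<in> D. f x \<in> fst c} (\<lambda>x. snd c (f x))"
  by (simp add: smooth_map_from_def comp_def)

lemma continuous_map_preimage_Int_open:
  assumes "continuous_map (top_of_set D) T f" "openin T V"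
  obtains N where "open N" "{x \<in> D. f x \<in> V} = D \<inter> N"
proof -
  have "openin (top_of_set D) {x \<in> D. f x \<in> V}"
    using openin_continuous_map_preimage[OF assms] by simp
  then show thesis using that by (auto simp: openin_open)
qed

lemma smooth_map_from_subset:
  assumes "smooth_map_from D T \<A> f" "D' \<subseteq> D"
  shows "smooth_map_from D' T \<A> f"
  unfolding smooth_map_from_def
proof (intro conjI ballI)
  show "continuous_map (top_of_set D') T f"
    using assms continuous_map_from_subtopology_mono by (auto simp: smooth_map_from_def)
  show "smooth_on {x \<in> D'. f x \<in> fst c} (snd c \<circ> f)" if "c \<in> \<A>" for c
    using assms that by (auto simp: smooth_map_from_def intro: smooth_on_subset)
qed

lemma smooth_map_from_cong:
  assumes "smooth_map_from D T \<A> f" "\<And>x. x \<in> D \<Longrightarrow> f x = g x"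
  shows "smooth_map_from D T \<A> g"
  unfolding smooth_map_from_def
proof (intro conjI ballI)
  show "continuous_map (top_of_set D) T g"
    by (rule continuous_map_eq[OF smooth_map_from_imp_continuous_map[OF assms(1)]]) (simp add: assms(2))
  fix c assume "c \<in> \<A>"
  then have "smooth_on {x \<in> D. f x \<in> fst c} (snd c \<circ> f)"
    using assms(1) unfolding smooth_map_from_def by blast
  moreover have "{x \<in> D. f x \<in> fst c} = {x \<in> D. g x \<in> fst c}" using assms(2) by auto
  ultimately have "smooth_on {x \<in> D. g x \<in> fst c} (snd c \<circ> f)" by simp
  then show "smooth_on {x \<in> D. g x \<in> fst c} (snd c \<circ> g)"
    by (rule smooth_on_cong) (simp add: assms(2))
qed

lemma smooth_map_from_local:
  assumes "\<And>x. x \<in> D \<Longrightarrow> \<exists>N. open N \<and> x \<in> N \<and> smooth_map_from (D \<inter> N) T \<A> f"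
  shows "smooth_map_from D T \<A> f"
  unfolding smooth_map_from_def
proof (intro conjI ballI)
  show "continuous_map (top_of_set D) T f"
    unfolding continuous_map
  proof (intro conjI allI impI)
    show "f ` topspace (top_of_set D) \<subseteq> topspace T"
      using assms by (force dest: smooth_map_from_in_topspace)
    fix V assume V: "openin T V"
    show "openin (top_of_set D) {x \<in> topspace (top_of_set D). f x \<in> V}"
    proof (subst openin_subopen, intro ballI)
      fix x assume "x \<in> {x \<in> topspace (top_of_set D). f x \<in> V}"
      then have x: "x \<in> D" "f x \<in> V" by auto
      then obtain N where N: "open N" "x \<in> N" "smooth_map_from (D \<inter> N) T \<A> f" using assms by blast
      obtain M where M: "open M" "{y \<in> D \<inter> N. f y \<in> V} = D \<inter> N \<inter> M"
        using continuous_map_preimage_Int_open[OF smooth_map_from_imp_continuous_map[OF N(3)] V] .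
      show "\<exists>W. openin (top_of_set D) W \<and> x \<in> W \<and> W \<subseteq> {x \<in> topspace (top_of_set D). f x \<in> V}"
        using M N x by (intro exI[of _ "D \<inter> (N \<inter> M)"]) (auto simp: openin_open_Int)
    qed
  qed
  fix c assume c: "c \<in> \<A>"
  show "smooth_on {x \<in> D. f x \<in> fst c} (snd c \<circ> f)"
  proof (rule smooth_on_local)
    fix x assume "x \<in> {x \<in> D. f x \<in> fst c}"
    then obtain N where N: "open N" "x \<in> N" "smooth_map_from (D \<inter> N) T \<A> f" using assms by blast
    moreover have "{x \<in> D. f x \<in> fst c} \<inter> N = {x \<in> D \<inter> N. f x \<in> fst c}" by auto
    ultimately show "\<exists>N. open N \<and> x \<in> N \<and> smooth_on ({x \<in> D. f x \<in> fst c} \<inter> N) (snd c \<circ> f)"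
      using smooth_map_from_def[of "D \<inter> N" T \<A> f] c by (intro exI[of _ N]) simp
  qed
qed

lemma smooth_map_from_const: "p \<in> topspace T \<Longrightarrow> smooth_map_from D T \<A> (\<lambda>x. p)"
  by (auto simp: smooth_map_from_def comp_def intro: smooth_on_const)

lemma smooth_map_from_compose:
  fixes f :: "'b::euclidean_space \<Rightarrow> 'a"
  assumes f: "smooth_map_from D' T \<A> f" and \<sigma>: "smooth_on D \<sigma>" and sub: "\<sigma> ` D \<subseteq> D'"
  shows "smooth_map_from D T \<A> (\<lambda>x. f (\<sigma> x))"
  unfolding smooth_map_from_def
proof (intro conjI ballI)
  have "continuous_map (top_of_set D) (top_of_set D') \<sigma>"
    using smooth_on_imp_continuous_on[OF \<sigma>] sub by (auto simp: continuous_map_in_subtopology)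
  from continuous_map_compose[OF this smooth_map_from_imp_continuous_map[OF f]]
  show "continuous_map (top_of_set D) T (\<lambda>x. f (\<sigma> x))" by (simp add: comp_def)
  fix c assume c: "c \<in> \<A>"
  have "smooth_on {x \<in> D. f (\<sigma> x) \<in> fst c} (\<lambda>x. (\<lambda>y. snd c (f y)) (\<sigma> x))"
    by (rule smooth_on_compose[OF smooth_on_subset[OF \<sigma>] smooth_map_from_smooth_on[OF f c]])
      (use sub in auto)
  then show "smooth_on {x \<in> D. f (\<sigma> x) \<in> fst c} (snd c \<circ> (\<lambda>x. f (\<sigma> x)))" by (simp add: comp_def)
qed

context smooth_manifold
begin

lemma topspace_chart: "c \<in> \<A> \<Longrightarrow> topspace (subtopology T (fst c)) = fst c"
  using openin_subset[OF chart_domain_open, of c] unfolding topspace_subtopology by blast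

lemma chart_domain_subset: "c \<in> \<A> \<Longrightarrow> fst c \<subseteq> topspace T"
  using chart_domain_open openin_subset by blast

lemma chart_inj: "c \<in> \<A> \<Longrightarrow> inj_on (snd c) (fst c)"
  using chart_homeomorphic[of c] homeomorphic_imp_injective_map topspace_chart[of c] by metis

lemma chart_inv_chart: "c \<in> \<A> \<Longrightarrow> p \<in> fst c \<Longrightarrow> chart_inv c (snd c p) = p"
  by (simp add: chart_inv_def chart_inj)

lemma chart_chart_inv: "x \<in> snd c ` fst c \<Longrightarrow> snd c (chart_inv c x) = x"
  by (simp add: chart_inv_def f_inv_into_f)

lemma chart_inv_in: "x \<in> snd c ` fst c \<Longrightarrow> chart_inv c x \<in> fst c"
  by (simp add: chart_inv_def inv_into_into)

lemma chart_at: "p \<in> topspace T \<Longrightarrow> \<exists>c. c \<in> charts_at \<A> p"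
  using chart_cover unfolding charts_at_def by blast

lemma continuous_map_chart_inv:
  assumes c: "c \<in> \<A>"
  shows "continuous_map (top_of_set (snd c ` fst c)) T (chart_inv c)"
proof -
  obtain h where h: "homeomorphic_maps (subtopology T (fst c)) (top_of_set (snd c ` fst c)) (snd c) h"
    using chart_homeomorphic[OF c] homeomorphic_map_maps by blast
  then have "continuous_map (top_of_set (snd c ` fst c)) T h"
    by (auto simp: homeomorphic_maps_def continuous_map_in_subtopology)
  moreover have "h x = chart_inv c x" if "x \<in> snd c ` fst c" for x
    using h that topspace_chart[OF c] chart_inv_chart[OF c] by (auto simp: homeomorphic_maps_def)
  ultimately show ?thesis by (rule continuous_map_eq) simp
qed

text \<open>Smoothness of the transition maps, read as smoothness of an inverse chart as a map into
  the manifold.\<close>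

lemma smooth_map_from_chart_inv:
  assumes c: "c \<in> \<A>"
  shows "smooth_map_from (snd c ` fst c) T \<A> (chart_inv c)"
  unfolding smooth_map_from_def
proof (intro conjI ballI continuous_map_chart_inv[OF c])
  fix d assume "d \<in> \<A>"
  then have "smooth_on (snd c ` (fst c \<inter> fst d)) (snd d \<circ> chart_inv c)"
    using transition_smooth[OF c] by blast
  moreover have "snd c ` (fst c \<inter> fst d) = {x \<in> snd c ` fst c. chart_inv c x \<in> fst d}"
    using chart_inv_chart[OF c] by auto
  ultimately show "smooth_on {x \<in> snd c ` fst c. chart_inv c x \<in> fst d} (snd d \<circ> chart_inv c)" by simp
qed

end

text \<open>Maps between manifolds are tested on inverse charts, so smoothness of translations and
  conjugations reduces to the closure of \<open>smooth_map_from\<close> under the group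
  operations.\<close>

lemma smooth_mapI:
  assumes "smooth_manifold T \<A>" "continuous_map T T' f"
    "\<And>c. c \<in> \<A> \<Longrightarrow> smooth_map_from (snd c ` fst c) T' \<B> (\<lambda>x. f (chart_inv c x))"
  shows "smooth_map T \<A> T' \<B> f"
  unfolding smooth_map_def
proof (intro conjI ballI assms)
  interpret smooth_manifold T \<A> by fact
  fix c d assume c: "c \<in> \<A>" and d: "d \<in> \<B>"
  have "snd c ` {p \<in> fst c. f p \<in> fst d} = {x \<in> snd c ` fst c. f (chart_inv c x) \<in> fst d}"
    using chart_inv_chart[OF c] by auto
  then show "smooth_on (snd c ` {p \<in> fst c. f p \<in> fst d}) (snd d \<circ> f \<circ> chart_inv c)"
    using smooth_map_from_smooth_on[OF assms(3)[OF c] d] by (simp add: comp_def)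
qed

section \<open>Group operations applied to smooth maps from Euclidean sets\<close>

context Lie_group
begin

lemma smooth_map_from_carrier: "smooth_map_from D T \<A> f \<Longrightarrow> x \<in> D \<Longrightarrow> f x \<in> carrier G"
  by (simp add: carrier_topspace smooth_map_from_in_topspace)

text \<open>Near a given point both factors stay in single charts \<open>c\<close> and
  \<open>d\<close>. There the product is the expression of multiplication in the product chart,
  composed with the pair of coordinate functions.\<close>

lemma smooth_map_from_mult:
  assumes f: "smooth_map_from D T \<A> f" and g: "smooth_map_from D T \<A> g"
  shows "smooth_map_from D T \<A> (\<lambda>x. f x \<otimes> g x)"
  unfolding smooth_map_from_def
proof (intro conjI ballI)
  have "continuous_map (top_of_set D) (prod_topology T T) (\<lambda>x. (f x, g x))"
    using f g by (simp add: smooth_map_from_def continuous_map_paired)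
  from continuous_map_compose[OF this mult_smooth[unfolded smooth_map_def, THEN conjunct1]]
  show "continuous_map (top_of_set D) T (\<lambda>x. f x \<otimes> g x)" by (simp add: comp_def)
  fix e assume e: "e \<in> \<A>"
  show "smooth_on {x \<in> D. f x \<otimes> g x \<in> fst e} (snd e \<circ> (\<lambda>x. f x \<otimes> g x))"
  proof (rule smooth_on_local)
    fix x assume x: "x \<in> {x \<in> D. f x \<otimes> g x \<in> fst e}"
    then obtain c d where c: "c \<in> \<A>" "f x \<in> fst c" and d: "d \<in> \<A>" "g x \<in> fst d"
      using chart_at[OF smooth_map_from_in_topspace[OF f, of x]] chart_at[OF smooth_map_from_in_topspace[OF g, of x]]
      by (auto simp: charts_at_def)
    obtain N where N: "open N" "{x \<in> D. f x \<in> fst c} = D \<inter> N"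
      using continuous_map_preimage_Int_open[OF smooth_map_from_imp_continuous_map[OF f] chart_domain_open[OF c(1)]] .
    obtain M where M: "open M" "{x \<in> D. g x \<in> fst d} = D \<inter> M"
      using continuous_map_preimage_Int_open[OF smooth_map_from_imp_continuous_map[OF g] chart_domain_open[OF d(1)]] .
    define cd where "cd = (fst c \<times> fst d, map_prod (snd c) (snd d))"
    have cd_inv: "chart_inv cd (snd c a, snd d b) = (a, b)" if "a \<in> fst c" "b \<in> fst d" for a b
    proof -
      have "inj_on (map_prod (snd c) (snd d)) (fst c \<times> fst d)"
        by (rule map_prod_inj_on[OF chart_inj[OF c(1)] chart_inj[OF d(1)]])
      then have "chart_inv cd (map_prod (snd c) (snd d) (a, b)) = (a, b)"
        unfolding chart_inv_def cd_def fst_conv snd_conv by (rule inv_into_f_f) (use that in simp)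
      then show ?thesis by simp
    qed
    define S where "S = {x \<in> D. f x \<otimes> g x \<in> fst e} \<inter> (N \<inter> M)"
    have S: "f y \<in> fst c" "g y \<in> fst d" "y \<in> D" "f y \<otimes> g y \<in> fst e" if "y \<in> S" for y
      using that N M by (auto simp: S_def)
    have "cd \<in> prod_atlas \<A> \<A>" using c d by (force simp: prod_atlas_def cd_def)
    then have m: "smooth_on (snd cd ` {p \<in> fst cd. (\<lambda>(x, y). x \<otimes> y) p \<in> fst e}) (snd e \<circ> (\<lambda>(x, y). x \<otimes> y) \<circ> chart_inv cd)"
      by (rule mult_smooth[unfolded smooth_map_def, THEN conjunct2, rule_format, OF _ e])
    have "smooth_on S (\<lambda>y. (snd c (f y), snd d (g y)))"
      using S by (intro smooth_on_Pair smooth_on_subset[OF smooth_map_from_smooth_on[OF f c(1)]]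
        smooth_on_subset[OF smooth_map_from_smooth_on[OF g d(1)]]) auto
    from smooth_on_compose[OF this m] have "smooth_on S (\<lambda>y. (snd e \<circ> (\<lambda>(x, y). x \<otimes> y) \<circ> chart_inv cd) (snd c (f y), snd d (g y)))"
      using S by (force simp: cd_def)
    then have "smooth_on S (snd e \<circ> (\<lambda>x. f x \<otimes> g x))"
      by (rule smooth_on_cong) (simp add: cd_inv S)
    then show "\<exists>N. open N \<and> x \<in> N \<and> smooth_on ({x \<in> D. f x \<otimes> g x \<in> fst e} \<inter> N) (snd e \<circ> (\<lambda>x. f x \<otimes> g x))"
      using x c d N M by (intro exI[of _ "N \<inter> M"]) (auto simp: S_def)
  qed
qed

lemma smooth_map_from_inv:
  assumes f: "smooth_map_from D T \<A> f"
  shows "smooth_map_from D T \<A> (\<lambda>x. inv (f x))"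
  unfolding smooth_map_from_def
proof (intro conjI ballI)
  from continuous_map_compose[OF smooth_map_from_imp_continuous_map[OF f] inv_smooth[unfolded smooth_map_def, THEN conjunct1]]
  show "continuous_map (top_of_set D) T (\<lambda>x. inv (f x))" by (simp add: comp_def)
  fix e assume e: "e \<in> \<A>"
  show "smooth_on {x \<in> D. inv (f x) \<in> fst e} (snd e \<circ> (\<lambda>x. inv (f x)))"
  proof (rule smooth_on_local)
    fix x assume x: "x \<in> {x \<in> D. inv (f x) \<in> fst e}"
    then obtain c where c: "c \<in> \<A>" "f x \<in> fst c"
      using chart_at[OF smooth_map_from_in_topspace[OF f, of x]] by (auto simp: charts_at_def)
    obtain N where N: "open N" "{x \<in> D. f x \<in> fst c} = D \<inter> N"
      using continuous_map_preimage_Int_open[OF smooth_map_from_imp_continuous_map[OF f] chart_domain_open[OF c(1)]] .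
    define S where "S = {x \<in> D. inv (f x) \<in> fst e} \<inter> N"
    have S: "f y \<in> fst c" "y \<in> D" "inv (f y) \<in> fst e" if "y \<in> S" for y
      using that N by (auto simp: S_def)
    have m: "smooth_on (snd c ` {p \<in> fst c. inv p \<in> fst e}) (snd e \<circ> (\<lambda>x. inv x) \<circ> chart_inv c)"
      using inv_smooth[unfolded smooth_map_def, THEN conjunct2, rule_format, OF c(1) e] .
    have "smooth_on S (\<lambda>y. snd c (f y))"
      using S by (intro smooth_on_subset[OF smooth_map_from_smooth_on[OF f c(1)]]) auto
    from smooth_on_compose[OF this m] have "smooth_on S (\<lambda>y. (snd e \<circ> (\<lambda>x. inv x) \<circ> chart_inv c) (snd c (f y)))"
      using S by force
    then have "smooth_on S (snd e \<circ> (\<lambda>x. inv (f x)))"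
      by (rule smooth_on_cong) (simp add: chart_inv_chart[OF c(1)] S)
    then show "\<exists>N. open N \<and> x \<in> N \<and> smooth_on ({x \<in> D. inv (f x) \<in> fst e} \<inter> N) (snd e \<circ> (\<lambda>x. inv (f x)))"
      using x c N by (intro exI[of _ N]) (auto simp: S_def)
  qed
qed

lemma continuous_map_mult:
  assumes "continuous_map X T f" "continuous_map X T g"
  shows "continuous_map X T (\<lambda>x. f x \<otimes> g x)"
proof -
  have "continuous_map X (prod_topology T T) (\<lambda>x. (f x, g x))"
    using assms by (simp add: continuous_map_paired)
  from continuous_map_compose[OF this mult_smooth[unfolded smooth_map_def, THEN conjunct1]]
  show ?thesis by (simp add: comp_def)
qed

lemma continuous_map_inv:
  assumes "continuous_map X T f"
  shows "continuous_map X T (\<lambda>x. inv (f x))"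
  using continuous_map_compose[OF assms inv_smooth[unfolded smooth_map_def, THEN conjunct1]]
  by (simp add: comp_def)

lemma smooth_map_left_translation: "h \<in> carrier G \<Longrightarrow> smooth_map T \<A> T \<A> (\<lambda>x. h \<otimes> x)"
  by (intro smooth_mapI continuous_map_mult smooth_map_from_mult smooth_map_from_const
      smooth_map_from_chart_inv) (auto simp: carrier_topspace smooth_manifold_axioms)

lemma smooth_map_right_translation: "h \<in> carrier G \<Longrightarrow> smooth_map T \<A> T \<A> (\<lambda>x. x \<otimes> h)"
  by (intro smooth_mapI continuous_map_mult smooth_map_from_mult smooth_map_from_const
      smooth_map_from_chart_inv) (auto simp: carrier_topspace smooth_manifold_axioms)

end

section \<open>Velocities of curves\<close>

lemma has_vector_derivative_localize:
  assumes "(f has_vector_derivative w) (at s within J)" "open N" "s \<in> N" "s \<in> J"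
    and "\<And>t. t \<in> J \<Longrightarrow> t \<in> N \<Longrightarrow> f t = g t"
  shows "(g has_vector_derivative w) (at s within J)"
proof -
  have eq: "at s within J = at s within (J \<inter> N)"
    using assms(2,3) by (intro at_within_nhd[of s N]) auto
  show ?thesis
    using assms(1) unfolding eq
    by (rule has_vector_derivative_transform[rotated 2]) (use assms(3-5) in auto)
qed

lemma smooth_on_has_vector_derivative:
  assumes "smooth_on J f" "s \<in> J"
  shows "\<exists>w. (f has_vector_derivative w) (at s within J)"
proof -
  obtain U F where U: "open U" "s \<in> U" "\<forall>k. Ck_on k F U" "\<forall>y\<in>J \<inter> U. F y = f y"
    by (rule smooth_onE[OF assms])
  then have "F differentiable (at s)" using Ck_on.simps(2)[of 0 F U] by blast
  then have "(F has_vector_derivative vector_derivative F (at s)) (at s within J)"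
    using vector_derivative_works has_vector_derivative_at_within by blast
  then have "(f has_vector_derivative vector_derivative F (at s)) (at s within J)"
    by (rule has_vector_derivative_localize[OF _ U(1,2) assms(2)]) (use U in auto)
  then show ?thesis by blast
qed

context smooth_manifold
begin

lemma curve_in_chart_nhd:
  assumes "smooth_map_from J T \<A> \<alpha>" "s \<in> J" "c \<in> charts_at \<A> (\<alpha> s)"
  obtains N where "open N" "s \<in> N" "\<And>t. t \<in> J \<Longrightarrow> t \<in> N \<Longrightarrow> \<alpha> t \<in> fst c"
proof -
  have c: "c \<in> \<A>" "\<alpha> s \<in> fst c" using assms(3) by (auto simp: charts_at_def)
  obtain N where "open N" "{x \<in> J. \<alpha> x \<in> fst c} = J \<inter> N"
    using continuous_map_preimage_Int_open[OF smooth_map_from_imp_continuous_map[OF assms(1)] chart_domain_open[OF c(1)]] .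
  then show thesis using that[of N] c assms(2) by blast
qed

lemma chart_image_openin:
  assumes c: "c \<in> \<A>" and W: "openin T W" "W \<subseteq> fst c"
  shows "open (snd c ` W)"
proof -
  obtain N where N: "open N" "{x \<in> snd c ` fst c. chart_inv c x \<in> W} = snd c ` fst c \<inter> N"
    using continuous_map_preimage_Int_open[OF continuous_map_chart_inv[OF c] W(1)] .
  moreover have "{x \<in> snd c ` fst c. chart_inv c x \<in> W} = snd c ` W"
    using W(2) chart_inv_chart[OF c] by (auto simp: subset_iff)
  ultimately show ?thesis using chart_image_open[OF c] by auto
qed

text \<open>\<open>vector_derivative\<close> is determined only along a nontrivial filter. Stated
  for \<open>at s within J\<close>, the lemma serves two-sided and one-sided velocities
  alike.\<close>

lemma velocity_has_vector_derivative:
  assumes \<alpha>: "smooth_map_from J T \<A> \<alpha>" "s \<in> J" and ntriv: "at s within J \<noteq> bot"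
    and c: "c \<in> charts_at \<A> (\<alpha> s)"
  shows "((\<lambda>t. snd c (\<alpha> t)) has_vector_derivative velocity \<A> \<alpha> s (at s within J) c) (at s within J)"
proof -
  have c': "c \<in> \<A>" "\<alpha> s \<in> fst c" using c by (auto simp: charts_at_def)
  obtain N where N: "open N" "s \<in> N" "\<And>t. t \<in> J \<Longrightarrow> t \<in> N \<Longrightarrow> \<alpha> t \<in> fst c"
    using curve_in_chart_nhd[OF \<alpha> c] by blast
  have eq: "at s within J = at s within {t \<in> J. \<alpha> t \<in> fst c}"
    using N by (intro at_within_nhd[of s N]) auto
  obtain w where "((\<lambda>t. snd c (\<alpha> t)) has_vector_derivative w) (at s within J)"
    using smooth_on_has_vector_derivative[OF smooth_map_from_smooth_on[OF \<alpha>(1) c'(1)], of s] \<alpha>(2) c'(2)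
    unfolding eq by auto
  then have "(\<lambda>t. snd c (\<alpha> t)) differentiable (at s within J)" by (rule differentiableI_vector)
  from this[unfolded vector_derivative_works] show ?thesis using c by (simp add: velocity_def comp_def)
qed

lemma velocity_eqI:
  assumes "((\<lambda>t. snd c (\<alpha> t)) has_vector_derivative w) (at s within J)" "at s within J \<noteq> bot"
    "c \<in> charts_at \<A> (\<alpha> s)"
  shows "velocity \<A> \<alpha> s (at s within J) c = w"
  using vector_derivative_within[OF assms(2,1)] assms(3) unfolding velocity_def comp_def by simp

lemma smooth_map_chart_has_derivative:
  assumes f: "smooth_map T \<A> T' \<B> f" and B: "\<And>d. d \<in> \<B> \<Longrightarrow> openin T' (fst d)"
    and c: "c \<in> charts_at \<A> p" and d: "d \<in> charts_at \<B> (f p)"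
  shows "((snd d \<circ> f \<circ> chart_inv c) has_derivative
      frechet_derivative (snd d \<circ> f \<circ> chart_inv c) (at (snd c p))) (at (snd c p))"
proof (rule smooth_on_open_has_derivative)
  have c': "c \<in> \<A>" "p \<in> fst c" using c by (auto simp: charts_at_def)
  have d': "d \<in> \<B>" "f p \<in> fst d" using d by (auto simp: charts_at_def)
  have "openin T (fst c \<inter> {x \<in> topspace T. f x \<in> fst d})"
    using f B[OF d'(1)] chart_domain_open[OF c'(1)]
    by (intro openin_Int openin_continuous_map_preimage) (auto simp: smooth_map_def)
  moreover have "fst c \<inter> {x \<in> topspace T. f x \<in> fst d} = {p \<in> fst c. f p \<in> fst d}"
    using chart_domain_subset[OF c'(1)] by auto
  ultimately show "open (snd c ` {p \<in> fst c. f p \<in> fst d})"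
    using chart_image_openin[OF c'(1)] by auto
  show "smooth_on (snd c ` {p \<in> fst c. f p \<in> fst d}) (snd d \<circ> f \<circ> chart_inv c)"
    using f c' d' by (auto simp: smooth_map_def)
  show "snd c p \<in> snd c ` {p \<in> fst c. f p \<in> fst d}" using c' d' by auto
qed

text \<open>The chain rule in charts. For the identity map it is the transformation law of
  velocities, for a general map it describes the differential.\<close>

lemma smooth_map_velocity_chart:
  assumes f: "smooth_map T \<A> T' \<B> f" and B: "\<And>d. d \<in> \<B> \<Longrightarrow> openin T' (fst d)"
    and \<alpha>: "smooth_map_from J T \<A> \<alpha>" "s \<in> J" and ntriv: "at s within J \<noteq> bot"
    and c: "c \<in> charts_at \<A> (\<alpha> s)" and d: "d \<in> charts_at \<B> (f (\<alpha> s))"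
  shows "velocity \<B> (\<lambda>t. f (\<alpha> t)) s (at s within J) d =
    frechet_derivative (snd d \<circ> f \<circ> chart_inv c) (at (snd c (\<alpha> s))) (velocity \<A> \<alpha> s (at s within J) c)"
proof -
  let ?D = "frechet_derivative (snd d \<circ> f \<circ> chart_inv c) (at (snd c (\<alpha> s)))"
  let ?v = "velocity \<A> \<alpha> s (at s within J) c"
  have c': "c \<in> \<A>" using c by (auto simp: charts_at_def)
  obtain N where N: "open N" "s \<in> N" "\<And>t. t \<in> J \<Longrightarrow> t \<in> N \<Longrightarrow> \<alpha> t \<in> fst c"
    using curve_in_chart_nhd[OF \<alpha> c] by blast
  note D = smooth_map_chart_has_derivative[OF f B c d]
  have lin: "linear ?D" using D has_derivative_linear by blast
  have "((\<lambda>t. snd c (\<alpha> t)) has_derivative (\<lambda>h. h *\<^sub>R ?v)) (at s within J)"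
    using velocity_has_vector_derivative[OF \<alpha> ntriv c] by (simp add: has_vector_derivative_def)
  from has_derivative_compose[OF this D]
  have "((\<lambda>t. (snd d \<circ> f \<circ> chart_inv c) (snd c (\<alpha> t))) has_vector_derivative ?D ?v) (at s within J)"
    by (simp add: has_vector_derivative_def linear_scale[OF lin])
  then have "((\<lambda>t. snd d (f (\<alpha> t))) has_vector_derivative ?D ?v) (at s within J)"
    by (rule has_vector_derivative_localize[OF _ N(1,2) \<alpha>(2)]) (simp add: chart_inv_chart[OF c'] N)
  from vector_derivative_within[OF ntriv this] show ?thesis using d by (simp add: velocity_def comp_def)
qed

lemma smooth_map_ident: "smooth_map T \<A> T \<A> (\<lambda>x. x)"
  by (intro smooth_mapI smooth_map_from_chart_inv smooth_manifold_axioms) auto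

lemma velocity_tangent_space:
  assumes \<alpha>: "smooth_map_from J T \<A> \<alpha>" "s \<in> J" and ntriv: "at s within J \<noteq> bot"
  shows "velocity \<A> \<alpha> s (at s within J) \<in> tangent_space \<A> (\<alpha> s)"
proof -
  have "velocity \<A> \<alpha> s (at s within J) d = transition_deriv c d (\<alpha> s) (velocity \<A> \<alpha> s (at s within J) c)"
    if "c \<in> charts_at \<A> (\<alpha> s)" "d \<in> charts_at \<A> (\<alpha> s)" for c d
    using smooth_map_velocity_chart[OF smooth_map_ident chart_domain_open \<alpha> ntriv that]
    unfolding transition_deriv_def comp_def .
  moreover have "velocity \<A> \<alpha> s (at s within J) c = 0" if "c \<notin> charts_at \<A> (\<alpha> s)" for c
    using that unfolding velocity_def by simp
  ultimately show ?thesis unfolding tangent_space_def by blast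
qed

lemma tangent_space_eq_tvec_of_coords:
  assumes "v \<in> tangent_space \<A> p" "c \<in> charts_at \<A> p"
  shows "v = tvec_of_coords \<A> c p (v c)"
proof
  fix d
  have "d \<in> charts_at \<A> p \<Longrightarrow> v d = transition_deriv c d p (v c)" "d \<notin> charts_at \<A> p \<Longrightarrow> v d = 0"
    using assms unfolding tangent_space_def by blast+
  then show "v d = tvec_of_coords \<A> c p (v c) d"
    unfolding tvec_of_coords_def by argo
qed

lemma differential_velocity:
  assumes f: "smooth_map T \<A> T' \<B> f" and B: "\<And>d. d \<in> \<B> \<Longrightarrow> openin T' (fst d)"
    and \<alpha>: "smooth_map_from J T \<A> \<alpha>" "s \<in> J" and ntriv: "at s within J \<noteq> bot"
  shows "differential \<A> \<B> f (\<alpha> s) (velocity \<A> \<alpha> s (at s within J)) =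
    velocity \<B> (\<lambda>t. f (\<alpha> t)) s (at s within J)"
proof
  fix d
  define c where "c = (SOME c. c \<in> charts_at \<A> (\<alpha> s))"
  have c: "c \<in> charts_at \<A> (\<alpha> s)"
    unfolding c_def using chart_at[OF smooth_map_from_in_topspace[OF \<alpha>]] by (rule someI_ex)
  show "differential \<A> \<B> f (\<alpha> s) (velocity \<A> \<alpha> s (at s within J)) d =
    velocity \<B> (\<lambda>t. f (\<alpha> t)) s (at s within J) d"
  proof (cases "d \<in> charts_at \<B> (f (\<alpha> s))")
    case True
    then show ?thesis using smooth_map_velocity_chart[OF f B \<alpha> ntriv c True]
      by (simp add: differential_def c_def Let_def)
  qed (simp add: differential_def velocity_def)
qed

text \<open>The coordinate line through \<open>p\<close> in direction \<open>e\<close> realizes a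
  prescribed tangent vector as a velocity, so that statements about tangent vectors can be proved
  along curves.\<close>

lemma coordinate_curve:
  assumes c: "c \<in> charts_at \<A> p"
  obtains \<delta> where "\<delta> > 0" "smooth_map_from {0..\<delta>} T \<A> (\<lambda>t. chart_inv c (snd c p + t *\<^sub>R e))"
    "\<And>t. t \<in> {0..\<delta>} \<Longrightarrow> snd c (chart_inv c (snd c p + t *\<^sub>R e)) = snd c p + t *\<^sub>R e"
    "velocity \<A> (\<lambda>t. chart_inv c (snd c p + t *\<^sub>R e)) 0 (at 0 within {0..\<delta>}) = tvec_of_coords \<A> c p e"
proof -
  have c': "c \<in> \<A>" "p \<in> fst c" using c by (auto simp: charts_at_def)
  let ?\<alpha> = "\<lambda>t. chart_inv c (snd c p + t *\<^sub>R e)"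
  have "continuous_on UNIV (\<lambda>t::real. snd c p + t *\<^sub>R e)" by (intro continuous_intros)
  then have o: "open ((\<lambda>t::real. snd c p + t *\<^sub>R e) -` (snd c ` fst c))"
    using chart_image_open[OF c'(1)] open_vimage by blast
  have "0 \<in> (\<lambda>t::real. snd c p + t *\<^sub>R e) -` (snd c ` fst c)" using c' by simp
  then obtain \<delta> where \<delta>: "\<delta> > 0" "cball 0 \<delta> \<subseteq> (\<lambda>t::real. snd c p + t *\<^sub>R e) -` (snd c ` fst c)"
    using o unfolding open_contains_cball by blast
  have in_chart: "snd c p + t *\<^sub>R e \<in> snd c ` fst c" if "t \<in> {0..\<delta>}" for t
    using \<delta>(2) that by (auto simp: subset_iff)
  have ntriv: "at 0 within {0..\<delta>} \<noteq> bot"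
    using \<delta>(1) by (simp add: at_within_Icc_at_right)
  have smooth: "smooth_map_from {0..\<delta>} T \<A> ?\<alpha>"
    using in_chart
    by (intro smooth_map_from_compose[OF smooth_map_from_chart_inv[OF c'(1)]] smooth_on_add smooth_on_const
        smooth_on_bounded_linear bounded_linear_scaleR_left) auto
  have p: "?\<alpha> 0 = p" using chart_inv_chart[OF c'] by simp
  have eq: "snd c (?\<alpha> t) = snd c p + t *\<^sub>R e" if "t \<in> {0..\<delta>}" for t
    using chart_chart_inv[OF in_chart[OF that]] .
  have "((\<lambda>t. snd c p + t *\<^sub>R e) has_vector_derivative e) (at 0 within {0..\<delta>})"
    by (auto intro!: derivative_eq_intros)
  then have "((\<lambda>t. snd c (?\<alpha> t)) has_vector_derivative e) (at 0 within {0..\<delta>})"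
    by (rule has_vector_derivative_localize[of _ _ _ _ UNIV]) (use \<delta>(1) eq in auto)
  then have "velocity \<A> ?\<alpha> 0 (at 0 within {0..\<delta>}) c = e"
    by (rule velocity_eqI[OF _ ntriv]) (use c p in simp)
  moreover have "velocity \<A> ?\<alpha> 0 (at 0 within {0..\<delta>}) \<in> tangent_space \<A> p"
    using velocity_tangent_space[OF smooth _ ntriv] \<delta>(1) p by auto
  ultimately have "velocity \<A> ?\<alpha> 0 (at 0 within {0..\<delta>}) = tvec_of_coords \<A> c p e"
    using tangent_space_eq_tvec_of_coords[OF _ c] by (metis (no_types))
  with \<delta>(1) smooth eq show thesis by (rule that)
qed

text \<open>The cocycle rule for transition derivatives comes for free: the vector is a velocity,
  and velocities are tangent.\<close>

lemma tvec_of_coords_tangent_space: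
  assumes "c \<in> charts_at \<A> p"
  shows "tvec_of_coords \<A> c p e \<in> tangent_space \<A> p"
proof -
  obtain \<delta> where \<delta>: "\<delta> > 0" "smooth_map_from {0..\<delta>} T \<A> (\<lambda>t. chart_inv c (snd c p + t *\<^sub>R e))"
    "velocity \<A> (\<lambda>t. chart_inv c (snd c p + t *\<^sub>R e)) 0 (at 0 within {0..\<delta>}) = tvec_of_coords \<A> c p e"
    using coordinate_curve[OF assms] by metis
  have "chart_inv c (snd c p) = p" using assms chart_inv_chart by (auto simp: charts_at_def)
  then show ?thesis
    using velocity_tangent_space[OF \<delta>(2), of 0] \<delta> by (simp add: at_within_Icc_at_right)
qed

lemma linear_transition_deriv:
  assumes "c \<in> charts_at \<A> p" "d \<in> charts_at \<A> p"
  shows "linear (transition_deriv c d p)"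
  using has_derivative_linear[OF smooth_map_chart_has_derivative[OF smooth_map_ident chart_domain_open assms]]
  unfolding transition_deriv_def comp_def .

lemma tvec_of_coords_lincomb:
  assumes "c \<in> charts_at \<A> p"
  shows "tvec_of_coords \<A> c p (a *\<^sub>R e + b *\<^sub>R e') =
    tvec_lincomb a (tvec_of_coords \<A> c p e) b (tvec_of_coords \<A> c p e')"
proof
  fix d
  show "tvec_of_coords \<A> c p (a *\<^sub>R e + b *\<^sub>R e') d =
      tvec_lincomb a (tvec_of_coords \<A> c p e) b (tvec_of_coords \<A> c p e') d"
    using linear_transition_deriv[OF assms, of d]
    by (simp add: tvec_of_coords_def tvec_lincomb_def linear_add linear_scale)
qed

lemma tvec_of_coords_chart:
  assumes "c \<in> charts_at \<A> p"
  shows "tvec_of_coords \<A> c p e c = e"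
proof -
  have c': "c \<in> \<A>" "p \<in> fst c" using assms by (auto simp: charts_at_def)
  have "((\<lambda>x. x) has_derivative (\<lambda>x. x)) (at (snd c p))" by (rule has_derivative_ident)
  then have "((snd c \<circ> chart_inv c) has_derivative (\<lambda>x. x)) (at (snd c p))"
    by (rule has_derivative_transform_within_open[OF _ chart_image_open[OF c'(1)]])
      (use c' chart_chart_inv[of _ c] in auto)
  then have "transition_deriv c c p = (\<lambda>x. x)"
    unfolding transition_deriv_def by (rule frechet_derivative_at[symmetric])
  then show ?thesis using assms by (simp add: tvec_of_coords_def)
qed

end

context Lie_group
begin

lemma left_invariant_form_velocity:
  assumes \<omega>: "left_invariant_form G \<A> \<omega>" and h: "h \<in> carrier G"
    and \<alpha>: "smooth_map_from J T \<A> \<alpha>" "s \<in> J" and ntriv: "at s within J \<noteq> bot"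
  shows "\<omega> (h \<otimes> \<alpha> s) (velocity \<A> (\<lambda>t. h \<otimes> \<alpha> t) s (at s within J)) =
    \<omega> (\<alpha> s) (velocity \<A> \<alpha> s (at s within J))"
  using \<omega>[unfolded left_invariant_form_def, rule_format, OF h smooth_map_from_carrier[OF \<alpha>] velocity_tangent_space[OF \<alpha> ntriv]]
  by (simp add: differential_velocity[OF smooth_map_left_translation[OF h] chart_domain_open \<alpha> ntriv])

text \<open>The two curves only have to meet at one point and may have different parameter sets;
  this allows both arguments of the metric to vary independently.\<close>

lemma bi_invariant_metric_velocity:
  assumes g: "bi_invariant_metric G \<A> g" and h: "h \<in> carrier G"
    and \<alpha>: "smooth_map_from J T \<A> \<alpha>" "s \<in> J" and ntriv: "at s within J \<noteq> bot"
    and \<beta>: "smooth_map_from J' T \<A> \<beta>" "s' \<in> J'" and ntriv': "at s' within J' \<noteq> bot"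
    and eq: "\<alpha> s = \<beta> s'"
  shows "g (h \<otimes> \<alpha> s) (velocity \<A> (\<lambda>t. h \<otimes> \<alpha> t) s (at s within J))
        (velocity \<A> (\<lambda>t. h \<otimes> \<beta> t) s' (at s' within J')) =
      g (\<alpha> s) (velocity \<A> \<alpha> s (at s within J)) (velocity \<A> \<beta> s' (at s' within J'))" (is ?L)
    and "g (\<alpha> s \<otimes> h) (velocity \<A> (\<lambda>t. \<alpha> t \<otimes> h) s (at s within J))
        (velocity \<A> (\<lambda>t. \<beta> t \<otimes> h) s' (at s' within J')) =
      g (\<alpha> s) (velocity \<A> \<alpha> s (at s within J)) (velocity \<A> \<beta> s' (at s' within J'))" (is ?R)
proof -
  note t = smooth_map_from_carrier[OF \<alpha>] velocity_tangent_space[OF \<alpha> ntriv]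
    velocity_tangent_space[OF \<beta> ntriv', folded eq]
  note gD = g[unfolded bi_invariant_metric_def, rule_format, OF h t]
  show ?L
    using gD[THEN conjunct1]
      differential_velocity[OF smooth_map_left_translation[OF h] chart_domain_open \<alpha> ntriv]
      differential_velocity[OF smooth_map_left_translation[OF h] chart_domain_open \<beta> ntriv', folded eq]
    by simp
  show ?R
    using gD[THEN conjunct2]
      differential_velocity[OF smooth_map_right_translation[OF h] chart_domain_open \<alpha> ntriv]
      differential_velocity[OF smooth_map_right_translation[OF h] chart_domain_open \<beta> ntriv', folded eq]
    by simp
qed

end

section \<open>Left logarithmic derivatives\<close>

lemma has_vector_derivative_compose_frechet:
  assumes f: "(f has_derivative f') (at (c s))" and c: "(c has_vector_derivative w) (at s within J)"
  shows "((\<lambda>t. f (c t)) has_vector_derivative f' w) (at s within J)"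
proof -
  have "linear f'" using f has_derivative_linear by blast
  then show ?thesis
    using has_derivative_compose[OF c[unfolded has_vector_derivative_def] f]
    by (simp add: has_vector_derivative_def linear_scale)
qed

context Lie_group
begin

section \<open>The group law in a chart around the identity\<close>

definition chart1 where "chart1 = (SOME c. c \<in> charts_at \<A> \<one>)"

definition \<kappa> where "\<kappa> = snd chart1"
definition \<iota> where "\<iota> = chart_inv chart1"
definition U1 where "U1 = fst chart1"
definition E1 where "E1 = \<kappa> ` U1"
definition e0 where "e0 = \<kappa> \<one>"

lemma chart1: "chart1 \<in> charts_at \<A> \<one>"
  unfolding chart1_def by (rule someI_ex, rule chart_at) (simp flip: carrier_topspace)

lemma chart1_atlas: "chart1 \<in> \<A>" and one_U1: "\<one> \<in> U1"
  using chart1 by (auto simp: charts_at_def U1_def)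

lemma open_E1: "open E1"
  using chart_image_open[OF chart1_atlas] by (simp add: E1_def U1_def \<kappa>_def)

lemma openin_U1: "openin T U1"
  using chart_domain_open[OF chart1_atlas] by (simp add: U1_def)

lemma U1_carrier: "p \<in> U1 \<Longrightarrow> p \<in> carrier G"
  using chart_domain_subset[OF chart1_atlas] by (auto simp: carrier_topspace U1_def)

lemma iota_kappa: "p \<in> U1 \<Longrightarrow> \<iota> (\<kappa> p) = p"
  using chart_inv_chart[OF chart1_atlas] by (simp add: U1_def \<kappa>_def \<iota>_def)

lemma kappa_iota: "x \<in> E1 \<Longrightarrow> \<kappa> (\<iota> x) = x"
  using chart_chart_inv[of x chart1] by (simp add: E1_def U1_def \<kappa>_def \<iota>_def)

lemma iota_U1: "x \<in> E1 \<Longrightarrow> \<iota> x \<in> U1"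
  using chart_inv_in[of x chart1] by (simp add: E1_def U1_def \<kappa>_def \<iota>_def)

lemma kappa_E1: "p \<in> U1 \<Longrightarrow> \<kappa> p \<in> E1"
  by (simp add: E1_def)

lemma e0_E1: "e0 \<in> E1"
  by (simp add: e0_def kappa_E1 one_U1)

lemma iota_e0: "\<iota> e0 = \<one>"
  by (simp add: e0_def iota_kappa one_U1)

lemma iota_carrier: "x \<in> E1 \<Longrightarrow> \<iota> x \<in> carrier G"
  by (simp add: U1_carrier iota_U1)

lemma smooth_iota: "smooth_map_from E1 T \<A> \<iota>"
  using smooth_map_from_chart_inv[OF chart1_atlas] by (simp add: E1_def U1_def \<kappa>_def \<iota>_def)

lemma smooth_iota_compose:
  fixes \<sigma> :: "'b::euclidean_space \<Rightarrow> 'e"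
  shows "smooth_on D \<sigma> \<Longrightarrow> \<sigma> ` D \<subseteq> E1 \<Longrightarrow> smooth_map_from D T \<A> (\<lambda>x. \<iota> (\<sigma> x))"
  by (rule smooth_map_from_compose[OF smooth_iota])

lemma smooth_on_kappa:
  "smooth_map_from D T \<A> F \<Longrightarrow> smooth_on {z \<in> D. F z \<in> U1} (\<lambda>z. \<kappa> (F z))"
  using smooth_map_from_smooth_on[OF _ chart1_atlas] by (simp add: U1_def \<kappa>_def)

lemma open_preimage_U1:
  assumes "smooth_map_from D T \<A> F" "open D"
  shows "open {z \<in> D. F z \<in> U1}"
  using continuous_map_preimage_Int_open[OF smooth_map_from_imp_continuous_map[OF assms(1)] openin_U1] assms(2)
  by (metis open_Int)

lemma smooth_map_from_iota_fst_snd: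
  "smooth_map_from (E1 \<times> E1) T \<A> (\<lambda>z. \<iota> (fst z))" "smooth_map_from (E1 \<times> E1) T \<A> (\<lambda>z. \<iota> (snd z))"
  by (auto intro!: smooth_iota_compose smooth_on_bounded_linear bounded_linear_fst bounded_linear_snd)

definition mul_dom where "mul_dom = {z \<in> E1 \<times> E1. \<iota> (fst z) \<otimes> \<iota> (snd z) \<in> U1}"
definition mul where "mul z = \<kappa> (\<iota> (fst z) \<otimes> \<iota> (snd z))"
definition ldiv_dom where "ldiv_dom = {z \<in> E1 \<times> E1. inv (\<iota> (fst z)) \<otimes> \<iota> (snd z) \<in> U1}"
definition ldiv where "ldiv z = \<kappa> (inv (\<iota> (fst z)) \<otimes> \<iota> (snd z))"

lemma open_mul_dom: "open mul_dom"
  unfolding mul_dom_def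
  by (intro open_preimage_U1 smooth_map_from_mult smooth_map_from_iota_fst_snd open_Times open_E1)

lemma smooth_mul: "smooth_on mul_dom mul"
  unfolding mul_dom_def mul_def[abs_def]
  by (intro smooth_on_kappa smooth_map_from_mult smooth_map_from_iota_fst_snd)

lemma open_ldiv_dom: "open ldiv_dom"
  unfolding ldiv_dom_def
  by (intro open_preimage_U1 smooth_map_from_mult smooth_map_from_inv smooth_map_from_iota_fst_snd open_Times open_E1)

lemma smooth_ldiv: "smooth_on ldiv_dom ldiv"
  unfolding ldiv_dom_def ldiv_def[abs_def]
  by (intro smooth_on_kappa smooth_map_from_mult smooth_map_from_inv smooth_map_from_iota_fst_snd)

lemma mul_e0_right: "x \<in> E1 \<Longrightarrow> (x, e0) \<in> mul_dom \<and> mul (x, e0) = x"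
  by (simp add: mul_dom_def mul_def e0_E1 iota_e0 iota_carrier iota_U1 kappa_iota)

lemma mul_e0_left: "x \<in> E1 \<Longrightarrow> (e0, x) \<in> mul_dom \<and> mul (e0, x) = x"
  by (simp add: mul_dom_def mul_def e0_E1 iota_e0 iota_carrier iota_U1 kappa_iota)

lemma ldiv_e0_left: "x \<in> E1 \<Longrightarrow> (e0, x) \<in> ldiv_dom \<and> ldiv (e0, x) = x"
  by (simp add: ldiv_dom_def ldiv_def e0_E1 iota_e0 iota_carrier iota_U1 kappa_iota)

lemma ldiv_diag: "x \<in> E1 \<Longrightarrow> (x, x) \<in> ldiv_dom \<and> ldiv (x, x) = e0"
  by (simp add: ldiv_dom_def ldiv_def iota_carrier one_U1 e0_def)

text \<open>In the coordinates \<kappa>, \<open>Mfield x u\<close> is the value at \<open>x\<close>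
  of the left-invariant vector field that equals \<open>u\<close> at the identity, and
  \<open>Afield x\<close> is the Maurer-Cartan form at \<open>x\<close>.\<close>

definition Mfield where "Mfield x u = frechet_derivative mul (at (x, e0)) (0, u)"
definition Afield where "Afield x u = frechet_derivative ldiv (at (x, x)) (0, u)"

lemma mul_has_derivative:
  "z \<in> mul_dom \<Longrightarrow> (mul has_derivative frechet_derivative mul (at z)) (at z)"
  by (rule smooth_on_open_has_derivative[OF open_mul_dom smooth_mul])

lemma ldiv_has_derivative:
  "z \<in> ldiv_dom \<Longrightarrow> (ldiv has_derivative frechet_derivative ldiv (at z)) (at z)"
  by (rule smooth_on_open_has_derivative[OF open_ldiv_dom smooth_ldiv])

lemma has_derivative_eq_ident_near:
  assumes "(f has_derivative f') (at (x::'e))" "x \<in> E1" "\<And>y. y \<in> E1 \<Longrightarrow> f y = y"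
  shows "f' = (\<lambda>u. u)"
proof -
  have "(f has_derivative (\<lambda>u. u)) (at x)"
    by (rule has_derivative_transform_within_open[OF has_derivative_ident open_E1 assms(2)]) (simp add: assms(3))
  then show ?thesis using has_derivative_unique assms(1) by blast
qed

text \<open>Both partial maps of \<open>mul\<close> at \<open>e0\<close> are the identity because
  \<open>e0\<close> is neutral, and a linear map on a product is the sum of its restrictions to the
  factors.\<close>

lemma frechet_mul_e0: "frechet_derivative mul (at (e0, e0)) (u, v) = u + v"
proof -
  let ?D = "frechet_derivative mul (at (e0, e0))"
  have D: "(mul has_derivative ?D) (at (e0, e0))"
    using mul_e0_left[OF e0_E1] by (intro mul_has_derivative) simp
  have "((\<lambda>x. mul (x, e0)) has_derivative (\<lambda>u. ?D (u, 0))) (at e0)"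
    using D by (intro has_derivative_compose[where f = "\<lambda>x. (x, e0)" and g = mul]) (auto intro!: derivative_eq_intros)
  then have l: "(\<lambda>u. ?D (u, 0)) = (\<lambda>u. u)"
    by (rule has_derivative_eq_ident_near[OF _ e0_E1]) (simp add: mul_e0_right)
  have "((\<lambda>x. mul (e0, x)) has_derivative (\<lambda>u. ?D (0, u))) (at e0)"
    using D by (intro has_derivative_compose[where f = "\<lambda>x. (e0, x)" and g = mul]) (auto intro!: derivative_eq_intros)
  then have r: "(\<lambda>u. ?D (0, u)) = (\<lambda>u. u)"
    by (rule has_derivative_eq_ident_near[OF _ e0_E1]) (simp add: mul_e0_left)
  have "linear ?D" using D has_derivative_linear by blast
  then have "?D ((u, 0) + (0, v)) = ?D (u, 0) + ?D (0, v)" by (rule linear_add)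
  then show ?thesis using fun_cong[OF l, of u] fun_cong[OF r, of v] by simp
qed

lemma Mfield_e0: "Mfield e0 u = u"
  by (simp add: Mfield_def frechet_mul_e0)

lemma Afield_e0: "Afield e0 u = u"
proof -
  let ?D = "frechet_derivative ldiv (at (e0, e0))"
  have D: "(ldiv has_derivative ?D) (at (e0, e0))"
    using ldiv_e0_left[OF e0_E1] by (intro ldiv_has_derivative) simp
  have "((\<lambda>x. ldiv (e0, x)) has_derivative (\<lambda>u. ?D (0, u))) (at e0)"
    using D by (intro has_derivative_compose[where f = "\<lambda>x. (e0, x)" and g = ldiv]) (auto intro!: derivative_eq_intros)
  then have "(\<lambda>u. ?D (0, u)) = (\<lambda>u. u)"
    by (rule has_derivative_eq_ident_near[OF _ e0_E1]) (simp add: ldiv_e0_left)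
  then show ?thesis unfolding Afield_def by (rule fun_cong)
qed

lemma smooth_Mfield: "smooth_on E1 (\<lambda>x. Mfield x u)"
  unfolding Mfield_def
  by (rule smooth_on_compose[OF _ smooth_on_frechet_derivative[OF open_mul_dom smooth_mul], where f = "\<lambda>x. (x, e0)"])
    (auto intro!: smooth_on_Pair smooth_on_bounded_linear[OF bounded_linear_ident] smooth_on_const simp: mul_e0_right)

lemma smooth_Afield: "smooth_on E1 (\<lambda>x. Afield x u)"
  unfolding Afield_def
  by (rule smooth_on_compose[OF _ smooth_on_frechet_derivative[OF open_ldiv_dom smooth_ldiv], where f = "\<lambda>x. (x, x)"])
    (auto intro!: smooth_on_Pair smooth_on_bounded_linear[OF bounded_linear_ident] simp: ldiv_diag)

lemma linear_Mfield:
  assumes "x \<in> E1"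
  shows "linear (Mfield x)"
proof -
  have "linear (frechet_derivative mul (at (x, e0)))"
    using mul_has_derivative mul_e0_right[OF assms] has_derivative_linear by blast
  then have "linear (frechet_derivative mul (at (x, e0)) \<circ> (\<lambda>u. (0, u)))"
    by (rule linear_compose[rotated]) (auto intro!: linearI)
  then show ?thesis by (simp add: comp_def Mfield_def[abs_def])
qed

lemma linear_Afield:
  assumes "x \<in> E1"
  shows "linear (Afield x)"
proof -
  have "linear (frechet_derivative ldiv (at (x, x)))"
    using ldiv_has_derivative ldiv_diag[OF assms] has_derivative_linear by blast
  then have "linear (frechet_derivative ldiv (at (x, x)) \<circ> (\<lambda>u. (0, u)))"
    by (rule linear_compose[rotated]) (auto intro!: linearI)
  then show ?thesis by (simp add: comp_def Afield_def[abs_def])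
qed

text \<open>The left logarithmic derivative. Translation puts the curve through the identity, so
  that one chart and one vector space serve all curves; \<open>J\<close> selects a one-sided or a
  two-sided derivative.\<close>

definition lder where
  "lder \<alpha> s J = velocity \<A> (\<lambda>t. inv (\<alpha> s) \<otimes> \<alpha> t) s (at s within J) chart1"

text \<open>The adjoint representation, with the Lie algebra identified with the model space by
  \<kappa>.\<close>

definition Ad where
  "Ad h = frechet_derivative (\<kappa> \<circ> (\<lambda>x. h \<otimes> x \<otimes> inv h) \<circ> \<iota>) (at e0)"

definition smooth_curve_at where
  "smooth_curve_at \<alpha> s J \<longleftrightarrow> smooth_map_from J T \<A> \<alpha> \<and> s \<in> J \<and> at s within J \<noteq> bot"

lemma smooth_curve_at_mult:
  "smooth_curve_at \<alpha> s J \<Longrightarrow> smooth_curve_at \<beta> s J \<Longrightarrow> smooth_curve_at (\<lambda>t. \<alpha> t \<otimes> \<beta> t) s J"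
  by (simp add: smooth_curve_at_def smooth_map_from_mult)

lemma smooth_curve_at_const:
  "h \<in> carrier G \<Longrightarrow> s \<in> J \<Longrightarrow> at s within J \<noteq> bot \<Longrightarrow> smooth_curve_at (\<lambda>t. h) s J"
  by (simp add: smooth_curve_at_def smooth_map_from_const carrier_topspace)

lemma smooth_curve_at_left:
  "h \<in> carrier G \<Longrightarrow> smooth_curve_at \<alpha> s J \<Longrightarrow> smooth_curve_at (\<lambda>t. h \<otimes> \<alpha> t) s J"
  by (rule smooth_curve_at_mult[OF smooth_curve_at_const]) (auto simp: smooth_curve_at_def)

lemma smooth_curve_at_right:
  "h \<in> carrier G \<Longrightarrow> smooth_curve_at \<alpha> s J \<Longrightarrow> smooth_curve_at (\<lambda>t. \<alpha> t \<otimes> h) s J"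
  by (rule smooth_curve_at_mult[OF _ smooth_curve_at_const]) (auto simp: smooth_curve_at_def)

lemma smooth_curve_at_carrier: "smooth_curve_at \<alpha> s J \<Longrightarrow> t \<in> J \<Longrightarrow> \<alpha> t \<in> carrier G"
  using smooth_map_from_carrier by (auto simp: smooth_curve_at_def)

lemma smooth_curve_at_carrier_base: "smooth_curve_at \<alpha> s J \<Longrightarrow> \<alpha> s \<in> carrier G"
  by (simp add: smooth_curve_at_carrier smooth_curve_at_def)

lemma smooth_curve_at_base:
  "smooth_curve_at \<alpha> s J \<Longrightarrow> smooth_curve_at (\<lambda>t. inv (\<alpha> s) \<otimes> \<alpha> t) s J"
  by (rule smooth_curve_at_left) (auto dest: smooth_curve_at_carrier_base)

lemma lder_has_vector_derivative:
  assumes "smooth_curve_at \<alpha> s J"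
  shows "((\<lambda>t. \<kappa> (inv (\<alpha> s) \<otimes> \<alpha> t)) has_vector_derivative lder \<alpha> s J) (at s within J)"
  unfolding lder_def \<kappa>_def
  using smooth_curve_at_base[OF assms] smooth_curve_at_carrier_base[OF assms] chart1
  by (intro velocity_has_vector_derivative) (auto simp: smooth_curve_at_def)

lemma lder_eqI:
  assumes "smooth_curve_at \<alpha> s J"
    and d: "(f has_vector_derivative w) (at s within J)" and N: "open N" "s \<in> N"
    and eq: "\<And>t. t \<in> J \<Longrightarrow> t \<in> N \<Longrightarrow> f t = \<kappa> (inv (\<alpha> s) \<otimes> \<alpha> t)"
  shows "lder \<alpha> s J = w"
proof -
  have s: "s \<in> J" "at s within J \<noteq> bot" using assms(1) by (auto simp: smooth_curve_at_def)
  have "((\<lambda>t. \<kappa> (inv (\<alpha> s) \<otimes> \<alpha> t)) has_vector_derivative w) (at s within J)"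
    by (rule has_vector_derivative_localize[OF d N s(1) eq])
  then show ?thesis
    using lder_has_vector_derivative[OF assms(1)] vector_derivative_unique_within[OF s(2)] by blast
qed

lemma lder_cong:
  assumes "smooth_curve_at \<alpha> s J" "smooth_curve_at \<beta> s J"
    and "\<And>t. t \<in> J \<Longrightarrow> inv (\<alpha> s) \<otimes> \<alpha> t = inv (\<beta> s) \<otimes> \<beta> t"
  shows "lder \<alpha> s J = lder \<beta> s J"
  by (rule lder_eqI[OF assms(1) lder_has_vector_derivative[OF assms(2)] open_UNIV]) (auto simp: assms(3))

lemma lder_left_translation:
  assumes h: "h \<in> carrier G" and \<alpha>: "smooth_curve_at \<alpha> s J"
  shows "lder (\<lambda>t. h \<otimes> \<alpha> t) s J = lder \<alpha> s J"
proof (rule lder_cong[OF smooth_curve_at_left[OF h \<alpha>] \<alpha>])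
  fix t assume "t \<in> J"
  note c = smooth_curve_at_carrier[OF \<alpha> this] smooth_curve_at_carrier_base[OF \<alpha>]
  have "inv h \<otimes> (h \<otimes> \<alpha> t) = \<alpha> t" using c h by (simp add: m_assoc[symmetric])
  then show "inv (h \<otimes> \<alpha> s) \<otimes> (h \<otimes> \<alpha> t) = inv (\<alpha> s) \<otimes> \<alpha> t"
    using h c by (simp add: inv_mult_group m_assoc)
qed

lemma lder_chart:
  assumes \<alpha>: "smooth_curve_at \<alpha> s J" and "\<alpha> s = \<one>"
  shows "((\<lambda>t. \<kappa> (\<alpha> t)) has_vector_derivative lder \<alpha> s J) (at s within J)"
  by (rule has_vector_derivative_localize[OF lder_has_vector_derivative[OF \<alpha>] open_UNIV])
    (use \<alpha> in \<open>auto simp: assms(2) smooth_curve_at_def smooth_map_from_carrier\<close>)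

lemma smooth_map_conj:
  assumes h: "h \<in> carrier G"
  shows "smooth_map T \<A> T \<A> (\<lambda>x. h \<otimes> x \<otimes> inv h)"
  using h by (intro smooth_mapI continuous_map_mult smooth_map_from_mult smooth_map_from_const
      smooth_map_from_chart_inv) (auto simp: carrier_topspace[symmetric] smooth_manifold_axioms)

lemma Ad_has_derivative:
  assumes h: "h \<in> carrier G"
  shows "((\<kappa> \<circ> (\<lambda>x. h \<otimes> x \<otimes> inv h) \<circ> \<iota>) has_derivative Ad h) (at e0)"
  unfolding Ad_def \<kappa>_def \<iota>_def e0_def
  by (rule smooth_map_chart_has_derivative[OF smooth_map_conj[OF h] chart_domain_open])
    (use h chart1 in auto)

lemma linear_Ad: "h \<in> carrier G \<Longrightarrow> linear (Ad h)"
  using Ad_has_derivative has_derivative_linear by blast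

lemma curve_U1_nhd:
  assumes "smooth_curve_at \<alpha> s J" "\<alpha> s \<in> U1"
  obtains N where "open N" "s \<in> N" "\<And>t. t \<in> J \<Longrightarrow> t \<in> N \<Longrightarrow> \<alpha> t \<in> U1"
  using curve_in_chart_nhd[of J \<alpha> s chart1] assms chart1_atlas
  by (auto simp: smooth_curve_at_def charts_at_def U1_def)

lemma lder_conj_base:
  assumes h: "h \<in> carrier G" and \<alpha>: "smooth_curve_at \<alpha> s J" and one: "\<alpha> s = \<one>"
  shows "lder (\<lambda>t. h \<otimes> \<alpha> t \<otimes> inv h) s J = Ad h (lder \<alpha> s J)"
proof -
  have sm: "smooth_curve_at (\<lambda>t. h \<otimes> \<alpha> t \<otimes> inv h) s J"
    using h by (intro smooth_curve_at_right smooth_curve_at_left \<alpha>) auto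
  obtain N where N: "open N" "s \<in> N" "\<And>t. t \<in> J \<Longrightarrow> t \<in> N \<Longrightarrow> \<alpha> t \<in> U1"
    using curve_U1_nhd[OF \<alpha>] one one_U1 by auto
  have "((\<kappa> \<circ> (\<lambda>x. h \<otimes> x \<otimes> inv h) \<circ> \<iota>) has_derivative Ad h) (at (\<kappa> (\<alpha> s)))"
    using Ad_has_derivative[OF h] by (simp add: one e0_def)
  from has_vector_derivative_compose_frechet[OF this lder_chart[OF \<alpha> one]] show ?thesis
    by (rule lder_eqI[OF sm _ N(1,2)]) (use h N \<alpha> in \<open>auto simp: one iota_kappa smooth_curve_at_def smooth_map_from_carrier\<close>)
qed

text \<open>The derivative of multiplication at the identity is addition.\<close>

lemma lder_mult_base:
  assumes \<alpha>: "smooth_curve_at \<alpha> s J" "\<alpha> s = \<one>" and \<beta>: "smooth_curve_at \<beta> s J" "\<beta> s = \<one>"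
  shows "lder (\<lambda>t. \<alpha> t \<otimes> \<beta> t) s J = lder \<alpha> s J + lder \<beta> s J"
proof -
  obtain N where N: "open N" "s \<in> N" "\<And>t. t \<in> J \<Longrightarrow> t \<in> N \<Longrightarrow> \<alpha> t \<in> U1"
    using curve_U1_nhd[OF \<alpha>(1)] \<alpha>(2) one_U1 by auto
  obtain M where M: "open M" "s \<in> M" "\<And>t. t \<in> J \<Longrightarrow> t \<in> M \<Longrightarrow> \<beta> t \<in> U1"
    using curve_U1_nhd[OF \<beta>(1)] \<beta>(2) one_U1 by auto
  have D: "(mul has_derivative frechet_derivative mul (at (e0, e0))) (at (\<kappa> (\<alpha> s), \<kappa> (\<beta> s)))"
    using mul_has_derivative[of "(e0, e0)"] mul_e0_left[OF e0_E1] by (simp add: \<alpha> \<beta> e0_def)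
  have "((\<lambda>t. (\<kappa> (\<alpha> t), \<kappa> (\<beta> t))) has_vector_derivative (lder \<alpha> s J, lder \<beta> s J)) (at s within J)"
    by (intro has_vector_derivative_Pair lder_chart \<alpha> \<beta>)
  from has_vector_derivative_compose_frechet[OF D this]
  have d: "((\<lambda>t. mul (\<kappa> (\<alpha> t), \<kappa> (\<beta> t))) has_vector_derivative lder \<alpha> s J + lder \<beta> s J) (at s within J)"
    by (simp add: frechet_mul_e0)
  show ?thesis
    by (rule lder_eqI[OF smooth_curve_at_mult[OF \<alpha>(1) \<beta>(1)] d open_Int[OF N(1) M(1)]])
      (use N M \<alpha> \<beta> in \<open>auto simp: mul_def iota_kappa smooth_curve_at_carrier\<close>)
qed

lemma lder_base: "smooth_curve_at \<alpha> s J \<Longrightarrow> lder (\<lambda>t. inv (\<alpha> s) \<otimes> \<alpha> t) s J = lder \<alpha> s J"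
  by (rule lder_left_translation) (auto dest: smooth_curve_at_carrier_base)

text \<open>With \<open>b0 = \<beta> s\<close> and both curves translated to the identity, the
  translated product is \<open>b0^-1 a(t) b0 b(t)\<close>. The conjugation produces
  \<open>Ad\<close>, the product of curves through the identity produces the sum.\<close>

lemma lder_mult:
  assumes \<alpha>: "smooth_curve_at \<alpha> s J" and \<beta>: "smooth_curve_at \<beta> s J"
  shows "lder (\<lambda>t. \<alpha> t \<otimes> \<beta> t) s J = Ad (inv (\<beta> s)) (lder \<alpha> s J) + lder \<beta> s J"
proof -
  define a where "a = (\<lambda>t. inv (\<alpha> s) \<otimes> \<alpha> t)"
  define b where "b = (\<lambda>t. inv (\<beta> s) \<otimes> \<beta> t)"
  note c = smooth_curve_at_carrier_base[OF \<alpha>] smooth_curve_at_carrier_base[OF \<beta>]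
  have a: "smooth_curve_at a s J" "a s = \<one>" and b: "smooth_curve_at b s J" "b s = \<one>"
    using smooth_curve_at_base \<alpha> \<beta> c by (auto simp: a_def b_def)
  have ca: "smooth_curve_at (\<lambda>t. inv (\<beta> s) \<otimes> a t \<otimes> inv (inv (\<beta> s))) s J"
    using c by (intro smooth_curve_at_right smooth_curve_at_left a) auto
  have "lder (\<lambda>t. \<alpha> t \<otimes> \<beta> t) s J = lder (\<lambda>t. (inv (\<beta> s) \<otimes> a t \<otimes> inv (inv (\<beta> s))) \<otimes> b t) s J"
  proof (rule lder_cong[OF smooth_curve_at_mult[OF \<alpha> \<beta>] smooth_curve_at_mult[OF ca b(1)]])
    fix t assume t: "t \<in> J"
    have ct: "\<alpha> t \<in> carrier G" "\<beta> t \<in> carrier G" using smooth_curve_at_carrier t \<alpha> \<beta> by auto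
    have "\<beta> s \<otimes> (inv (\<beta> s) \<otimes> \<beta> t) = \<beta> t" using c ct by (simp add: m_assoc[symmetric])
    then show "inv (\<alpha> s \<otimes> \<beta> s) \<otimes> (\<alpha> t \<otimes> \<beta> t) =
        inv (inv (\<beta> s) \<otimes> a s \<otimes> inv (inv (\<beta> s)) \<otimes> b s) \<otimes> (inv (\<beta> s) \<otimes> a t \<otimes> inv (inv (\<beta> s)) \<otimes> b t)"
      using c ct unfolding a(2) b(2) by (simp add: a_def b_def inv_mult_group m_assoc)
  qed
  also have "\<dots> = lder (\<lambda>t. inv (\<beta> s) \<otimes> a t \<otimes> inv (inv (\<beta> s))) s J + lder b s J"
    using c by (intro lder_mult_base ca b) (simp_all add: a b)
  also have "lder (\<lambda>t. inv (\<beta> s) \<otimes> a t \<otimes> inv (inv (\<beta> s))) s J = Ad (inv (\<beta> s)) (lder a s J)"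
    using c by (intro lder_conj_base a) auto
  finally show ?thesis using lder_base \<alpha> \<beta> by (simp add: a_def b_def)
qed

text \<open>Write \<alpha>(t) = \<alpha>(s) a(t) with \<open>a\<close> passing through the identity
  and differentiate the second factor of \<open>mul\<close>. A curve with constant
  \<open>lder\<close> is thereby an integral curve of a left-invariant field.\<close>

lemma chart_derivative_lder:
  assumes \<alpha>: "smooth_curve_at \<alpha> s J" and U: "\<alpha> s \<in> U1"
  shows "((\<lambda>t. \<kappa> (\<alpha> t)) has_vector_derivative Mfield (\<kappa> (\<alpha> s)) (lder \<alpha> s J)) (at s within J)"
proof -
  define a where "a = (\<lambda>t. inv (\<alpha> s) \<otimes> \<alpha> t)"
  note c = smooth_curve_at_carrier_base[OF \<alpha>]
  have a: "smooth_curve_at a s J" "a s = \<one>"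
    using smooth_curve_at_base \<alpha> c by (auto simp: a_def)
  obtain N where N: "open N" "s \<in> N" "\<And>t. t \<in> J \<Longrightarrow> t \<in> N \<Longrightarrow> a t \<in> U1"
    using curve_U1_nhd[OF a(1)] a(2) one_U1 by auto
  have D: "(mul has_derivative frechet_derivative mul (at (\<kappa> (\<alpha> s), e0))) (at (\<kappa> (\<alpha> s), \<kappa> (a s)))"
    using mul_has_derivative mul_e0_right[OF kappa_E1[OF U]] by (simp add: a e0_def)
  have "((\<lambda>t. (\<kappa> (\<alpha> s), \<kappa> (a t))) has_vector_derivative (0, lder \<alpha> s J)) (at s within J)"
    using lder_chart[OF a] lder_base[OF \<alpha>] by (auto intro!: has_vector_derivative_Pair derivative_eq_intros simp: a_def)
  from has_vector_derivative_compose_frechet[OF D this] show ?thesis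
    unfolding Mfield_def
  proof (rule has_vector_derivative_localize[OF _ N(1,2)])
    show "s \<in> J" using \<alpha> by (simp add: smooth_curve_at_def)
    fix t assume t: "t \<in> J" "t \<in> N"
    have "\<alpha> s \<otimes> a t = \<alpha> t" using c smooth_curve_at_carrier[OF \<alpha> t(1)] by (simp add: a_def m_assoc[symmetric])
    then show "mul (\<kappa> (\<alpha> s), \<kappa> (a t)) = \<kappa> (\<alpha> t)" using N(3)[OF t] U by (simp add: mul_def iota_kappa)
  qed
qed

text \<open>The way back from coordinate velocities to logarithmic derivatives, by differentiating
  left division by the fixed point \<alpha>(s).\<close>

lemma lder_eq_Afield:
  assumes \<alpha>: "smooth_curve_at \<alpha> s J" and U: "\<alpha> s \<in> U1"
    and d: "((\<lambda>t. \<kappa> (\<alpha> t)) has_vector_derivative w) (at s within J)"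
  shows "lder \<alpha> s J = Afield (\<kappa> (\<alpha> s)) w"
proof -
  obtain N where N: "open N" "s \<in> N" "\<And>t. t \<in> J \<Longrightarrow> t \<in> N \<Longrightarrow> \<alpha> t \<in> U1"
    using curve_U1_nhd[OF \<alpha> U] by auto
  have D: "(ldiv has_derivative frechet_derivative ldiv (at (\<kappa> (\<alpha> s), \<kappa> (\<alpha> s)))) (at (\<kappa> (\<alpha> s), \<kappa> (\<alpha> s)))"
    using ldiv_has_derivative ldiv_diag[OF kappa_E1[OF U]] by simp
  have "((\<lambda>t. (\<kappa> (\<alpha> s), \<kappa> (\<alpha> t))) has_vector_derivative (0, w)) (at s within J)"
    using d by (auto intro!: has_vector_derivative_Pair derivative_eq_intros)
  from has_vector_derivative_compose_frechet[OF D this]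
  have "((\<lambda>t. ldiv (\<kappa> (\<alpha> s), \<kappa> (\<alpha> t))) has_vector_derivative Afield (\<kappa> (\<alpha> s)) w) (at s within J)"
    by (simp add: Afield_def)
  then show ?thesis
    by (rule lder_eqI[OF \<alpha> _ N(1,2)]) (use N U in \<open>simp add: ldiv_def iota_kappa\<close>)
qed

end

section \<open>Ordinary differential equations with small Lipschitz constant\<close>

lemma norm_diff_le_of_vector_derivative:
  fixes u :: "real \<Rightarrow> 'a::real_normed_vector"
  assumes "convex J" "\<And>t. t \<in> J \<Longrightarrow> (u has_vector_derivative u' t) (at t within J)"
    and "\<And>t. t \<in> J \<Longrightarrow> norm (u' t) \<le> c" and "s \<in> J" "t \<in> J"
  shows "norm (u t - u s) \<le> c * \<bar>t - s\<bar>"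
proof -
  have "onorm (\<lambda>h. h *\<^sub>R u' t) \<le> c" if "t \<in> J" for t
    using assms(3)[OF that] by (intro onorm_le) (simp, metis abs_ge_zero mult.commute mult_left_mono)
  then have "norm (u t - u s) \<le> c * norm (t - s)"
    using assms by (intro differentiable_bound[of J u "\<lambda>t h. h *\<^sub>R u' t"]) (auto simp: has_vector_derivative_def)
  then show ?thesis by simp
qed

text \<open>The solution is the fixed point of the integral operator on bounded continuous functions
  with values in the ball. \<open>R\<close> bounds both the ball and the speed, and K < 1, so a
  single contraction covers all of [0,1].\<close>

lemma picard_existence:
  fixes f :: "'e::banach \<Rightarrow> 'e"
  assumes lip: "\<And>x y. x \<in> cball a R \<Longrightarrow> y \<in> cball a R \<Longrightarrow> norm (f x - f y) \<le> K * norm (x - y)"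
    and K: "0 \<le> K" "K < 1" and bound: "\<And>x. x \<in> cball a R \<Longrightarrow> norm (f x) \<le> R" and R: "0 \<le> R"
  obtains x where "x 0 = a" "\<And>t. t \<in> {0..1} \<Longrightarrow> x t \<in> cball a R"
    "\<And>t. t \<in> {0..1} \<Longrightarrow> (x has_vector_derivative f (x t)) (at t within {0..1::real})"
proof -
  define S where "S = {x :: real \<Rightarrow>\<^sub>C 'e. \<forall>t. x t \<in> cball a R}"
  have "closed (PiC UNIV (\<lambda>_. cball a R) :: (real \<Rightarrow>\<^sub>C 'e) set)"
    by (rule closed_PiC) simp
  moreover have "S = PiC UNIV (\<lambda>_. cball a R)"
    by (auto simp: S_def mem_PiC_iff Pi_def)
  ultimately have complete: "complete S" by (simp add: complete_eq_closed)
  have ne: "S \<noteq> {}"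
    using R by (auto simp: S_def intro!: exI[of _ "const_bcontfun a"])
  have fc: "continuous_on (cball a R) f"
    by (rule lipschitz_on_continuous_on[of K]) (use lip K in \<open>auto simp: lipschitz_on_def dist_norm\<close>)
  \<comment> \<open>Solutions live on [0,1], while the complete space consists of functions on the
    whole line; clipping the time extends them by constants.\<close>
  define clip where "clip t = max 0 (min 1 t)" for t :: real
  have clip: "clip t \<in> {0..1}" for t by (auto simp: clip_def)
  have clip_cont: "continuous_on UNIV clip" unfolding clip_def by (intro continuous_intros)
  define I where "I x t = a + integral {0..t} (\<lambda>s. f (apply_bcontfun x s))" for x :: "real \<Rightarrow>\<^sub>C 'e" and t
  have gc: "continuous_on A (\<lambda>s. f (apply_bcontfun x s))" if "x \<in> S" for x A
    by (rule continuous_on_compose2[OF fc]) (use that in \<open>auto simp: S_def\<close>)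
  have I_in: "I x t \<in> cball a R" if "x \<in> S" "t \<in> {0..1}" for x t
  proof -
    have "norm (integral {0..t} (\<lambda>s. f (apply_bcontfun x s))) \<le> R * (t - 0)"
      using that bound by (intro integral_bound gc) (auto simp: S_def)
    also have "\<dots> \<le> R" using that R by (auto intro: mult_left_le)
    finally show ?thesis by (simp add: I_def dist_norm)
  qed
  have I_cont: "continuous_on {0..1} (I x)" if "x \<in> S" for x
    unfolding I_def
    by (intro continuous_on_add continuous_on_const indefinite_integral_continuous_1 integrable_continuous_real gc that)
  define P where "P x = Bcontfun (\<lambda>t. I x (clip t))" for x
  have P: "apply_bcontfun (P x) = (\<lambda>t. I x (clip t))" if "x \<in> S" for x
  proof -
    have "continuous_on UNIV (\<lambda>t. I x (clip t))"
      by (rule continuous_on_compose2[OF I_cont[OF that] clip_cont]) (use clip in auto)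
    moreover have "norm (I x (clip t)) \<le> norm a + R" for t
      using I_in[OF that clip, of t] norm_triangle_ineq2[of "I x (clip t)" a]
      by (simp add: dist_norm norm_minus_commute)
    ultimately have "(\<lambda>t. I x (clip t)) \<in> bcontfun" by (rule bcontfun_normI)
    then show ?thesis unfolding P_def by (rule Bcontfun_inverse)
  qed
  have "\<exists>!x\<in>S. P x = x"
  proof (rule Banach_fix[OF complete ne K])
    show "P ` S \<subseteq> S" using P I_in clip by (auto simp: S_def)
    fix x y assume xy: "x \<in> S" "y \<in> S"
    show "dist (P x) (P y) \<le> K * dist x y"
    proof (rule dist_bound)
      fix t
      let ?t = "clip t"
      have "I x ?t - I y ?t = integral {0..?t} (\<lambda>s. f (apply_bcontfun x s) - f (apply_bcontfun y s))"
        using gc xy by (simp add: I_def integral_diff integrable_continuous_real)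
      also have "norm \<dots> \<le> (K * dist x y) * (?t - 0)"
      proof (rule integral_bound)
        show "continuous_on {0..?t} (\<lambda>s. f (apply_bcontfun x s) - f (apply_bcontfun y s))"
          by (intro continuous_on_diff gc xy)
        fix s
        have "norm (f (apply_bcontfun x s) - f (apply_bcontfun y s)) \<le> K * norm (apply_bcontfun x s - apply_bcontfun y s)"
          using xy by (intro lip) (auto simp: S_def)
        also have "\<dots> \<le> K * dist x y"
          using K dist_bounded[of x s y] by (intro mult_left_mono) (auto simp: dist_norm)
        finally show "norm (f (apply_bcontfun x s) - f (apply_bcontfun y s)) \<le> K * dist x y" .
      qed (use clip in auto)
      also have "\<dots> \<le> K * dist x y" using clip[of t] K by (auto intro!: mult_left_le)
      finally show "dist (apply_bcontfun (P x) t) (apply_bcontfun (P y) t) \<le> K * dist x y"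
        using P xy by (simp add: dist_norm)
    qed
  qed
  then obtain x where x: "x \<in> S" "P x = x" by blast
  then have eq: "apply_bcontfun x t = I x t" if "t \<in> {0..1}" for t
    using P[OF x(1)] that by (metis atLeastAtMost_iff clip_def max.absorb2 min.absorb2)
  show thesis
  proof (rule that[of "I x"])
    show "I x 0 = a" by (simp add: I_def)
    show "I x t \<in> cball a R" if "t \<in> {0..1}" for t using I_in[OF x(1) that] .
    show "(I x has_vector_derivative f (I x t)) (at t within {0..1})" if "t \<in> {0..1}" for t
      using integral_has_vector_derivative[OF gc[OF x(1)] that] eq[OF that]
      unfolding I_def by (auto intro!: derivative_eq_intros)
  qed
qed

text \<open>At a point \<open>m\<close> where the two solutions are farthest apart, the mean value
  inequality over length at most 1 bounds the distance by |K| times itself.\<close>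

lemma ode_unique:
  fixes y z :: "real \<Rightarrow> 'a::real_normed_vector"
  assumes lip: "\<And>x y. x \<in> B \<Longrightarrow> y \<in> B \<Longrightarrow> norm (f x - f y) \<le> K * norm (x - y)"
    and K: "K < 1" and T: "T \<le> 1"
    and y: "\<And>t. t \<in> {0..T} \<Longrightarrow> y t \<in> B" "\<And>t. t \<in> {0..T} \<Longrightarrow> (y has_vector_derivative f (y t)) (at t within {0..T})"
    and z: "\<And>t. t \<in> {0..T} \<Longrightarrow> z t \<in> B" "\<And>t. t \<in> {0..T} \<Longrightarrow> (z has_vector_derivative f (z t)) (at t within {0..T})"
    and init: "y 0 = z 0" and t: "t \<in> {0..T}"
  shows "y t = z t"
proof -
  define u where "u t = y t - z t" for t
  have u': "(u has_vector_derivative f (y t) - f (z t)) (at t within {0..T})" if "t \<in> {0..T}" for t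
    unfolding u_def by (intro has_vector_derivative_diff y z that)
  then have "continuous_on {0..T} u"
    unfolding continuous_on_eq_continuous_within using has_vector_derivative_continuous by blast
  then have "continuous_on {0..T} (\<lambda>t. norm (u t))" by (rule continuous_on_norm)
  then obtain m where m: "m \<in> {0..T}" "\<And>t. t \<in> {0..T} \<Longrightarrow> norm (u t) \<le> norm (u m)"
    using continuous_attains_sup[of "{0..T}" "\<lambda>t. norm (u t)"] t by auto
  have "norm (u m - u 0) \<le> norm (K * norm (u m)) * \<bar>m - 0\<bar>"
  proof (rule norm_diff_le_of_vector_derivative[OF convex_real_interval(5) u'])
    fix s assume s: "s \<in> {0..T}"
    have "norm (f (y s) - f (z s)) \<le> K * norm (u s)" using lip y z s by (simp add: u_def)
    also have "\<dots> \<le> \<bar>K\<bar> * norm (u m)" using m(2)[OF s] by (intro mult_mono) auto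
    finally show "norm (f (y s) - f (z s)) \<le> norm (K * norm (u m))" by (simp add: abs_mult)
  qed (use m t in auto)
  also have "\<dots> \<le> norm (K * norm (u m)) * 1" using m T by (intro mult_left_mono) auto
  finally have le: "norm (u m) \<le> \<bar>K\<bar> * norm (u m)" using init by (simp add: u_def abs_mult)
  have "norm (u m) = 0"
  proof (cases "K \<ge> 0")
    case True
    then have "norm (u m) \<le> K * norm (u m)" using le by simp
    then show ?thesis using K mult_strict_right_mono[of K 1 "norm (u m)"] norm_ge_zero[of "u m"] by linarith
  next
    \<comment> \<open>For negative \<open>K\<close> the Lipschitz bound at \<open>m\<close> has a
      nonnegative left side, which forces \<open>y m = z m\<close>.\<close>
    case False
    have "norm (u m) = norm (y m - z m)" by (simp add: u_def)
    moreover have "0 \<le> norm (f (y m) - f (z m))" by simp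
    moreover have "norm (f (y m) - f (z m)) \<le> K * norm (y m - z m)" using lip y z m by blast
    ultimately show ?thesis using False by (smt (verit) mult_neg_pos norm_ge_zero)
  qed
  then show ?thesis using m(2)[OF t] by (simp add: u_def)
qed

text \<open>For \<open>t = 1\<close> this makes the time-one map \<open>l \<mapsto> x(1)\<close> of \<open>x' = M x l\<close>, that is the exponential map,
  locally invertible.\<close>

lemma ode_parameter_estimate:
  fixes x y :: "real \<Rightarrow> 'a::real_normed_vector"
  assumes lip: "\<And>p q u. p \<in> cball a R \<Longrightarrow> q \<in> cball a R \<Longrightarrow> norm (M p u - M q u) \<le> C * norm (p - q) * norm u"
    and lin: "\<And>p u v. p \<in> cball a R \<Longrightarrow> M p (u - v) = M p u - M p v" and M_a: "\<And>u. M a u = u"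
    and C: "0 \<le> C" and CR: "C * R \<le> 1/8" and R: "0 \<le> R"
    and l: "norm m \<le> R"
    and x: "\<And>t. t \<in> {0..1} \<Longrightarrow> x t \<in> cball a R"
      "\<And>t. t \<in> {0..1} \<Longrightarrow> (x has_vector_derivative M (x t) l) (at t within {0..1})"
    and y: "\<And>t. t \<in> {0..1} \<Longrightarrow> y t \<in> cball a R"
      "\<And>t. t \<in> {0..1} \<Longrightarrow> (y has_vector_derivative M (y t) m) (at t within {0..1})"
    and init: "x 0 = y 0" and t: "t \<in> {0..1}"
  shows "norm (x t - y t - t *\<^sub>R (l - m)) \<le> norm (l - m) / 2"
proof -
  define u where "u t = x t - y t - t *\<^sub>R (l - m)" for t
  have u': "(u has_vector_derivative (M (x t) l - M (y t) m) - (l - m)) (at t within {0..1})" if "t \<in> {0..1}" for t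
    unfolding u_def by (intro has_vector_derivative_diff x y that) (auto intro!: derivative_eq_intros)
  then have "continuous_on {0..1} u"
    unfolding continuous_on_eq_continuous_within using has_vector_derivative_continuous by blast
  then have "continuous_on {0..1} (\<lambda>t. norm (u t))" by (rule continuous_on_norm)
  then obtain b where b: "b \<in> {0..1}" "\<And>t. t \<in> {0..1} \<Longrightarrow> norm (u t) \<le> norm (u b)"
    using continuous_attains_sup[of "{0..1}" "\<lambda>t. norm (u t)"] by auto
  let ?d = "norm (l - m)"
  have "norm (u b - u 0) \<le> (?d / 8 + (norm (u b) + ?d) / 8) * \<bar>b - 0\<bar>"
  proof (rule norm_diff_le_of_vector_derivative[OF convex_real_interval(5) u'])
    fix s :: real assume s: "s \<in> {0..1}"
    have a: "a \<in> cball a R" using R by simp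
    \<comment> \<open>The first difference measures how far \<open>M (x s)\<close> is from the
      identity map \<open>M a\<close>, the second how far the two curves have drifted apart. Each of
      them costs one factor C * R \<le> 1/8.\<close>
    have eq: "M (x s) l - M (y s) m - (l - m) = (M (x s) (l - m) - M a (l - m)) + (M (x s) m - M (y s) m)"
      using lin[OF x(1)[OF s], of l m] by (simp add: M_a)
    have "norm (M (x s) (l - m) - M a (l - m)) \<le> C * norm (x s - a) * ?d"
      using lip x(1)[OF s] a by blast
    also have "\<dots> \<le> (C * R) * ?d"
      using x(1)[OF s] C by (intro mult_right_mono mult_left_mono) (auto simp: dist_norm norm_minus_commute)
    also have "\<dots> \<le> (1/8) * ?d" using CR by (intro mult_right_mono) auto
    finally have 1: "norm (M (x s) (l - m) - M a (l - m)) \<le> ?d / 8" by simp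
    have "norm (s *\<^sub>R (l - m)) \<le> ?d" using s by (auto intro: mult_left_le_one_le)
    moreover have "x s - y s = u s + s *\<^sub>R (l - m)" by (simp add: u_def)
    ultimately have xy: "norm (x s - y s) \<le> norm (u b) + ?d"
      using b(2)[OF s] norm_triangle_ineq[of "u s" "s *\<^sub>R (l - m)"] by simp
    have "norm (M (x s) m - M (y s) m) \<le> C * norm (x s - y s) * norm m"
      using lip x(1)[OF s] y(1)[OF s] by blast
    also have "\<dots> \<le> C * norm (x s - y s) * R" using l C by (intro mult_left_mono) auto
    also have "\<dots> = (C * R) * norm (x s - y s)" by simp
    also have "\<dots> \<le> (1/8) * (norm (u b) + ?d)" using CR xy C R by (intro mult_mono) auto
    finally have 2: "norm (M (x s) m - M (y s) m) \<le> (norm (u b) + ?d) / 8" by simp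
    show "norm (M (x s) l - M (y s) m - (l - m)) \<le> ?d / 8 + (norm (u b) + ?d) / 8"
      unfolding eq using 1 2 norm_triangle_ineq by (meson add_mono order_trans)
  qed (use b in auto)
  also have "\<dots> \<le> (?d / 8 + (norm (u b) + ?d) / 8) * 1" using b by (intro mult_left_mono) auto
  finally have "norm (u b) \<le> ?d / 8 + (norm (u b) + ?d) / 8" using init by (simp add: u_def)
  \<comment> \<open>Solving for \<open>norm (u b)\<close> gives the bound 2/7 *
    \<open>?d\<close>.\<close>
  then have "norm (u b) \<le> ?d / 2" using norm_ge_zero[of "l - m"] by argo
  then show ?thesis using b(2)[OF t] by (simp add: u_def)
qed

text \<open>The sum of the norms of the partial derivatives dominates the operator norm and is
  bounded on a compact ball; convexity of the ball turns this into a Lipschitz bound.\<close>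

lemma smooth_on_locally_Lipschitz:
  fixes f :: "'a::euclidean_space \<Rightarrow> 'b::real_normed_vector"
  assumes U: "open U" "smooth_on U f" and a: "a \<in> U"
  obtains r C where "r > 0" "C \<ge> 0" "cball a r \<subseteq> U"
    "\<And>x y. x \<in> cball a r \<Longrightarrow> y \<in> cball a r \<Longrightarrow> norm (f x - f y) \<le> C * norm (x - y)"
proof -
  obtain r where r: "r > 0" "cball a r \<subseteq> U" using U(1) a open_contains_cball by blast
  have ck: "Ck_on (Suc 0) f U" using U smooth_on_open by blast
  then have "continuous_on (cball a r) (\<lambda>x. \<Sum>b\<in>Basis. norm (frechet_derivative f (at x) b))"
    using r(2) by (intro continuous_on_sum continuous_on_norm) (auto intro: continuous_on_subset)
  then obtain z where z: "\<And>x. x \<in> cball a r \<Longrightarrow> (\<Sum>b\<in>Basis. norm (frechet_derivative f (at x) b)) \<le>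
      (\<Sum>b\<in>Basis. norm (frechet_derivative f (at z) b))"
    using continuous_attains_sup[of "cball a r" "\<lambda>x. \<Sum>b\<in>Basis. norm (frechet_derivative f (at x) b)"] r(1)
    by (metis compact_cball cball_eq_empty less_imp_le not_le)
  define C where "C = (\<Sum>b\<in>Basis. norm (frechet_derivative f (at z) b))"
  have d: "(f has_derivative frechet_derivative f (at x)) (at x)" if "x \<in> cball a r" for x
    using r(2) that by (intro Ck_on_Suc_has_derivative[OF ck]) auto
  have "norm (f x - f y) \<le> C * norm (x - y)" if "x \<in> cball a r" "y \<in> cball a r" for x y
  proof (rule differentiable_bound[OF convex_cball _ _ that])
    fix w assume w: "w \<in> cball a r"
    show "(f has_derivative frechet_derivative f (at w)) (at w within cball a r)"
      using d[OF w] by (rule has_derivative_at_withinI)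
    have lin: "linear (frechet_derivative f (at w))" using d[OF w] has_derivative_linear by blast
    show "onorm (frechet_derivative f (at w)) \<le> C"
    proof (rule onorm_le)
      fix h
      have "frechet_derivative f (at w) h = (\<Sum>b\<in>Basis. (h \<bullet> b) *\<^sub>R frechet_derivative f (at w) b)"
        by (rule linear_Basis_sum[OF lin])
      also have "norm \<dots> \<le> (\<Sum>b\<in>Basis. norm h * norm (frechet_derivative f (at w) b))"
        by (intro sum_norm_le) (simp add: Basis_le_norm mult_right_mono)
      also have "\<dots> = norm h * (\<Sum>b\<in>Basis. norm (frechet_derivative f (at w) b))" by (simp add: sum_distrib_left)
      also have "\<dots> \<le> norm h * C" unfolding C_def by (intro mult_left_mono z w) simp
      finally show "norm (frechet_derivative f (at w) h) \<le> C * norm h" by (simp add: mult.commute)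
    qed
  qed
  moreover have "C \<ge> 0" by (simp add: C_def sum_nonneg)
  ultimately show thesis using that r by blast
qed

section \<open>Invariant metrics and forms\<close>

context Lie_group
begin

lemma velocity_base_one:
  assumes \<alpha>: "smooth_curve_at \<alpha> s J" and one: "\<alpha> s = \<one>"
  shows "velocity \<A> \<alpha> s (at s within J) = tvec_of_coords \<A> chart1 \<one> (lder \<alpha> s J)"
proof -
  have a: "smooth_map_from J T \<A> \<alpha>" "s \<in> J" "at s within J \<noteq> bot" using \<alpha> by (auto simp: smooth_curve_at_def)
  have "velocity \<A> \<alpha> s (at s within J) chart1 = lder \<alpha> s J"
    by (rule velocity_eqI[OF _ a(3)]) (use lder_chart[OF \<alpha> one] chart1 one in \<open>auto simp: \<kappa>_def\<close>)
  then show ?thesis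
    using tangent_space_eq_tvec_of_coords[OF velocity_tangent_space[OF a], of chart1] chart1 one by simp
qed

text \<open>The coordinate line through the identity. It lets identities on the Lie algebra be
  checked along curves.\<close>

lemma curve_with_lder:
  obtains \<alpha> J where "smooth_curve_at \<alpha> 0 J" "\<alpha> 0 = \<one>" "lder \<alpha> 0 J = u"
proof -
  obtain \<delta> where \<delta>: "\<delta> > 0" "smooth_map_from {0..\<delta>} T \<A> (\<lambda>t. chart_inv chart1 (snd chart1 \<one> + t *\<^sub>R u))"
    "velocity \<A> (\<lambda>t. chart_inv chart1 (snd chart1 \<one> + t *\<^sub>R u)) 0 (at 0 within {0..\<delta>}) = tvec_of_coords \<A> chart1 \<one> u"
    using coordinate_curve[OF chart1, of u] by metis
  define \<alpha> where "\<alpha> = (\<lambda>t::real. chart_inv chart1 (snd chart1 \<one> + t *\<^sub>R u))"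
  have 1: "smooth_curve_at \<alpha> 0 {0..\<delta>}"
    using \<delta> by (auto simp: \<alpha>_def smooth_curve_at_def at_within_Icc_at_right)
  have 2: "\<alpha> 0 = \<one>" using iota_e0 by (simp add: \<alpha>_def \<iota>_def e0_def \<kappa>_def)
  have "tvec_of_coords \<A> chart1 \<one> (lder \<alpha> 0 {0..\<delta>}) = tvec_of_coords \<A> chart1 \<one> u"
    using velocity_base_one[OF 1 2] \<delta>(3) by (simp add: \<alpha>_def)
  then have "lder \<alpha> 0 {0..\<delta>} = u" using tvec_of_coords_chart[OF chart1] by metis
  with 1 2 show thesis by (rule that)
qed

text \<open>Conjugation by \<open>h\<close> fixes every point of such a curve, hence its
  derivative.\<close>

lemma Ad_lder_of_commuting:
  assumes h: "h \<in> carrier G" and \<alpha>: "smooth_curve_at \<alpha> s J" and one: "\<alpha> s = \<one>"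
    and comm: "\<And>t. t \<in> J \<Longrightarrow> h \<otimes> \<alpha> t = \<alpha> t \<otimes> h"
  shows "Ad h (lder \<alpha> s J) = lder \<alpha> s J"
proof -
  have eq: "h \<otimes> \<alpha> t \<otimes> inv h = \<alpha> t" if "t \<in> J" for t
    using comm[OF that] smooth_curve_at_carrier[OF \<alpha> that] h by (simp add: m_assoc)
  have "lder (\<lambda>t. h \<otimes> \<alpha> t \<otimes> inv h) s J = lder \<alpha> s J"
    using h \<alpha> eq by (intro lder_cong smooth_curve_at_right smooth_curve_at_left) (auto simp: smooth_curve_at_def)
  then show ?thesis using lder_conj_base[OF h \<alpha> one] by simp
qed

end

section \<open>Reduction of the Kropina structure to the Lie algebra\<close>

locale kropina_group = Lie_group G T \<A>
  for G :: "('a, 'm) monoid_scheme" (structure)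
    and T :: "'a topology" and \<A> :: "('a, 'e::euclidean_space) chart set" +
  fixes g :: "'a \<Rightarrow> ('a, 'e) tvec \<Rightarrow> ('a, 'e) tvec \<Rightarrow> real"
    and \<omega> :: "'a \<Rightarrow> ('a, 'e) tvec \<Rightarrow> real"
  assumes compact: "compact_space T"
    and metric: "riemannian_metric T \<A> g" and bi_inv: "bi_invariant_metric G \<A> g"
    and form: "one_form T \<A> \<omega>" and left_inv: "left_invariant_form G \<A> \<omega>"
    and nontrivial: "\<exists>p\<in>topspace T. \<exists>v\<in>tangent_space \<A> p. \<omega> p v \<noteq> 0"
begin

definition gh where "gh u v = g \<one> (tvec_of_coords \<A> chart1 \<one> u) (tvec_of_coords \<A> chart1 \<one> v)"
definition wh where "wh u = \<omega> \<one> (tvec_of_coords \<A> chart1 \<one> u)"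
definition kh where "kh u = - (gh u u / (2 * wh u))"

lemma one_topspace: "\<one> \<in> topspace T"
  by (simp flip: carrier_topspace)

lemma wh_lincomb: "wh (a *\<^sub>R u + b *\<^sub>R v) = a * wh u + b * wh v"
  using form one_topspace tvec_of_coords_tangent_space[OF chart1]
  unfolding wh_def tvec_of_coords_lincomb[OF chart1] one_form_def by blast

lemma gh_lincomb: "gh (a *\<^sub>R u + b *\<^sub>R v) w = a * gh u w + b * gh v w"
  using metric[unfolded riemannian_metric_def, THEN conjunct1] one_topspace tvec_of_coords_tangent_space[OF chart1]
  unfolding gh_def tvec_of_coords_lincomb[OF chart1] by blast

lemma gh_sym: "gh u v = gh v u"
  using metric[unfolded riemannian_metric_def, THEN conjunct2, THEN conjunct1] one_topspace
    tvec_of_coords_tangent_space[OF chart1]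
  unfolding gh_def by blast

lemma gh_pos: "u \<noteq> 0 \<Longrightarrow> gh u u > 0"
proof -
  assume "u \<noteq> 0"
  then have "tvec_of_coords \<A> chart1 \<one> u \<noteq> (\<lambda>_. 0)"
    using tvec_of_coords_chart[OF chart1, of u] by auto
  then show "gh u u > 0"
    using metric[unfolded riemannian_metric_def, THEN conjunct2, THEN conjunct2, THEN conjunct1] one_topspace
      tvec_of_coords_tangent_space[OF chart1]
    unfolding gh_def by blast
qed

lemma linear_wh: "linear wh"
  using wh_lincomb[of 1 _ 1] wh_lincomb[of _ _ 0 0] by (intro linearI) auto

lemma linear_gh: "linear (\<lambda>u. gh u v)"
  using gh_lincomb[of 1 _ 1] gh_lincomb[of _ _ 0 0] by (intro linearI) auto

lemma linear_gh': "linear (\<lambda>v. gh u v)"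
  using linear_gh[of u] gh_sym by simp

text \<open>Left translation by the inverse of the base point carries the velocity to the identity
  without changing the value of \<omega>.\<close>

lemma form_lder:
  assumes \<alpha>: "smooth_curve_at \<alpha> s J"
  shows "\<omega> (\<alpha> s) (velocity \<A> \<alpha> s (at s within J)) = wh (lder \<alpha> s J)"
proof -
  have a: "smooth_map_from J T \<A> \<alpha>" "s \<in> J" "at s within J \<noteq> bot" using \<alpha> by (auto simp: smooth_curve_at_def)
  have c: "\<alpha> s \<in> carrier G" by (rule smooth_curve_at_carrier_base[OF \<alpha>])
  then show ?thesis
    using left_invariant_form_velocity[OF left_inv inv_closed[OF c] a]
      velocity_base_one[OF smooth_curve_at_base[OF \<alpha>]] lder_base[OF \<alpha>]
    by (simp add: wh_def)
qed

lemma metric_lder: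
  assumes \<alpha>: "smooth_curve_at \<alpha> s J"
  shows "g (\<alpha> s) (velocity \<A> \<alpha> s (at s within J)) (velocity \<A> \<alpha> s (at s within J)) = gh (lder \<alpha> s J) (lder \<alpha> s J)"
proof -
  have a: "smooth_map_from J T \<A> \<alpha>" "s \<in> J" "at s within J \<noteq> bot" using \<alpha> by (auto simp: smooth_curve_at_def)
  have c: "\<alpha> s \<in> carrier G" by (rule smooth_curve_at_carrier_base[OF \<alpha>])
  then show ?thesis
    using bi_invariant_metric_velocity(1)[OF bi_inv inv_closed[OF c] a a refl]
      velocity_base_one[OF smooth_curve_at_base[OF \<alpha>]] lder_base[OF \<alpha>]
    by (simp add: gh_def)
qed

lemma kropina_lder:
  assumes \<alpha>: "smooth_curve_at \<alpha> s J"
  shows "kropina g \<omega> (\<alpha> s) (velocity \<A> \<alpha> s (at s within J)) = kh (lder \<alpha> s J)"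
  by (simp add: kropina_def kh_def form_lder[OF \<alpha>] metric_lder[OF \<alpha>])

text \<open>Conjugation is left translation by \<open>h\<close> followed by right translation by
  \<open>inv h\<close>, and both are isometries. Right invariance of the metric enters here.\<close>

lemma gh_Ad:
  assumes h: "h \<in> carrier G"
  shows "gh (Ad h u) (Ad h v) = gh u v"
proof -
  obtain \<alpha> J where \<alpha>: "smooth_curve_at \<alpha> 0 J" "\<alpha> 0 = \<one>" "lder \<alpha> 0 J = u" by (rule curve_with_lder)
  obtain \<beta> I where \<beta>: "smooth_curve_at \<beta> 0 I" "\<beta> 0 = \<one>" "lder \<beta> 0 I = v" by (rule curve_with_lder)
  have a: "smooth_map_from J T \<A> \<alpha>" "0 \<in> J" "at 0 within J \<noteq> bot" using \<alpha>(1) by (auto simp: smooth_curve_at_def)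
  have b: "smooth_map_from I T \<A> \<beta>" "0 \<in> I" "at 0 within I \<noteq> bot" using \<beta>(1) by (auto simp: smooth_curve_at_def)
  have ha: "smooth_curve_at (\<lambda>t. h \<otimes> \<alpha> t) 0 J" and hb: "smooth_curve_at (\<lambda>t. h \<otimes> \<beta> t) 0 I"
    using h \<alpha> \<beta> by (auto intro: smooth_curve_at_left)
  have a': "smooth_map_from J T \<A> (\<lambda>t. h \<otimes> \<alpha> t)" and b': "smooth_map_from I T \<A> (\<lambda>t. h \<otimes> \<beta> t)"
    using ha hb by (auto simp: smooth_curve_at_def)
  have ha': "smooth_curve_at (\<lambda>t. h \<otimes> \<alpha> t \<otimes> inv h) 0 J" and hb': "smooth_curve_at (\<lambda>t. h \<otimes> \<beta> t \<otimes> inv h) 0 I"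
    using h ha hb by (auto intro: smooth_curve_at_right)
  have "gh (Ad h u) (Ad h v) = g \<one> (velocity \<A> (\<lambda>t. h \<otimes> \<alpha> t \<otimes> inv h) 0 (at 0 within J))
      (velocity \<A> (\<lambda>t. h \<otimes> \<beta> t \<otimes> inv h) 0 (at 0 within I))"
    using velocity_base_one[OF ha'] velocity_base_one[OF hb'] lder_conj_base[OF h] \<alpha> \<beta> h by (simp add: gh_def)
  also have "\<dots> = g h (velocity \<A> (\<lambda>t. h \<otimes> \<alpha> t) 0 (at 0 within J)) (velocity \<A> (\<lambda>t. h \<otimes> \<beta> t) 0 (at 0 within I))"
    using bi_invariant_metric_velocity(2)[OF bi_inv inv_closed[OF h] a' a(2,3) b' b(2,3)] \<alpha>(2) \<beta>(2) h by simp
  also have "\<dots> = g \<one> (velocity \<A> \<alpha> 0 (at 0 within J)) (velocity \<A> \<beta> 0 (at 0 within I))"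
    using bi_invariant_metric_velocity(1)[OF bi_inv h a b] \<alpha>(2) \<beta>(2) h by simp
  also have "\<dots> = gh u v"
    using velocity_base_one[OF \<alpha>(1,2)] velocity_base_one[OF \<beta>(1,2)] \<alpha>(3) \<beta>(3) by (simp add: gh_def)
  finally show ?thesis .
qed

text \<open>A vector on which \<omega> does not vanish is the velocity of a coordinate line, whose
  logarithmic derivative carries the value of \<omega> to the identity.\<close>

lemma wh_nontrivial: "\<exists>u. wh u \<noteq> 0"
proof -
  obtain p v where p: "p \<in> topspace T" and v: "v \<in> tangent_space \<A> p" "\<omega> p v \<noteq> 0" using nontrivial by blast
  obtain c where c: "c \<in> charts_at \<A> p" using chart_at[OF p] by blast
  have vc: "v = tvec_of_coords \<A> c p (v c)" by (rule tangent_space_eq_tvec_of_coords[OF v(1) c])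
  define \<alpha> where "\<alpha> = (\<lambda>t::real. chart_inv c (snd c p + t *\<^sub>R v c))"
  obtain \<delta> where \<delta>: "\<delta> > 0" "smooth_map_from {0..\<delta>} T \<A> \<alpha>"
    "velocity \<A> \<alpha> 0 (at 0 within {0..\<delta>}) = v"
    using coordinate_curve[OF c, of "v c"] vc unfolding \<alpha>_def by metis
  have 1: "smooth_curve_at \<alpha> 0 {0..\<delta>}" using \<delta> by (auto simp: smooth_curve_at_def at_within_Icc_at_right)
  have "\<alpha> 0 = p" using c chart_inv_chart by (auto simp: \<alpha>_def charts_at_def)
  then show ?thesis using form_lder[OF 1] \<delta>(3) v(2) by metis
qed

text \<open>Riesz representation for \<open>gh\<close>. The map \<open>L\<close> expresses
  \<open>gh\<close> through the standard inner product; definiteness makes it injective, finite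
  dimension then surjective.\<close>

lemma dual_vector:
  obtains B where "\<And>v. gh B v = wh v" "wh B \<noteq> 0"
proof -
  define L where "L u = (\<Sum>b\<in>Basis. gh u b *\<^sub>R b)" for u
  have inner_L: "L u \<bullet> v = gh u v" for u v
  proof -
    have "gh u v = (\<Sum>b\<in>Basis. (v \<bullet> b) * gh u b)"
      using linear_Basis_sum[OF linear_gh', of u v] by simp
    then show ?thesis by (simp add: L_def inner_sum_left inner_commute[of v] mult.commute)
  qed
  have "linear L"
    unfolding L_def
    by (intro linearI) (simp_all add: linear_add[OF linear_gh] linear_scale[OF linear_gh] scaleR_left_distrib
        sum.distrib scaleR_sum_right)
  moreover have "inj L"
  proof (subst linear_injective_0[OF \<open>linear L\<close>], intro allI impI)
    fix u assume "L u = 0"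
    then have "gh u u = 0" using inner_L[of u u] by simp
    then show "u = 0" using gh_pos[of u] by fastforce
  qed
  ultimately have "surj L" by (rule linear_inj_imp_surj)
  then obtain B where B: "L B = (\<Sum>b\<in>Basis. wh b *\<^sub>R b)" by (metis surjD)
  have eq: "gh B v = wh v" for v
  proof -
    have "wh v = (\<Sum>b\<in>Basis. (v \<bullet> b) * wh b)"
      using linear_Basis_sum[OF linear_wh, of v] by simp
    also have "\<dots> = L B \<bullet> v" by (simp add: B inner_sum_left inner_commute[of v] mult.commute)
    finally show ?thesis by (simp add: inner_L)
  qed
  have "B \<noteq> 0" using eq wh_nontrivial linear_0[OF linear_gh] by metis
  then have "wh B \<noteq> 0" using gh_pos[of B] eq[of B] by simp
  with eq show thesis by (rule that)
qed

text \<open>\<omega>(Ad v) = g(B, Ad v) = g(Ad B, Ad v) = g(B, v) = \<omega>(v).\<close>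

lemma wh_Ad:
  assumes B: "\<And>v. gh B v = wh v" and h: "h \<in> carrier G" and fixed: "Ad h B = B"
  shows "wh (Ad h v) = wh v"
  using gh_Ad[OF h, of B v] by (simp add: fixed B)

end

section \<open>One-parameter subgroups\<close>

context Lie_group
begin

text \<open>The constant 1/8 is the one in \<open>ode_parameter_estimate\<close>. On such a ball
  \<open>Mfield p\<close> is within 1/8 of the identity, and the field for a vector of norm at most
  \<open>R\<close> has Lipschitz constant 1/8.\<close>

definition good_radius where
  "good_radius R \<longleftrightarrow> R > 0 \<and> cball e0 R \<subseteq> E1 \<and> (\<exists>C\<ge>0. C * R \<le> 1/8 \<and>
     (\<forall>p\<in>cball e0 R. \<forall>q\<in>cball e0 R. \<forall>u. norm (Mfield p u - Mfield q u) \<le> C * norm (p - q) * norm u))"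

text \<open>For each fixed direction \<open>b\<close> the field is locally Lipschitz; linearity in
  the direction lets the constants of the finitely many basis vectors add up.\<close>

lemma good_radius_exists: "\<exists>R. good_radius R"
proof -
  have "\<exists>r C. r > 0 \<and> C \<ge> 0 \<and> cball e0 r \<subseteq> E1 \<and>
      (\<forall>p\<in>cball e0 r. \<forall>q\<in>cball e0 r. norm (Mfield p b - Mfield q b) \<le> C * norm (p - q))" for b
  proof -
    obtain r C where "r > 0" "C \<ge> 0" "cball e0 r \<subseteq> E1"
      "\<And>x y. x \<in> cball e0 r \<Longrightarrow> y \<in> cball e0 r \<Longrightarrow> norm (Mfield x b - Mfield y b) \<le> C * norm (x - y)"
      using smooth_on_locally_Lipschitz[OF open_E1 smooth_Mfield[of b] e0_E1] by blast
    then show ?thesis by blast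
  qed
  then obtain r C where rC0: "\<And>b. r b > 0 \<and> C b \<ge> 0 \<and> cball e0 (r b) \<subseteq> E1 \<and>
      (\<forall>p\<in>cball e0 (r b). \<forall>q\<in>cball e0 (r b). norm (Mfield p b - Mfield q b) \<le> C b * norm (p - q))"
    by metis
  have rC: "r b > 0" "C b \<ge> 0" "cball e0 (r b) \<subseteq> E1"
    "p \<in> cball e0 (r b) \<Longrightarrow> q \<in> cball e0 (r b) \<Longrightarrow> norm (Mfield p b - Mfield q b) \<le> C b * norm (p - q)" for b p q
    using rC0 by blast+
  define C' where "C' = (\<Sum>b\<in>Basis. C b)"
  \<comment> \<open>The second entry yields \<open>C' * R\<close> \<le> 1/8; the added 1 covers the
    case \<open>C' = 0\<close>.\<close>
  define R where "R = min (Min (r ` Basis)) (1 / (8 * (C' + 1)))"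
  have C': "C' \<ge> 0" by (simp add: C'_def rC sum_nonneg)
  have R: "R > 0" using rC(1) C' by (auto simp: R_def)
  have Rr: "R \<le> r b" if "b \<in> Basis" for b
    using that by (auto simp: R_def intro: min.coboundedI1)
  obtain b :: 'e where b: "b \<in> Basis" using nonempty_Basis by blast
  have sub: "cball e0 R \<subseteq> E1" using rC(3)[of b] Rr[OF b] by (meson order_trans subset_cball)
  have "C' * R \<le> C' * (1 / (8 * (C' + 1)))" using C' by (intro mult_left_mono) (auto simp: R_def)
  also have "\<dots> \<le> 1/8" using C' by (simp add: divide_simps)
  finally have CR: "C' * R \<le> 1/8" .
  have "norm (Mfield p u - Mfield q u) \<le> C' * norm (p - q) * norm u"
    if p: "p \<in> cball e0 R" and q: "q \<in> cball e0 R" for p q u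
  proof -
    have lin: "linear (Mfield p)" "linear (Mfield q)" using p q sub linear_Mfield by auto
    have "Mfield p u - Mfield q u = (\<Sum>b\<in>Basis. (u \<bullet> b) *\<^sub>R (Mfield p b - Mfield q b))"
      by (simp add: linear_Basis_sum[OF lin(1), of u] linear_Basis_sum[OF lin(2), of u]
          scaleR_diff_right sum_subtractf)
    also have "norm \<dots> \<le> (\<Sum>b\<in>Basis. norm u * (C b * norm (p - q)))"
    proof (intro sum_norm_le)
      fix b :: 'e assume b: "b \<in> Basis"
      have "p \<in> cball e0 (r b)" "q \<in> cball e0 (r b)" using p q Rr[OF b] by auto
      then show "norm ((u \<bullet> b) *\<^sub>R (Mfield p b - Mfield q b)) \<le> norm u * (C b * norm (p - q))"
        using rC(4) Basis_le_norm[OF b, of u] by (simp add: mult_mono)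
    qed
    also have "\<dots> = C' * norm (p - q) * norm u"
      by (simp add: C'_def sum_distrib_left sum_distrib_right mult_ac)
    finally show ?thesis .
  qed
  then show ?thesis using R sub CR C' unfolding good_radius_def by blast
qed

definition rad where "rad = (SOME R. good_radius R)"

lemma good_radius_rad: "good_radius rad"
  unfolding rad_def using good_radius_exists by (rule someI_ex)

lemma rad_pos: "rad > 0" and cball_rad: "cball e0 rad \<subseteq> E1"
  using good_radius_rad by (auto simp: good_radius_def)

definition Mlip where
  "Mlip = (SOME C. C \<ge> 0 \<and> C * rad \<le> 1/8 \<and>
     (\<forall>p\<in>cball e0 rad. \<forall>q\<in>cball e0 rad. \<forall>u. norm (Mfield p u - Mfield q u) \<le> C * norm (p - q) * norm u))"

lemma Mlip:
  shows Mlip_nonneg: "Mlip \<ge> 0" and Mlip_rad: "Mlip * rad \<le> 1/8"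
    and Mfield_Lipschitz: "\<And>p q u. p \<in> cball e0 rad \<Longrightarrow> q \<in> cball e0 rad \<Longrightarrow>
      norm (Mfield p u - Mfield q u) \<le> Mlip * norm (p - q) * norm u"
proof -
  let ?P = "\<lambda>C. C \<ge> 0 \<and> C * rad \<le> 1/8 \<and>
     (\<forall>p\<in>cball e0 rad. \<forall>q\<in>cball e0 rad. \<forall>u. norm (Mfield p u - Mfield q u) \<le> C * norm (p - q) * norm u)"
  have "\<exists>C. ?P C" using good_radius_rad unfolding good_radius_def by blast
  then have "?P Mlip" unfolding Mlip_def by (rule someI_ex)
  then show "Mlip \<ge> 0" "Mlip * rad \<le> 1/8" "\<And>p q u. p \<in> cball e0 rad \<Longrightarrow> q \<in> cball e0 rad \<Longrightarrow>
      norm (Mfield p u - Mfield q u) \<le> Mlip * norm (p - q) * norm u" by blast+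
qed

lemma Mfield_contraction:
  assumes "norm l \<le> rad" "p \<in> cball e0 rad" "q \<in> cball e0 rad"
  shows "norm (Mfield p l - Mfield q l) \<le> 1/8 * norm (p - q)"
proof -
  have "norm (Mfield p l - Mfield q l) \<le> Mlip * norm (p - q) * norm l"
    by (rule Mfield_Lipschitz[OF assms(2,3)])
  also have "\<dots> \<le> Mlip * norm (p - q) * rad" using assms(1) Mlip_nonneg by (intro mult_left_mono) auto
  also have "\<dots> = (Mlip * rad) * norm (p - q)" by simp
  also have "\<dots> \<le> 1/8 * norm (p - q)" using Mlip_rad by (intro mult_right_mono) auto
  finally show ?thesis .
qed

lemma Mfield_near_ident:
  assumes p: "p \<in> cball e0 rad"
  shows "norm (Mfield p u - u) \<le> norm u / 8"
proof -
  have "norm (Mfield p u - Mfield e0 u) \<le> Mlip * norm (p - e0) * norm u"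
    using p rad_pos by (intro Mfield_Lipschitz) auto
  also have "\<dots> \<le> (Mlip * rad) * norm u"
    using p Mlip_nonneg by (intro mult_right_mono mult_left_mono) (auto simp: dist_norm norm_minus_commute)
  also have "\<dots> \<le> (1/8) * norm u" using Mlip_rad by (intro mult_right_mono) auto
  finally show ?thesis by (simp add: Mfield_e0)
qed

lemma Mfield_inj:
  assumes p: "p \<in> cball e0 rad" and eq: "Mfield p u = Mfield p v"
  shows "u = v"
proof -
  have "Mfield p (u - v) = 0"
    using linear_diff[OF linear_Mfield] p cball_rad eq by auto
  then have "norm (u - v) \<le> norm (u - v) / 8"
    using Mfield_near_ident[OF p, of "u - v"] by (simp only: diff_0 norm_minus_cancel)
  then show ?thesis by simp
qed

definition integral_curve where
  "integral_curve l b x \<longleftrightarrow> (\<forall>t\<in>{0..b}. x t \<in> cball e0 rad \<and>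
     (x has_vector_derivative Mfield (x t) l) (at t within {0..b}))"

lemma integral_curve_unique:
  assumes l: "norm l \<le> rad" and x: "integral_curve l b x" and y: "integral_curve l b y"
    and "b \<le> 1" "x 0 = y 0" "t \<in> {0..b}"
  shows "x t = y t"
proof -
  show ?thesis
    using ode_unique[of "cball e0 rad" "\<lambda>p. Mfield p l" "1/8" b x y t] Mfield_contraction[OF l] assms
    unfolding integral_curve_def by auto
qed

text \<open>Halving the radius leaves room for \<open>Mfield\<close>, whose values on the ball
  exceed \<open>norm l\<close> by at most an eighth of it: the speed is at most \<open>rad\<close>,
  so the curve stays in the ball for unit time.\<close>

lemma integral_curve_exists:
  assumes l: "norm l \<le> rad / 2"
  shows "\<exists>x. x 0 = e0 \<and> integral_curve l 1 x"
proof -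
  have lr: "norm l \<le> rad" using l rad_pos by simp
  show ?thesis
  proof (rule picard_existence[of e0 rad "\<lambda>p. Mfield p l" "1/8"])
    show "norm (Mfield p l - Mfield q l) \<le> 1/8 * norm (p - q)"
      if "p \<in> cball e0 rad" "q \<in> cball e0 rad" for p q by (rule Mfield_contraction[OF lr that])
    show "norm (Mfield p l) \<le> rad" if "p \<in> cball e0 rad" for p
    proof -
      have "norm (Mfield p l) \<le> norm (Mfield p l - l) + norm l"
        using norm_triangle_ineq[of "Mfield p l - l" l] by simp
      then show ?thesis using Mfield_near_ident[OF that, of l] l rad_pos by linarith
    qed
    fix x assume "x 0 = e0" "\<And>t. t \<in> {0..1} \<Longrightarrow> x t \<in> cball e0 rad"
      "\<And>t. t \<in> {0..1} \<Longrightarrow> (x has_vector_derivative Mfield (x t) l) (at t within {0..1})"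
    then show ?thesis unfolding integral_curve_def by blast
  qed (use rad_pos in auto)
qed

text \<open>The curve t \<mapsto> exp(t l) in coordinates, for t in [0,1] and \<open>norm l\<close>
  at most \<open>rad / 2\<close>.\<close>

definition expc where "expc l = (SOME x. x 0 = e0 \<and> integral_curve l 1 x)"

lemma expc:
  assumes "norm l \<le> rad / 2"
  shows "expc l 0 = e0" "integral_curve l 1 (expc l)"
  using someI_ex[OF integral_curve_exists[OF assms]] by (auto simp: expc_def)

lemma expc_E1: "norm l \<le> rad / 2 \<Longrightarrow> t \<in> {0..1} \<Longrightarrow> expc l t \<in> E1"
  using expc(2) cball_rad unfolding integral_curve_def by blast

lemma expc_estimate:
  assumes l: "norm l \<le> rad / 2" and m: "norm m \<le> rad / 2" and t: "t \<in> {0..1}"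
  shows "norm (expc l t - expc m t - t *\<^sub>R (l - m)) \<le> norm (l - m) / 2"
proof -
  show ?thesis
    by (rule ode_parameter_estimate[of e0 rad Mfield Mlip m "expc l" l "expc m"])
      (use Mlip expc[OF l] expc[OF m] rad_pos m t linear_diff[OF linear_Mfield] cball_rad
        in \<open>auto simp: integral_curve_def Mfield_e0 subset_iff\<close>)
qed

text \<open>Comparison with the constant curve \<open>expc 0\<close>; the factor 2 absorbs 1 +
  1/2.\<close>

lemma expc_near:
  assumes l: "norm l \<le> rad / 2" and t: "t \<in> {0..1}"
  shows "norm (expc l t - e0) \<le> 2 * norm l"
proof -
  have "linear (Mfield e0)" by (rule linear_Mfield[OF e0_E1])
  then have "integral_curve 0 1 (\<lambda>_. e0)"
    using rad_pos by (auto simp: integral_curve_def Mfield_e0 intro!: derivative_eq_intros)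
  then have "expc 0 t = e0"
    using integral_curve_unique[of 0 1 "expc 0" "\<lambda>_. e0" t] expc[of 0] rad_pos t by simp
  then have "norm (expc l t - e0 - t *\<^sub>R l) \<le> norm l / 2"
    using expc_estimate[OF l, of 0 t] rad_pos t by simp
  moreover have "norm (t *\<^sub>R l) \<le> norm l" using t by (auto intro: mult_left_le_one_le)
  moreover have "norm (expc l t - e0) \<le> norm (expc l t - e0 - t *\<^sub>R l) + norm (t *\<^sub>R l)"
    using norm_triangle_ineq[of "expc l t - e0 - t *\<^sub>R l" "t *\<^sub>R l"] by simp
  ultimately show ?thesis using norm_ge_zero[of l] by linarith
qed

text \<open>Running the curve of \<open>l\<close> at speed \<open>s\<close> gives an integral curve
  for \<open>s *\<^sub>R l\<close> with the same start, and integral curves are unique.\<close>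

lemma expc_scale:
  assumes l: "norm l \<le> rad / 2" and s: "s \<in> {0..1}" and t: "t \<in> {0..1}"
  shows "expc (s *\<^sub>R l) t = expc l (s * t)"
proof (rule integral_curve_unique[of "s *\<^sub>R l" 1 "expc (s *\<^sub>R l)" "\<lambda>t. expc l (s * t)"])
  have "norm (s *\<^sub>R l) \<le> norm l" using s by (auto intro: mult_left_le_one_le)
  then have sl: "norm (s *\<^sub>R l) \<le> rad / 2" using l by simp
  show "norm (s *\<^sub>R l) \<le> rad" using sl rad_pos by simp
  show "integral_curve (s *\<^sub>R l) 1 (expc (s *\<^sub>R l))" "expc (s *\<^sub>R l) 0 = expc l (s * 0)"
    using expc[OF sl] expc[OF l] by auto
  show "integral_curve (s *\<^sub>R l) 1 (\<lambda>t. expc l (s * t))"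
    unfolding integral_curve_def
  proof
    fix t :: real assume t: "t \<in> {0..1}"
    then have st: "s * t \<in> {0..1}" using s by (auto intro: mult_le_one)
    have "linear (Mfield (expc l (s * t)))" by (rule linear_Mfield[OF expc_E1[OF l st]])
    then have sc: "Mfield (expc l (s * t)) (s *\<^sub>R l) = s *\<^sub>R Mfield (expc l (s * t)) l" by (rule linear_scale)
    have "(\<lambda>t. s * t) ` {0..1} \<subseteq> {0..1}" using s by (auto intro: mult_le_one)
    moreover have "(expc l has_vector_derivative Mfield (expc l (s * t)) l) (at (s * t) within {0..1})"
      using expc(2)[OF l] st by (auto simp: integral_curve_def)
    ultimately have "(expc l has_vector_derivative Mfield (expc l (s * t)) l) (at (s * t) within (\<lambda>t. s * t) ` {0..1})"
      using has_vector_derivative_within_subset by blast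
    moreover have "((\<lambda>t. s * t) has_vector_derivative s) (at t within {0..1})"
      by (auto intro!: derivative_eq_intros simp: has_vector_derivative_def)
    ultimately have "((\<lambda>t. expc l (s * t)) has_vector_derivative s *\<^sub>R Mfield (expc l (s * t)) l) (at t within {0..1})"
      using vector_diff_chain_within[of "\<lambda>t. s * t" s t "{0..1}" "expc l"] by (simp add: comp_def)
    then show "expc l (s * t) \<in> cball e0 rad \<and> ((\<lambda>t. expc l (s * t)) has_vector_derivative
        Mfield (expc l (s * t)) (s *\<^sub>R l)) (at t within {0..1})"
      using expc(2)[OF l] st sc by (auto simp: integral_curve_def)
  qed
qed (use t in auto)

text \<open>Bootstrap in x' = M(x) l: if x is of class k, so is the right-hand side, and x is of
  class k + 1. The interval is open because \<open>Ck_on\<close> asks for two-sided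
  derivatives.\<close>

lemma smooth_on_expc:
  assumes l: "norm l \<le> rad / 2"
  shows "smooth_on {0<..<1} (expc l)"
proof -
  have d: "(expc l has_derivative (\<lambda>h. h *\<^sub>R Mfield (expc l t) l)) (at t)" if "t \<in> {0<..<1}" for t
  proof -
    have "(expc l has_vector_derivative Mfield (expc l t) l) (at t within {0..1})"
      using expc(2)[OF l] that by (auto simp: integral_curve_def)
    moreover have "at t within {0..1} = at t" using that by (auto intro!: at_within_Icc_at)
    ultimately show ?thesis by (simp add: has_vector_derivative_def)
  qed
  have in_E1: "expc l ` {0<..<1} \<subseteq> E1" using expc_E1[OF l] by auto
  have "Ck_on k (expc l) {0<..<1}" for k
  proof (induction k)
    case 0
    have "isCont (expc l) t" if "t \<in> {0<..<1}" for t using d[OF that] has_derivative_continuous by blast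
    then show ?case by (simp add: continuous_at_imp_continuous_on)
  next
    case (Suc k)
    have M: "Ck_on k (\<lambda>p. Mfield p l) E1" using smooth_Mfield open_E1 smooth_on_open by blast
    have "Ck_on k (\<lambda>t. Mfield (expc l t) l) {0<..<1}"
      by (rule Ck_on_compose[OF open_greaterThanLessThan open_E1 in_E1 Suc M])
    then have c: "Ck_on k (\<lambda>t. v *\<^sub>R Mfield (expc l t) l) {0<..<1}" for v
      by (rule Ck_on_scaleR[OF open_greaterThanLessThan Ck_on_const])
    show ?case by (rule Ck_on_SucI[OF open_greaterThanLessThan d c])
  qed
  then show ?thesis by (simp add: smooth_on_open)
qed

text \<open>Left invariance of the field \<open>Mfield\<close> in coordinates: differentiate a(bz) =
  (ab)z with respect to z at the identity.\<close>

lemma frechet_mul_Mfield: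
  assumes ab: "(a, b) \<in> mul_dom"
  shows "frechet_derivative mul (at (a, b)) (0, Mfield b u) = Mfield (mul (a, b)) u"
proof -
  have a: "a \<in> E1" and b: "b \<in> E1" and abU: "\<iota> a \<otimes> \<iota> b \<in> U1" using ab by (auto simp: mul_dom_def)
  have mab: "mul (a, b) \<in> E1" using abU by (simp add: mul_def kappa_E1)
  \<comment> \<open>On \<open>N\<close> the product bz stays in the chart, so the nested coordinate
    products are genuine group products and associativity applies.\<close>
  define N where "N = (\<lambda>z. (b, z)) -` mul_dom"
  have N: "open N" "e0 \<in> N"
    unfolding N_def using mul_e0_right[OF b]
    by (auto intro!: open_vimage open_mul_dom continuous_intros)
  have A1: "((\<lambda>z. (b, z)) has_derivative (\<lambda>h. (0, h))) (at e0)" by (auto intro!: derivative_eq_intros)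
  have B1: "(mul has_derivative frechet_derivative mul (at (b, e0))) (at (b, e0))"
    using mul_e0_right[OF b] by (intro mul_has_derivative) simp
  have 1: "((\<lambda>z. mul (b, z)) has_derivative Mfield b) (at e0)"
    unfolding Mfield_def[abs_def] by (rule has_derivative_compose[OF A1 B1])
  have A2: "((\<lambda>z. (a, mul (b, z))) has_derivative (\<lambda>h. (0, Mfield b h))) (at e0)"
    using 1 by (auto intro!: derivative_eq_intros)
  have B2: "(mul has_derivative frechet_derivative mul (at (a, b))) (at (a, mul (b, e0)))"
    using mul_has_derivative[OF ab] mul_e0_right[OF b] by simp
  have 2: "((\<lambda>z. mul (a, mul (b, z))) has_derivative
      (\<lambda>h. frechet_derivative mul (at (a, b)) (0, Mfield b h))) (at e0)"
    by (rule has_derivative_compose[OF A2 B2])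
  have A3: "((\<lambda>z. (mul (a, b), z)) has_derivative (\<lambda>h. (0, h))) (at e0)" by (auto intro!: derivative_eq_intros)
  have B3: "(mul has_derivative frechet_derivative mul (at (mul (a, b), e0))) (at (mul (a, b), e0))"
    using mul_e0_right[OF mab] by (intro mul_has_derivative) simp
  have 3: "((\<lambda>z. mul (mul (a, b), z)) has_derivative Mfield (mul (a, b))) (at e0)"
    unfolding Mfield_def[abs_def] by (rule has_derivative_compose[OF A3 B3])
  have "((\<lambda>z. mul (a, mul (b, z))) has_derivative Mfield (mul (a, b))) (at e0)"
  proof (rule has_derivative_transform_within_open[OF 3 N])
    fix z assume "z \<in> N"
    then have "\<iota> b \<otimes> \<iota> z \<in> U1" "z \<in> E1" by (auto simp: N_def mul_dom_def)
    then show "mul (mul (a, b), z) = mul (a, mul (b, z))"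
      using a b abU by (simp add: mul_def iota_kappa m_assoc iota_carrier)
  qed
  from fun_cong[OF has_derivative_unique[OF 2 this], of u] show ?thesis by simp
qed

text \<open>Exponential curves with \<open>norm l\<close> at most \<open>exp_rad\<close> stay within
  twice that radius of \<open>e0\<close>, by \<open>expc_near\<close>. A product of two of their
  points has to remain in the ball on which integral curves are unique.\<close>

definition exp_rad where
  "exp_rad = (SOME r. r > 0 \<and> r \<le> rad / 2 \<and>
     (\<forall>a\<in>cball e0 (2 * r). \<forall>b\<in>cball e0 (2 * r). (a, b) \<in> mul_dom \<and> mul (a, b) \<in> cball e0 rad))"

lemma exp_rad:
  shows exp_rad_pos: "exp_rad > 0" and exp_rad_le: "exp_rad \<le> rad / 2"
    and exp_rad_mul: "\<And>a b. a \<in> cball e0 (2 * exp_rad) \<Longrightarrow> b \<in> cball e0 (2 * exp_rad) \<Longrightarrow>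
      (a, b) \<in> mul_dom \<and> mul (a, b) \<in> cball e0 rad"
proof -
  have cont: "continuous_on mul_dom mul" by (rule smooth_on_imp_continuous_on[OF smooth_mul])
  have o: "open (mul_dom \<inter> mul -` ball e0 rad)"
    by (rule continuous_open_preimage[OF cont open_mul_dom open_ball])
  have e: "(e0, e0) \<in> mul_dom \<inter> mul -` ball e0 rad"
    using mul_e0_left[OF e0_E1] rad_pos by simp
  obtain A B where AB: "open A" "open B" "(e0, e0) \<in> A \<times> B" "A \<times> B \<subseteq> mul_dom \<inter> mul -` ball e0 rad"
    by (rule open_prod_elim[OF o e])
  obtain r1 where r1: "r1 > 0" "cball e0 r1 \<subseteq> A" using AB(1,3) open_contains_cball by blast
  obtain r2 where r2: "r2 > 0" "cball e0 r2 \<subseteq> B" using AB(2,3) open_contains_cball by blast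
  let ?r = "min (rad / 2) (min r1 r2 / 2)"
  let ?P = "\<lambda>r. r > 0 \<and> r \<le> rad / 2 \<and>
     (\<forall>a\<in>cball e0 (2 * r). \<forall>b\<in>cball e0 (2 * r). (a, b) \<in> mul_dom \<and> mul (a, b) \<in> cball e0 rad)"
  have "?P ?r"
  proof (intro conjI ballI)
    fix a b assume ab: "a \<in> cball e0 (2 * ?r)" "b \<in> cball e0 (2 * ?r)"
    have "2 * ?r \<le> r1" "2 * ?r \<le> r2" by linarith+
    then have "a \<in> cball e0 r1" "b \<in> cball e0 r2" using ab unfolding mem_cball by linarith+
    then have "(a, b) \<in> mul_dom \<inter> mul -` ball e0 rad" using AB(4) r1(2) r2(2) by blast
    then show "(a, b) \<in> mul_dom" "mul (a, b) \<in> cball e0 rad" by auto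
  qed (use rad_pos r1 r2 in auto)
  then have "?P exp_rad" unfolding exp_rad_def by (rule someI)
  then show "exp_rad > 0" "exp_rad \<le> rad / 2"
    "\<And>a b. a \<in> cball e0 (2 * exp_rad) \<Longrightarrow> b \<in> cball e0 (2 * exp_rad) \<Longrightarrow>
      (a, b) \<in> mul_dom \<and> mul (a, b) \<in> cball e0 rad" by blast+
qed

text \<open>For fixed \<open>s\<close> both sides, as functions of \<open>t\<close>, are integral
  curves on [0, 1 - s] starting at \<open>expc l s\<close>; for the product this is left invariance
  of the field.\<close>

lemma expc_add:
  assumes l: "norm l \<le> exp_rad" and s: "0 \<le> s" and t: "0 \<le> t" and st: "s + t \<le> 1"
  shows "(expc l s, expc l t) \<in> mul_dom \<and> expc l (s + t) = mul (expc l s, expc l t)"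
proof -
  have lr: "norm l \<le> rad / 2" using l exp_rad_le by simp
  have near: "expc l t \<in> cball e0 (2 * exp_rad)" if "t \<in> {0..1}" for t
    using expc_near[OF lr that] l by (simp add: dist_norm norm_minus_commute)
  have md: "(expc l s, expc l t) \<in> mul_dom" "mul (expc l s, expc l t) \<in> cball e0 rad" if "t \<in> {0..1 - s}" for t
    using exp_rad_mul[OF near near, of s t] that s by auto
  have "expc l (s + t) = mul (expc l s, expc l t)"
  proof (rule integral_curve_unique[of l "1 - s" "\<lambda>t. expc l (s + t)" "\<lambda>t. mul (expc l s, expc l t)"])
    show "norm l \<le> rad" using lr rad_pos by simp
    show "integral_curve l (1 - s) (\<lambda>t. expc l (s + t))"
      unfolding integral_curve_def
    proof
      fix t assume t: "t \<in> {0..1 - s}"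
      have "(expc l has_vector_derivative Mfield (expc l (s + t)) l) (at (s + t) within {0..1})"
        using expc(2)[OF lr] t s by (auto simp: integral_curve_def)
      then have "(expc l has_vector_derivative Mfield (expc l (s + t)) l) (at (s + t) within (\<lambda>t. s + t) ` {0..1 - s})"
        by (rule has_vector_derivative_within_subset) (use s in auto)
      moreover have "((\<lambda>t. s + t) has_vector_derivative 1) (at t within {0..1 - s})"
        by (auto intro!: derivative_eq_intros)
      ultimately have "((\<lambda>t. expc l (s + t)) has_vector_derivative Mfield (expc l (s + t)) l) (at t within {0..1 - s})"
        using vector_diff_chain_within[of "\<lambda>t. s + t" 1 t "{0..1 - s}" "expc l"] by (simp add: comp_def)
      then show "expc l (s + t) \<in> cball e0 rad \<and> ((\<lambda>t. expc l (s + t)) has_vector_derivative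
          Mfield (expc l (s + t)) l) (at t within {0..1 - s})"
        using expc(2)[OF lr] t s by (auto simp: integral_curve_def)
    qed
    show "integral_curve l (1 - s) (\<lambda>t. mul (expc l s, expc l t))"
      unfolding integral_curve_def
    proof
      fix t assume t: "t \<in> {0..1 - s}"
      have "(expc l has_vector_derivative Mfield (expc l t) l) (at t within {0..1 - s})"
        by (rule has_vector_derivative_within_subset[of _ _ _ "{0..1}"])
          (use expc(2)[OF lr] t s in \<open>auto simp: integral_curve_def\<close>)
      then have "((\<lambda>t. (expc l s, expc l t)) has_vector_derivative (0, Mfield (expc l t) l)) (at t within {0..1 - s})"
        by (auto intro!: has_vector_derivative_Pair derivative_eq_intros)
      from has_vector_derivative_compose_frechet[OF mul_has_derivative[OF md(1)[OF t]] this]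
      show "mul (expc l s, expc l t) \<in> cball e0 rad \<and> ((\<lambda>t. mul (expc l s, expc l t)) has_vector_derivative
          Mfield (mul (expc l s, expc l t)) l) (at t within {0..1 - s})"
        using md[OF t] by (simp add: frechet_mul_Mfield)
    qed
    show "expc l (s + 0) = mul (expc l s, expc l 0)"
      using expc(1)[OF lr] mul_e0_right[OF expc_E1[OF lr, of s]] s t st by simp
  qed (use s t st in auto)
  then show ?thesis using md(1)[of t] t st by simp
qed

end

section \<open>One-parameter subgroups defined on the whole real line\<close>

context Lie_group
begin

lemma commutes_int_pow:
  assumes x: "x \<in> carrier G" and y: "y \<in> carrier G" and xy: "x \<otimes> y = y \<otimes> x"
  shows "x [^] (n::int) \<otimes> y = y \<otimes> x [^] n"
proof -
  have p: "x [^] k \<otimes> y = y \<otimes> x [^] k" for k :: nat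
    using group_commutes_pow[OF xy x y] .
  have "inv (x [^] k) \<otimes> y = y \<otimes> inv (x [^] k)" for k :: nat
  proof -
    have xk: "x [^] k \<in> carrier G" using x by simp
    have y': "y = inv (x [^] k) \<otimes> (y \<otimes> x [^] k)"
      using xk y p[of k] by (simp add: inv_solve_left)
    have "inv (x [^] k) \<otimes> y = inv (x [^] k) \<otimes> (y \<otimes> x [^] k) \<otimes> inv (x [^] k)"
      using xk y by (simp add: m_assoc)
    also have "\<dots> = y \<otimes> inv (x [^] k)" by (simp only: y'[symmetric])
    finally show ?thesis .
  qed
  with p show ?thesis unfolding int_pow_def2 by (cases "n < 0") (simp_all only: if_True if_False)
qed

text \<open>The derivative is prescribed for every \<open>J\<close>, which covers the one-sided
  derivatives used on the pieces of a variation.\<close>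

definition one_param where
  "one_param \<beta> l \<longleftrightarrow> (\<forall>s t. \<beta> (s + t) = \<beta> s \<otimes> \<beta> t) \<and> smooth_map_from UNIV T \<A> \<beta> \<and>
     (\<forall>s J. s \<in> J \<longrightarrow> at s within J \<noteq> bot \<longrightarrow> lder \<beta> s J = l)"

lemma one_param_add: "one_param \<beta> l \<Longrightarrow> \<beta> (s + t) = \<beta> s \<otimes> \<beta> t"
  by (simp add: one_param_def)

lemma one_param_smooth: "one_param \<beta> l \<Longrightarrow> smooth_map_from J T \<A> \<beta>"
  using smooth_map_from_subset[of UNIV T \<A> \<beta> J] by (simp add: one_param_def)

lemma one_param_carrier: "one_param \<beta> l \<Longrightarrow> \<beta> t \<in> carrier G"
  using smooth_map_from_carrier[of UNIV] by (auto simp: one_param_def)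

lemma one_param_zero: "one_param \<beta> l \<Longrightarrow> \<beta> 0 = \<one>"
  using one_param_add[of \<beta> l 0 0] one_param_carrier[of \<beta> l 0] by simp

lemma one_param_minus: "one_param \<beta> l \<Longrightarrow> \<beta> (- t) = inv (\<beta> t)"
  using one_param_add[of \<beta> l "-t" t] one_param_carrier[of \<beta> l t] one_param_carrier[of \<beta> l "-t"]
    one_param_zero[of \<beta> l] inv_equality[of "\<beta> (-t)" "\<beta> t"] by simp

lemma one_param_commute: "one_param \<beta> l \<Longrightarrow> \<beta> s \<otimes> \<beta> t = \<beta> t \<otimes> \<beta> s"
  using one_param_add[of \<beta> l s t] one_param_add[of \<beta> l t s] by (simp add: add.commute)

lemma one_param_curve:
  "one_param \<beta> l \<Longrightarrow> s \<in> J \<Longrightarrow> at s within J \<noteq> bot \<Longrightarrow> smooth_curve_at \<beta> s J"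
  by (simp add: smooth_curve_at_def one_param_smooth)

lemma one_param_lder:
  "one_param \<beta> l \<Longrightarrow> s \<in> J \<Longrightarrow> at s within J \<noteq> bot \<Longrightarrow> lder \<beta> s J = l"
  by (simp add: one_param_def)

text \<open>For a homomorphism the quotient \<beta>(s)^{-1} \<beta>(t) depends only on t - s, so the
  derivative at one point determines all others. The point \<open>a\<close> is left free because the
  exponential curve is differentiated at 1/2.\<close>

lemma one_paramI:
  assumes add: "\<And>s t. \<beta> (s + t) = \<beta> s \<otimes> \<beta> t" and smooth: "smooth_map_from UNIV T \<A> \<beta>"
    and l: "lder \<beta> a UNIV = l"
  shows "one_param \<beta> l"
  unfolding one_param_def
proof (intro conjI allI impI add smooth)
  fix s :: real and J assume s: "s \<in> J" "at s within J \<noteq> bot"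
  have c: "\<beta> t \<in> carrier G" for t using smooth_map_from_carrier[OF smooth] by simp
  have cv: "smooth_curve_at \<beta> a UNIV" using smooth by (simp add: smooth_curve_at_def)
  have "((\<lambda>t. a + (t - s)) has_vector_derivative 1) (at s within J)"
    by (auto intro!: derivative_eq_intros)
  moreover have "((\<lambda>t. \<kappa> (inv (\<beta> a) \<otimes> \<beta> t)) has_vector_derivative l) (at (a + (s - s)) within (\<lambda>t. a + (t - s)) ` J)"
    using lder_has_vector_derivative[OF cv] l by (auto intro: has_vector_derivative_at_within)
  ultimately have d: "((\<lambda>t. \<kappa> (inv (\<beta> a) \<otimes> \<beta> (a + (t - s)))) has_vector_derivative l) (at s within J)"
    using vector_diff_chain_within[of "\<lambda>t. a + (t - s)" 1 s J "\<lambda>t. \<kappa> (inv (\<beta> a) \<otimes> \<beta> t)" l] by (simp add: comp_def)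
  have "smooth_curve_at \<beta> s J"
    using s smooth_map_from_subset[OF smooth] by (simp add: smooth_curve_at_def)
  then show "lder \<beta> s J = l"
  proof (rule lder_eqI[OF _ d open_UNIV])
    fix t
    have "\<beta> (a + (t - s)) = \<beta> a \<otimes> \<beta> (t - s)" "\<beta> t = \<beta> s \<otimes> \<beta> (t - s)" using add[of a "t - s"] add[of s "t - s"] by auto
    then show "\<kappa> (inv (\<beta> a) \<otimes> \<beta> (a + (t - s))) = \<kappa> (inv (\<beta> s) \<otimes> \<beta> t)"
      using c by (simp add: m_assoc[symmetric])
  qed simp
qed

lemma one_param_scale:
  assumes \<beta>: "one_param \<beta> l"
  shows "one_param (\<lambda>t. \<beta> (c * t)) (c *\<^sub>R l)"
proof (rule one_paramI[of _ 0])
  show "\<beta> (c * (s + t)) = \<beta> (c * s) \<otimes> \<beta> (c * t)" for s t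
    by (simp add: distrib_left one_param_add[OF \<beta>])
  show sm: "smooth_map_from UNIV T \<A> (\<lambda>t. \<beta> (c * t))"
    by (rule smooth_map_from_compose[OF one_param_smooth[OF \<beta>, of UNIV]
        smooth_on_bounded_linear[OF bounded_linear_mult_right]]) simp
  have "((\<lambda>t. c * t) has_vector_derivative c) (at 0)"
    by (auto intro!: derivative_eq_intros simp: has_vector_derivative_def)
  moreover have "((\<lambda>t. \<kappa> (inv (\<beta> 0) \<otimes> \<beta> t)) has_vector_derivative l) (at (c * 0))"
    using lder_has_vector_derivative[OF one_param_curve[OF \<beta>], of 0 UNIV] one_param_lder[OF \<beta>, of 0 UNIV] by simp
  ultimately have d: "((\<lambda>t. \<kappa> (inv (\<beta> 0) \<otimes> \<beta> (c * t))) has_vector_derivative c *\<^sub>R l) (at 0)"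
    using vector_diff_chain_at[of "\<lambda>t. c * t" c 0 "\<lambda>t. \<kappa> (inv (\<beta> 0) \<otimes> \<beta> t)" l] by (simp add: comp_def)
  have "smooth_curve_at (\<lambda>t. \<beta> (c * t)) 0 UNIV" using sm by (simp add: smooth_curve_at_def)
  then show "lder (\<lambda>t. \<beta> (c * t)) 0 UNIV = c *\<^sub>R l"
    by (rule lder_eqI[OF _ d open_UNIV]) simp_all
qed

lemma one_param_mult:
  assumes \<beta>: "one_param \<beta> l" and \<eta>: "one_param \<eta> m"
    and comm: "\<And>s t. \<beta> s \<otimes> \<eta> t = \<eta> t \<otimes> \<beta> s"
  shows "one_param (\<lambda>t. \<beta> t \<otimes> \<eta> t) (l + m)"
proof (rule one_paramI[of _ 0])
  note c = one_param_carrier[OF \<beta>] one_param_carrier[OF \<eta>]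
  show "\<beta> (s + t) \<otimes> \<eta> (s + t) = \<beta> s \<otimes> \<eta> s \<otimes> (\<beta> t \<otimes> \<eta> t)" for s t
  proof -
    have "\<beta> t \<otimes> (\<eta> s \<otimes> \<eta> t) = \<eta> s \<otimes> (\<beta> t \<otimes> \<eta> t)" using c comm[of t s] by (metis m_assoc)
    then show ?thesis using c by (simp add: one_param_add[OF \<beta>] one_param_add[OF \<eta>] m_assoc)
  qed
  show "smooth_map_from UNIV T \<A> (\<lambda>t. \<beta> t \<otimes> \<eta> t)"
    by (intro smooth_map_from_mult one_param_smooth[OF \<beta>] one_param_smooth[OF \<eta>])
  show "lder (\<lambda>t. \<beta> t \<otimes> \<eta> t) 0 UNIV = l + m"
    using lder_mult_base[OF one_param_curve[OF \<beta>] one_param_zero[OF \<beta>] one_param_curve[OF \<eta>] one_param_zero[OF \<eta>]]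
    by (simp add: one_param_lder[OF \<beta>] one_param_lder[OF \<eta>])
qed

text \<open>The exponential curve is known on [0,1] and is continued by the integer powers of its
  end value.\<close>

definition expb where
  "expb l t = \<iota> (expc l 1) [^] \<lfloor>t\<rfloor> \<otimes> \<iota> (expc l (frac t))"

context
  fixes l :: 'e
  assumes l: "norm l \<le> exp_rad"
begin

lemma exp_rad_rad: "norm l \<le> rad / 2"
  using l exp_rad_le by simp

lemma iota_expc_carrier: "t \<in> {0..1} \<Longrightarrow> \<iota> (expc l t) \<in> carrier G"
  by (simp add: iota_carrier expc_E1[OF exp_rad_rad])

lemma iota_expc_add:
  assumes "0 \<le> s" "0 \<le> t" "s + t \<le> 1"
  shows "\<iota> (expc l (s + t)) = \<iota> (expc l s) \<otimes> \<iota> (expc l t)"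
proof -
  have "\<iota> (expc l s) \<otimes> \<iota> (expc l t) \<in> U1" "expc l (s + t) = \<kappa> (\<iota> (expc l s) \<otimes> \<iota> (expc l t))"
    using expc_add[OF l assms] by (simp_all add: mul_dom_def mul_def)
  then show ?thesis by (simp add: iota_kappa)
qed

lemma iota_expc_0: "\<iota> (expc l 0) = \<one>"
  using expc(1)[OF exp_rad_rad] iota_e0 by simp

lemma expb_eq: "t \<in> {0..1} \<Longrightarrow> expb l t = \<iota> (expc l t)"
proof -
  assume t: "t \<in> {0..1}"
  show ?thesis
  proof (cases "t = 1")
    case True
    then show ?thesis using iota_expc_carrier[of 1] iota_expc_0 by (simp add: expb_def)
  next
    case False
    then have "\<lfloor>t\<rfloor> = 0" using t by (simp add: floor_eq_iff)
    then show ?thesis using iota_expc_carrier[OF t] by (simp add: expb_def frac_def)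
  qed
qed

lemma expb_add: "expb l (s + t) = expb l s \<otimes> expb l t"
proof -
  let ?g = "\<lambda>t. \<iota> (expc l t)"
  let ?p = "?g 1"
  have fr: "frac x \<in> {0..1}" "frac x \<ge> 0" "frac x < 1" for x :: real
    using frac_ge_0[of x] frac_lt_1[of x] by auto
  note c = iota_expc_carrier
  have p: "?p \<in> carrier G" using c by simp
  \<comment> \<open>Splitting 1 as a + (1 - a) and as (1 - a) + a writes \<open>?p\<close> in two
    ways.\<close>
  have comm1: "?p \<otimes> ?g a = ?g a \<otimes> ?p" if a: "a \<in> {0..1}" for a
  proof -
    have "?p = ?g a \<otimes> ?g (1 - a)" "?p = ?g (1 - a) \<otimes> ?g a"
      using iota_expc_add[of a "1 - a"] iota_expc_add[of "1 - a" a] a by auto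
    then show ?thesis using c[OF a] c[of "1 - a"] a by (metis atLeastAtMost_iff diff_ge_0_iff_ge diff_le_eq le_add_same_cancel1 m_assoc)
  qed
  have comm: "?p [^] (n::int) \<otimes> ?g a = ?g a \<otimes> ?p [^] n" if a: "a \<in> {0..1}" for a n
    by (rule commutes_int_pow[OF p c[OF a] comm1[OF a]])
  have pc: "?p [^] (n::int) \<in> carrier G" for n using p by simp
  note gs = c[OF fr(1)[of s]] and gt = c[OF fr(1)[of t]]
  have rhs: "expb l s \<otimes> expb l t = ?p [^] (\<lfloor>s\<rfloor> + \<lfloor>t\<rfloor>) \<otimes> (?g (frac s) \<otimes> ?g (frac t))"
  proof -
    have "expb l s \<otimes> expb l t = ?p [^] \<lfloor>s\<rfloor> \<otimes> ((?g (frac s) \<otimes> ?p [^] \<lfloor>t\<rfloor>) \<otimes> ?g (frac t))"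
      using pc gs gt by (simp add: expb_def m_assoc)
    also have "\<dots> = ?p [^] \<lfloor>s\<rfloor> \<otimes> ((?p [^] \<lfloor>t\<rfloor> \<otimes> ?g (frac s)) \<otimes> ?g (frac t))"
      using comm[OF fr(1)] by simp
    also have "\<dots> = ?p [^] (\<lfloor>s\<rfloor> + \<lfloor>t\<rfloor>) \<otimes> (?g (frac s) \<otimes> ?g (frac t))"
      using pc gs gt p by (simp add: m_assoc int_pow_mult)
    finally show ?thesis .
  qed
  show ?thesis
  proof (cases "frac s + frac t < 1")
    case True
    then have "\<lfloor>s + t\<rfloor> = \<lfloor>s\<rfloor> + \<lfloor>t\<rfloor>" "frac (s + t) = frac s + frac t" by (simp_all add: floor_add frac_add)
    then show ?thesis using iota_expc_add[of "frac s" "frac t"] True rhs by (simp add: expb_def)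
  next
    case False
    \<comment> \<open>The fractional parts carry: their sum passes 1, and the factor
      \<open>?p\<close> that is split off at 1 goes into the integer power.\<close>
    then have fl: "\<lfloor>s + t\<rfloor> = \<lfloor>s\<rfloor> + \<lfloor>t\<rfloor> + 1" "frac (s + t) = frac s + frac t - 1"
      by (simp_all add: floor_add frac_add)
    have "?g (frac t) = ?g (1 - frac s) \<otimes> ?g (frac s + frac t - 1)"
      using iota_expc_add[of "1 - frac s" "frac s + frac t - 1"] False fr(3)[of s] fr(3)[of t] by simp
    moreover have "?p = ?g (frac s) \<otimes> ?g (1 - frac s)"
      using iota_expc_add[of "frac s" "1 - frac s"] fr(3)[of s] by simp
    moreover have "?g (1 - frac s) \<in> carrier G" "?g (frac s + frac t - 1) \<in> carrier G"
      using c False fr(3)[of s] fr(3)[of t] by auto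
    ultimately have "?g (frac s) \<otimes> ?g (frac t) = ?p \<otimes> ?g (frac s + frac t - 1)"
      using gs by (simp add: m_assoc)
    moreover have "?p [^] (\<lfloor>s\<rfloor> + \<lfloor>t\<rfloor> + 1) = ?p [^] (\<lfloor>s\<rfloor> + \<lfloor>t\<rfloor>) \<otimes> ?p"
      using p by (simp add: int_pow_mult)
    ultimately show ?thesis
      using rhs pc p c[of "frac s + frac t - 1"] False fr(3)[of s] fr(3)[of t] by (simp add: expb_def fl m_assoc)
  qed
qed

lemma expb_carrier: "expb l t \<in> carrier G"
proof -
  have "frac t \<in> {0..1}" using frac_ge_0[of t] frac_lt_1[of t] by simp
  then show ?thesis using iota_expc_carrier[of "frac t"] iota_expc_carrier[of 1] by (simp add: expb_def)
qed

text \<open>Group translation moves a neighbourhood of any \<open>x\<close> to (0,1), where the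
  curve is an integral curve in the chart. The seams at the integers are thus handled like all other
  points.\<close>

lemma smooth_expb: "smooth_map_from UNIV T \<A> (expb l)"
proof (rule smooth_map_from_local)
  fix x :: real
  have in01: "smooth_map_from {0<..<1} T \<A> (expb l)"
  proof (rule smooth_map_from_cong)
    show "smooth_map_from {0<..<1} T \<A> (\<lambda>t. \<iota> (expc l t))"
      using expc_E1[OF exp_rad_rad] by (intro smooth_iota_compose smooth_on_expc exp_rad_rad) auto
  qed (simp add: expb_eq)
  have "smooth_on {x - 1/2<..<x + 1/2} (\<lambda>t. t + (1/2 - x))"
    by (intro smooth_on_add smooth_on_const smooth_on_bounded_linear[OF bounded_linear_ident])
  then have "smooth_map_from {x - 1/2<..<x + 1/2} T \<A> (\<lambda>t. expb l (t + (1/2 - x)))"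
    by (rule smooth_map_from_compose[OF in01]) auto
  then have "smooth_map_from {x - 1/2<..<x + 1/2} T \<A> (\<lambda>t. expb l (x - 1/2) \<otimes> expb l (t + (1/2 - x)))"
    by (intro smooth_map_from_mult smooth_map_from_const) (simp_all add: carrier_topspace[symmetric] expb_carrier)
  then have "smooth_map_from {x - 1/2<..<x + 1/2} T \<A> (expb l)"
    by (rule smooth_map_from_cong) (simp flip: expb_add)
  then show "\<exists>N. open N \<and> x \<in> N \<and> smooth_map_from (UNIV \<inter> N) T \<A> (expb l)"
    by (intro exI[of _ "{x - 1/2<..<x + 1/2}"]) simp
qed

text \<open>At 1/2 the curve lies in the chart and has a two-sided derivative. Its coordinate
  velocity there is \<open>Mfield\<close> of \<open>l\<close> and also \<open>Mfield\<close> of the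
  logarithmic derivative, and \<open>Mfield\<close> is injective.\<close>

lemma one_param_expb: "one_param (expb l) l"
proof (rule one_paramI[of _ "1/2"])
  have cv: "smooth_curve_at (expb l) (1/2) UNIV" using smooth_expb by (simp add: smooth_curve_at_def)
  have E: "expc l (1/2) \<in> E1" by (rule expc_E1[OF exp_rad_rad]) simp
  have eq: "expb l (1/2) = \<iota> (expc l (1/2))" by (simp add: expb_eq)
  have 1: "((\<lambda>t. \<kappa> (expb l t)) has_vector_derivative Mfield (expc l (1/2)) (lder (expb l) (1/2) UNIV)) (at (1/2))"
    using chart_derivative_lder[OF cv] iota_U1[OF E] kappa_iota[OF E] by (simp add: eq)
  have "(expc l has_vector_derivative Mfield (expc l (1/2)) l) (at (1/2) within {0..1})"
    using expc(2)[OF exp_rad_rad] by (auto simp: integral_curve_def)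
  moreover have "at (1/2) within {0..1} = at (1/2::real)" by (rule at_within_Icc_at) auto
  ultimately have "(expc l has_vector_derivative Mfield (expc l (1/2)) l) (at (1/2))" by simp
  then have "((\<lambda>t. \<kappa> (expb l t)) has_vector_derivative Mfield (expc l (1/2)) l) (at (1/2))"
    by (rule has_vector_derivative_localize[of _ _ _ _ "{0<..<1}"])
      (auto simp: expb_eq kappa_iota expc_E1[OF exp_rad_rad])
  with 1 have "Mfield (expc l (1/2)) (lder (expb l) (1/2) UNIV) = Mfield (expc l (1/2)) l"
    by (rule vector_derivative_unique_at)
  moreover have "expc l (1/2) \<in> cball e0 rad" using expc(2)[OF exp_rad_rad] by (auto simp: integral_curve_def)
  ultimately show "lder (expb l) (1/2) UNIV = l" using Mfield_inj by blast
qed (simp_all add: expb_add smooth_expb)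

end

section \<open>Local invertibility of the exponential map\<close>

lemma expb_scale:
  assumes l: "norm l \<le> exp_rad" and s: "s \<in> {0..1}" and t: "t \<in> {0..1}"
  shows "expb (s *\<^sub>R l) t = expb l (s * t)"
proof -
  have "norm (s *\<^sub>R l) \<le> norm l" using s by (auto intro: mult_left_le_one_le)
  then have "norm (s *\<^sub>R l) \<le> exp_rad" using l by simp
  moreover have "s * t \<in> {0..1}" using s t by (auto intro: mult_le_one)
  ultimately show ?thesis using expc_scale[of l s t] l s t exp_rad_le by (simp add: expb_eq)
qed

text \<open>The difference of the end points deviates from \<open>l - m\<close> by at most half its
  norm.\<close>

lemma expb_inj:
  assumes "norm l \<le> exp_rad" "norm m \<le> exp_rad" "expb l 1 = expb m 1"
  shows "l = m"
proof -
  have r: "norm l \<le> rad / 2" "norm m \<le> rad / 2" using assms exp_rad_le by auto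
  have "\<iota> (expc l 1) = \<iota> (expc m 1)" using assms by (simp add: expb_eq)
  then have "expc l 1 = expc m 1" using kappa_iota expc_E1 r by (metis atLeastAtMost_iff order_refl zero_le_one)
  then have "norm (l - m) \<le> norm (l - m) / 2" using expc_estimate[OF r, of 1] by (simp add: norm_minus_commute)
  then show ?thesis by simp
qed

lemma openin_kappa_preimage:
  assumes "open V"
  shows "openin T {p \<in> U1. \<kappa> p \<in> V}"
proof -
  have "continuous_map (subtopology T U1) (top_of_set E1) \<kappa>"
    using homeomorphic_imp_continuous_map[OF chart_homeomorphic[OF chart1_atlas]]
    by (simp add: U1_def E1_def \<kappa>_def)
  then have "continuous_map (subtopology T U1) euclidean \<kappa>" by (simp add: continuous_map_in_subtopology)
  then have "openin (subtopology T U1) {p \<in> topspace (subtopology T U1). \<kappa> p \<in> V}"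
    using assms by (intro openin_continuous_map_preimage) auto
  moreover have "topspace (subtopology T U1) = U1"
    using topspace_chart[OF chart1_atlas] by (simp add: U1_def)
  ultimately show ?thesis using openin_trans_full openin_U1 by metis
qed

text \<open>A simplified Newton iteration: l \<mapsto> l + (\<kappa>(p) - exp l), taken in
  coordinates, contracts by 1/2 and its fixed points solve exp l = p. Taking \<kappa>(p) within r/2
  of \<open>e0\<close> leaves the other r/2 for the error, so the ball of radius \<open>r\<close> is
  preserved.\<close>

lemma expb_surj:
  assumes r: "0 < r" "r \<le> exp_rad"
  obtains N where "openin T N" "\<one> \<in> N" "\<And>p. p \<in> N \<Longrightarrow> \<exists>l. norm l \<le> r \<and> expb l 1 = p"
proof -
  define N where "N = {p \<in> U1. \<kappa> p \<in> ball e0 (r / 2)}"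
  have "\<exists>l. norm l \<le> r \<and> expb l 1 = p" if p: "p \<in> N" for p
  proof -
    have rr: "norm l \<le> rad / 2" if "l \<in> cball 0 r" for l using that r exp_rad_le by simp
    have ep: "expc 0 1 = e0" using expc_near[of 0 1] rad_pos by simp
    have "\<exists>!l\<in>cball 0 r. \<kappa> p - (expc l 1 - l) = l"
    proof (rule Banach_fix[of "cball 0 r" "1/2"])
      show "(\<lambda>l. \<kappa> p - (expc l 1 - l)) ` cball 0 r \<subseteq> cball 0 r"
      proof safe
        fix l :: 'e assume l: "l \<in> cball 0 r"
        have "norm (expc l 1 - e0 - l) \<le> norm l / 2"
          using expc_estimate[OF rr[OF l], of 0 1] rad_pos ep by simp
        moreover have "norm (\<kappa> p - e0) < r / 2" using p by (simp add: N_def dist_norm norm_minus_commute)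
        moreover have "norm (\<kappa> p - (expc l 1 - l)) \<le> norm (\<kappa> p - e0) + norm (expc l 1 - e0 - l)"
          using norm_triangle_ineq4[of "\<kappa> p - e0" "expc l 1 - e0 - l"] by (simp add: algebra_simps)
        ultimately show "\<kappa> p - (expc l 1 - l) \<in> cball 0 r" using l by simp
      qed
      fix l m :: 'e assume lm: "l \<in> cball 0 r" "m \<in> cball 0 r"
      have "norm (expc l 1 - expc m 1 - (l - m)) \<le> norm (l - m) / 2"
        using expc_estimate[OF rr[OF lm(1)] rr[OF lm(2)], of 1] by simp
      moreover have "(\<kappa> p - (expc l 1 - l)) - (\<kappa> p - (expc m 1 - m)) = - (expc l 1 - expc m 1 - (l - m))" by simp
      ultimately show "dist (\<kappa> p - (expc l 1 - l)) (\<kappa> p - (expc m 1 - m)) \<le> 1/2 * dist l m"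
        unfolding dist_norm by (metis mult.commute mult_1 norm_minus_cancel times_divide_eq_right)
    qed (use r in \<open>auto simp: complete_eq_closed\<close>)
    then obtain l where l: "l \<in> cball 0 r" "\<kappa> p - (expc l 1 - l) = l" by blast
    have "\<kappa> p - (expc l 1 - l) - l = \<kappa> p - expc l 1" by simp
    then have "norm l \<le> r" "expc l 1 = \<kappa> p" using l by auto
    then show ?thesis using r p by (auto simp: N_def expb_eq iota_kappa)
  qed
  moreover have "openin T N" unfolding N_def by (rule openin_kappa_preimage) simp
  moreover have "\<one> \<in> N" using r one_U1 by (simp add: N_def e0_def)
  ultimately show thesis using that by blast
qed

lemma expb_small:
  assumes N: "openin T N" "\<one> \<in> N"
  obtains r where "r > 0" "r \<le> exp_rad" "\<And>l t. norm l \<le> r \<Longrightarrow> t \<in> {0..1} \<Longrightarrow> expb l t \<in> N"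
proof -
  obtain V where V: "open V" "{x \<in> E1. \<iota> x \<in> N} = E1 \<inter> V"
    using continuous_map_preimage_Int_open[OF smooth_map_from_imp_continuous_map[OF smooth_iota] N(1)] .
  have "e0 \<in> {x \<in> E1. \<iota> x \<in> N}" using N e0_E1 iota_e0 by simp
  then have "e0 \<in> V" unfolding V(2) by simp
  then obtain d where d: "d > 0" "cball e0 d \<subseteq> V" using V(1) unfolding open_contains_cball by blast
  define r where "r = min exp_rad (d / 2)"
  have "expb l t \<in> N" if l: "norm l \<le> r" and t: "t \<in> {0..1}" for l t
  proof -
    have le: "norm l \<le> exp_rad" and lr: "norm l \<le> rad / 2" using l exp_rad_le by (auto simp: r_def)
    have "expc l t \<in> cball e0 d"
      using expc_near[OF lr t] l by (simp add: dist_norm norm_minus_commute r_def)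
    then have "expc l t \<in> E1 \<inter> V" using d expc_E1[OF lr t] by blast
    then have "\<iota> (expc l t) \<in> N" unfolding V(2)[symmetric] by simp
    then show ?thesis by (simp add: expb_eq[OF le t])
  qed
  moreover have "r > 0" "r \<le> exp_rad" using exp_rad_pos d by (auto simp: r_def)
  ultimately show thesis using that by blast
qed

end

section \<open>Closed one-parameter subgroups in compact groups\<close>

context Lie_group
begin

text \<open>The tube lemma over the compact group: the preimage of \<open>N\<close> under (p, h)
  \<mapsto> h p h^{-1} is open and contains all pairs (1, h).\<close>

lemma conj_invariant_nhd:
  assumes compact: "compact_space T" and N: "openin T N" "\<one> \<in> N"
  obtains N' where "openin T N'" "\<one> \<in> N'" "\<And>h p. h \<in> carrier G \<Longrightarrow> p \<in> N' \<Longrightarrow> h \<otimes> p \<otimes> inv h \<in> N"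
proof -
  let ?W = "{z \<in> topspace (prod_topology T T). snd z \<otimes> fst z \<otimes> inv (snd z) \<in> N}"
  have "continuous_map (prod_topology T T) T (\<lambda>z. snd z \<otimes> fst z \<otimes> inv (snd z))"
    by (intro continuous_map_mult continuous_map_inv continuous_map_fst continuous_map_snd)
  then have W: "openin (prod_topology T T) ?W" using N(1) by (rule openin_continuous_map_preimage)
  have one: "\<one> \<in> topspace T" by (simp flip: carrier_topspace)
  have "{\<one>} \<times> topspace T \<subseteq> ?W" using N(2) by (auto simp flip: carrier_topspace)
  from tube_lemma_right[OF W compact[unfolded compact_space_def] one this]
  obtain U V where UV: "openin T U" "\<one> \<in> U" "topspace T \<subseteq> V" "U \<times> V \<subseteq> ?W"
    by (elim exE conjE)
  have "h \<otimes> p \<otimes> inv h \<in> N" if "h \<in> carrier G" "p \<in> U" for h p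
  proof -
    have "(p, h) \<in> U \<times> V" using that UV(3) by (auto simp: carrier_topspace)
    then have "(p, h) \<in> ?W" using UV(4) by (rule subsetD[rotated])
    then show ?thesis by simp
  qed
  with UV(1,2) show thesis by (rule that)
qed

text \<open>Square roots are unique near the identity, so \<open>h\<close> commutes with all dyadic roots of \<open>exp v\<close>.\<close>

lemma commuting_one_param:
  assumes compact: "compact_space T"
  obtains r where "r > 0" "r \<le> exp_rad"
    "\<And>v h s. norm v \<le> r \<Longrightarrow> h \<in> carrier G \<Longrightarrow> h \<otimes> expb v 1 = expb v 1 \<otimes> h \<Longrightarrow> h \<otimes> expb v s = expb v s \<otimes> h"
proof -
  \<comment> \<open>Half the injectivity radius, so that the doubled logarithm
    \<open>2 *\<^sub>R w\<close> below is still in the range of \<open>expb_inj\<close>.\<close>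
  have "0 < exp_rad / 2" "exp_rad / 2 \<le> exp_rad" using exp_rad_pos by auto
  then obtain N where N: "openin T N" "\<one> \<in> N" "\<And>p. p \<in> N \<Longrightarrow> \<exists>l. norm l \<le> exp_rad / 2 \<and> expb l 1 = p"
    by (rule expb_surj) blast
  obtain N' where N': "openin T N'" "\<one> \<in> N'" "\<And>h p. h \<in> carrier G \<Longrightarrow> p \<in> N' \<Longrightarrow> h \<otimes> p \<otimes> inv h \<in> N"
    using conj_invariant_nhd[OF compact N(1,2)] by blast
  obtain r where r: "r > 0" "r \<le> exp_rad" "\<And>l t. norm l \<le> r \<Longrightarrow> t \<in> {0..1} \<Longrightarrow> expb l t \<in> N'"
    using expb_small[OF N'(1,2)] by blast
  have "h \<otimes> expb v s = expb v s \<otimes> h"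
    if v: "norm v \<le> r" and h: "h \<in> carrier G" and comm: "h \<otimes> expb v 1 = expb v 1 \<otimes> h" for v h s
  proof -
    have vr: "norm v \<le> exp_rad" using v r by simp
    note op = one_param_expb[OF vr]
    note c = one_param_carrier[OF op]
    let ?S = "{s. h \<otimes> expb v s = expb v s \<otimes> h}"
    have add: "s + t \<in> ?S" if "s \<in> ?S" "t \<in> ?S" for s t
    proof -
      have e: "h \<otimes> expb v s = expb v s \<otimes> h" "h \<otimes> expb v t = expb v t \<otimes> h" using that by auto
      have "h \<otimes> (expb v s \<otimes> expb v t) = (h \<otimes> expb v s) \<otimes> expb v t"
        using c h by (simp only: m_assoc)
      also have "\<dots> = expb v s \<otimes> (h \<otimes> expb v t)"
        unfolding e(1) using c h by (simp only: m_assoc)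
      also have "\<dots> = expb v s \<otimes> expb v t \<otimes> h"
        unfolding e(2) using c h by (simp only: m_assoc)
      finally show ?thesis by (simp add: one_param_add[OF op])
    qed
    have neg: "- s \<in> ?S" if "s \<in> ?S" for s
    proof -
      have "inv (expb v s) \<otimes> (h \<otimes> expb v s) \<otimes> inv (expb v s) = inv (expb v s) \<otimes> (expb v s \<otimes> h) \<otimes> inv (expb v s)"
        using that by simp
      moreover have "inv (expb v s) \<otimes> (h \<otimes> expb v s) \<otimes> inv (expb v s) = inv (expb v s) \<otimes> h"
        using c[of s] h by (simp add: m_assoc)
      moreover have "inv (expb v s) \<otimes> (expb v s \<otimes> h) \<otimes> inv (expb v s) = h \<otimes> inv (expb v s)"
        using c[of s] h by (simp add: m_assoc[symmetric])
      ultimately show ?thesis by (simp add: one_param_minus[OF op])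
    qed
    have dyadic: "(1/2) ^ n \<in> ?S" for n
    proof (induction n)
      case 0
      then show ?case using comm by simp
    next
      case (Suc n)
      define q :: real where "q = (1/2) ^ n"
      have "0 \<le> q" "q \<le> 1" by (simp_all add: q_def power_le_one)
      then have q: "q \<in> {0..1}" "q / 2 \<in> {0..1}" by auto
      have IH: "h \<otimes> expb v q = expb v q \<otimes> h" using Suc by (simp add: q_def)
      \<comment> \<open>The conjugate \<open>?y\<close> of exp((q/2) v) is again a square root of
        exp(q v), and it has a small logarithm \<open>w\<close> because it lies in \<open>N\<close>.
        Comparing 2w with q v shows that \<open>?y\<close> is the original root.\<close>
      let ?y = "h \<otimes> expb v (q / 2) \<otimes> inv h"
      have "expb v (q / 2) \<in> N'" by (rule r(3)[OF v q(2)])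
      then obtain w where w: "norm w \<le> exp_rad / 2" "expb w 1 = ?y" using N(3) N'(3)[OF h] by blast
      have w2: "norm (2 *\<^sub>R w) \<le> exp_rad" and wr: "norm w \<le> exp_rad" using w(1) exp_rad_pos by auto
      have wexp: "expb w 1 = expb (2 *\<^sub>R w) (1/2)" using expb_scale[OF w2, of "1/2" 1] by simp
      have "expb (2 *\<^sub>R w) 1 = expb (2 *\<^sub>R w) (1/2) \<otimes> expb (2 *\<^sub>R w) (1/2)"
        using one_param_add[OF one_param_expb[OF w2], of "1/2" "1/2"] by simp
      also have "\<dots> = ?y \<otimes> ?y" using w(2) wexp by simp
      also have "\<dots> = h \<otimes> (expb v (q / 2) \<otimes> expb v (q / 2)) \<otimes> inv h"
      proof -
        have "inv h \<otimes> (h \<otimes> (expb v (q / 2) \<otimes> inv h)) = expb v (q / 2) \<otimes> inv h"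
          using h c[of "q/2"] by (simp add: m_assoc[symmetric])
        then show ?thesis using h c[of "q/2"] by (simp add: m_assoc)
      qed
      also have "expb v (q / 2) \<otimes> expb v (q / 2) = expb v q"
        using one_param_add[OF op, of "q/2" "q/2"] by simp
      also have "h \<otimes> expb v q \<otimes> inv h = expb v q" using IH h c[of q] by (simp add: m_assoc)
      also have "\<dots> = expb (q *\<^sub>R v) 1" using expb_scale[OF vr q(1), of 1] by simp
      finally have e: "expb (2 *\<^sub>R w) 1 = expb (q *\<^sub>R v) 1" .
      have "norm (q *\<^sub>R v) \<le> norm v" using q by (auto intro: mult_left_le_one_le)
      then have "2 *\<^sub>R w = q *\<^sub>R v" using vr by (intro expb_inj[OF w2 _ e]) simp
      then have "(1/2) *\<^sub>R 2 *\<^sub>R w = (1/2) *\<^sub>R q *\<^sub>R v" by simp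
      then have "w = (q / 2) *\<^sub>R v" by simp
      then have "?y = expb v (q / 2)" using w(2) expb_scale[OF vr q(2), of 1] by simp
      then have "h \<otimes> expb v (q / 2) = expb v (q / 2) \<otimes> h"
        using h c[of "q/2"] by (metis inv_solve_right m_closed)
      then show ?case by (simp add: q_def field_simps)
    qed
    have nat_mult: "real k * (1/2) ^ n \<in> ?S" for k n
    proof (induction k)
      case 0
      have "0 \<in> ?S" using h by (simp add: one_param_zero[OF op])
      then show ?case by simp
    next
      case (Suc k)
      have "real (Suc k) * (1/2) ^ n = real k * (1/2) ^ n + (1/2) ^ n" by (simp add: distrib_right)
      then show ?case using add[OF Suc dyadic[of n]] by simp
    qed
    have int_mult: "of_int k * (1/2) ^ n \<in> ?S" for k n
    proof (cases "k \<ge> 0")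
      case True
      then show ?thesis using nat_mult[of "nat k" n] by simp
    next
      case False
      then show ?thesis using neg[OF nat_mult[of "nat (- k)" n]] by simp
    qed
    have ce: "continuous_map euclidean T (expb v)"
      using smooth_map_from_imp_continuous_map[OF one_param_smooth[OF op, of UNIV]] by simp
    have ch: "continuous_map euclidean T (\<lambda>_. h)" using h by (simp add: carrier_topspace)
    \<comment> \<open>In a Hausdorff space two continuous maps agree on a closed set.\<close>
    have "closedin euclidean {s \<in> topspace euclidean. h \<otimes> expb v s = expb v s \<otimes> h}"
      by (rule closedin_continuous_maps_eq[OF hausdorff continuous_map_mult[OF ch ce] continuous_map_mult[OF ce ch]])
    then have closed: "closed ?S" by simp
    \<comment> \<open>Dyadic numbers approximate \<open>s\<close> from below with error at most
      \<open>(1/2) ^ n\<close>.\<close>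
    have lim: "(\<lambda>n. of_int \<lfloor>s * 2 ^ n\<rfloor> * (1/2) ^ n) \<longlonglongrightarrow> s"
    proof (rule real_tendsto_sandwich)
      have lower: "s - (1/2) ^ n \<le> of_int \<lfloor>s * 2 ^ n\<rfloor> * (1/2) ^ n" for n
      proof -
        have "(s * 2 ^ n - 1) * (1/2) ^ n \<le> of_int \<lfloor>s * 2 ^ n\<rfloor> * (1/2) ^ n"
          by (intro mult_right_mono) (linarith, simp)
        then show ?thesis by (simp add: diff_divide_distrib power_one_over)
      qed
      have upper: "of_int \<lfloor>s * 2 ^ n\<rfloor> * (1/2) ^ n \<le> s" for n
      proof -
        have "of_int \<lfloor>s * 2 ^ n\<rfloor> * (1/2) ^ n \<le> (s * 2 ^ n) * (1/2) ^ n"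
          by (intro mult_right_mono) auto
        then show ?thesis by (simp add: power_one_over)
      qed
      show "\<forall>\<^sub>F n in sequentially. s - (1/2) ^ n \<le> of_int \<lfloor>s * 2 ^ n\<rfloor> * (1/2) ^ n" using lower by simp
      show "\<forall>\<^sub>F n in sequentially. of_int \<lfloor>s * 2 ^ n\<rfloor> * (1/2) ^ n \<le> s" using upper by simp
      have "(\<lambda>n. (1/2::real) ^ n) \<longlonglongrightarrow> 0" by (rule LIMSEQ_realpow_zero) auto
      from tendsto_diff[OF tendsto_const this, of s] show "(\<lambda>n. s - (1/2) ^ n) \<longlonglongrightarrow> s" by simp
    qed simp
    have "s \<in> ?S" by (rule closed_sequentially[OF closed int_mult lim])
    then show ?thesis by simp
  qed
  with r show thesis using that by blast
qed

text \<open>Pigeonhole: the compact group is covered by finitely many open sets V with V^{-1} V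
  inside \<open>N\<close>. Two of the points \<beta>(0), \<beta>(1), \<beta>(2), ... share such a
  set, and their quotient is \<beta>(j - i).\<close>

lemma recurrence:
  assumes compact: "compact_space T" and \<beta>: "one_param \<beta> l" and N: "openin T N" "\<one> \<in> N"
  obtains n :: nat where "n \<ge> 1" "\<beta> (real n) \<in> N"
proof -
  have "\<exists>V. openin T V \<and> h \<in> V \<and> (\<forall>x\<in>V. \<forall>y\<in>V. inv x \<otimes> y \<in> N)" if h: "h \<in> carrier G" for h
  proof -
    have "continuous_map (prod_topology T T) T (\<lambda>z. inv (fst z) \<otimes> snd z)"
      by (intro continuous_map_mult continuous_map_inv continuous_map_fst continuous_map_snd)
    then have "openin (prod_topology T T) {z \<in> topspace (prod_topology T T). inv (fst z) \<otimes> snd z \<in> N}"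
      using N(1) by (rule openin_continuous_map_preimage)
    moreover have "(h, h) \<in> {z \<in> topspace (prod_topology T T). inv (fst z) \<otimes> snd z \<in> N}"
      using h N(2) by (simp add: carrier_topspace[symmetric])
    ultimately obtain U V where UV: "openin T U" "openin T V" "h \<in> U" "h \<in> V"
      "U \<times> V \<subseteq> {z \<in> topspace (prod_topology T T). inv (fst z) \<otimes> snd z \<in> N}"
      unfolding openin_prod_topology_alt by meson
    then show ?thesis by (intro exI[of _ "U \<inter> V"]) auto
  qed
  then obtain V where V: "\<And>h. h \<in> carrier G \<Longrightarrow> openin T (V h) \<and> h \<in> V h \<and> (\<forall>x\<in>V h. \<forall>y\<in>V h. inv x \<otimes> y \<in> N)"
    by metis
  have "topspace T \<subseteq> \<Union> (V ` carrier G)" using V by (auto simp: carrier_topspace)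
  moreover have "\<forall>W\<in>V ` carrier G. openin T W" using V by blast
  ultimately obtain F where F: "finite F" "F \<subseteq> V ` carrier G" "topspace T \<subseteq> \<Union> F"
    using compact unfolding compact_space_def compactin_def by blast
  have "\<exists>W\<in>F. \<beta> (real n) \<in> W" for n using F(3) one_param_carrier[OF \<beta>] by (auto simp: carrier_topspace)
  then obtain f where f: "\<And>n. f n \<in> F" "\<And>n. \<beta> (real n) \<in> f n" by metis
  have "finite (range f)" by (rule finite_subset[OF _ F(1)]) (use f(1) in auto)
  then have "\<not> inj f" using finite_imageD[of f UNIV] by auto
  then obtain i j where ij: "i < j" "f i = f j" unfolding inj_def by (metis linorder_neqE_nat)
  obtain h where h: "h \<in> carrier G" "f i = V h" using F(2) f(1) by blast
  have "\<beta> (real i) \<in> V h" "\<beta> (real j) \<in> V h" using f(2)[of i] f(2)[of j] ij(2) h(2) by simp_all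
  then have "inv (\<beta> (real i)) \<otimes> \<beta> (real j) \<in> N" using V[OF h(1)] by blast
  moreover have "\<beta> (real (j - i)) = inv (\<beta> (real i)) \<otimes> \<beta> (real j)"
    using one_param_add[OF \<beta>, of "- real i" "real j"] one_param_minus[OF \<beta>] ij by (simp add: of_nat_diff)
  ultimately show thesis using that[of "j - i"] ij by simp
qed

end

context kropina_group
begin

lemma closed_one_param_exists:
  obtains \<gamma> l where "one_param \<gamma> l" "\<gamma> 1 = \<one>" "wh l < 0" "\<And>s v. wh (Ad (\<gamma> s) v) = wh v"
proof -
  obtain B where B: "\<And>v. gh B v = wh v" "wh B \<noteq> 0" using dual_vector by blast
  have "B \<noteq> 0" using B(2) linear_0[OF linear_wh] by auto
  then have whB: "wh B > 0" using B(1)[of B] gh_pos[of B] by simp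
  \<comment> \<open>Rescales \<open>B\<close> to norm \<open>exp_rad\<close>, the largest norm for
    which \<open>expb\<close> is known to be a one-parameter subgroup.\<close>
  define c where "c = exp_rad / norm B"
  have c: "c > 0" using exp_rad_pos \<open>B \<noteq> 0\<close> by (simp add: c_def)
  have cB: "norm (c *\<^sub>R B) \<le> exp_rad" using exp_rad_pos \<open>B \<noteq> 0\<close> by (simp add: c_def)
  define \<beta> where "\<beta> = expb (c *\<^sub>R B)"
  have \<beta>: "one_param \<beta> (c *\<^sub>R B)" unfolding \<beta>_def by (rule one_param_expb[OF cB])
  obtain r where r: "r > 0" "r \<le> exp_rad"
    "\<And>v h s. norm v \<le> r \<Longrightarrow> h \<in> carrier G \<Longrightarrow> h \<otimes> expb v 1 = expb v 1 \<otimes> h \<Longrightarrow> h \<otimes> expb v s = expb v s \<otimes> h"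
    by (rule commuting_one_param[OF compact]) blast
  obtain K where K: "K > 0" "\<And>v. norm (wh v) \<le> K * norm v"
    using linear_bounded_pos[OF linear_wh] by blast
  \<comment> \<open>The second bound keeps \<omega>(Y) at or below half of c \<omega>(B), hence
    below n c \<omega>(B): the sign of \<omega> on the final direction is decided by
    \<open>B\<close>.\<close>
  define r' where "r' = min r (c * wh B / (2 * K))"
  have r': "0 < r'" "r' \<le> exp_rad" "r' \<le> r" using r c whB K(1) by (auto simp: r'_def)
  obtain N where N: "openin T N" "\<one> \<in> N" "\<And>p. p \<in> N \<Longrightarrow> \<exists>l. norm l \<le> r' \<and> expb l 1 = p"
    using expb_surj[OF r'(1,2)] by blast
  obtain n where n: "n \<ge> 1" "\<beta> (real n) \<in> N" by (rule recurrence[OF compact \<beta> N(1,2)])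
  then obtain Y where Y: "norm Y \<le> r'" "expb Y 1 = \<beta> (real n)" using N(3) by blast
  define \<eta> where "\<eta> = expb Y"
  have \<eta>: "one_param \<eta> Y" unfolding \<eta>_def using Y r' by (intro one_param_expb) simp
  have comm: "\<beta> t \<otimes> \<eta> s = \<eta> s \<otimes> \<beta> t" for s t
    unfolding \<eta>_def
  proof (rule r(3)[OF _ one_param_carrier[OF \<beta>]])
    show "norm Y \<le> r" using Y(1) r'(3) by simp
    show "\<beta> t \<otimes> expb Y 1 = expb Y 1 \<otimes> \<beta> t" unfolding Y(2) by (rule one_param_commute[OF \<beta>])
  qed
  \<comment> \<open>The factor 1 in the second argument lets one scaling rule treat both commuting
    factors.\<close>
  define \<gamma> where "\<gamma> t = \<beta> ((- real n) * t) \<otimes> \<eta> (1 * t)" for t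
  have \<gamma>: "one_param \<gamma> ((- real n) *\<^sub>R (c *\<^sub>R B) + 1 *\<^sub>R Y)"
    unfolding \<gamma>_def by (intro one_param_mult one_param_scale \<beta> \<eta> comm)
  have 1: "\<gamma> 1 = \<one>"
    using Y(2) one_param_minus[OF \<beta>, of "real n"] one_param_carrier[OF \<beta>] by (simp add: \<gamma>_def \<eta>_def)
  have "wh Y \<le> K * norm Y" using K(2)[of Y] by simp
  also have "\<dots> \<le> K * (c * wh B / (2 * K))" using K(1) Y(1) by (intro mult_left_mono) (auto simp: r'_def)
  also have "\<dots> = c * wh B / 2" using K(1) by simp
  also have "\<dots> < c * wh B" using c whB by simp
  also have "\<dots> \<le> real n * (c * wh B)" using n c whB by simp
  finally have neg: "wh ((- real n) *\<^sub>R (c *\<^sub>R B) + 1 *\<^sub>R Y) < 0"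
    by (simp only: wh_lincomb linear_scale[OF linear_wh]) simp
  have Ad: "wh (Ad (\<gamma> s) v) = wh v" for s v
  proof (rule wh_Ad[OF B(1) one_param_carrier[OF \<gamma>]])
    note cr = one_param_carrier[OF \<beta>] one_param_carrier[OF \<eta>]
    have "Ad (\<gamma> s) (lder \<beta> 0 UNIV) = lder \<beta> 0 UNIV"
    proof (rule Ad_lder_of_commuting[OF one_param_carrier[OF \<gamma>] one_param_curve[OF \<beta>] one_param_zero[OF \<beta>]])
      fix t
      show "\<gamma> s \<otimes> \<beta> t = \<beta> t \<otimes> \<gamma> s"
        using cr comm one_param_commute[OF \<beta>] unfolding \<gamma>_def by (metis m_assoc)
    qed auto
    then have "Ad (\<gamma> s) (c *\<^sub>R B) = c *\<^sub>R B" using one_param_lder[OF \<beta>] by simp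
    then show "Ad (\<gamma> s) B = B" using c by (simp add: linear_scale[OF linear_Ad[OF one_param_carrier[OF \<gamma>]]])
  qed
  from \<gamma> 1 neg Ad show thesis by (rule that)
qed

end

section \<open>Families of curves near a constant curve\<close>

text \<open>Radii and constants found near each parameter \<open>s0\<close> become one radius and
  one constant by a finite subcover; \<open>mono\<close> allows passing to the largest
  constant.\<close>

lemma compact_interval_uniform:
  fixes a b :: real
  assumes loc: "\<And>s0. s0 \<in> {a..b} \<Longrightarrow> \<exists>r>0. \<exists>C. \<forall>\<tau> s. \<bar>\<tau>\<bar> < r \<longrightarrow> s \<in> {a..b} \<longrightarrow> \<bar>s - s0\<bar> < r \<longrightarrow> P C \<tau> s"
    and mono: "\<And>C C' \<tau> s. C \<le> C' \<Longrightarrow> P C \<tau> s \<Longrightarrow> P C' \<tau> s"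
  shows "\<exists>r>0. \<exists>C::real. \<forall>(\<tau>::real) s. \<bar>\<tau>\<bar> < r \<longrightarrow> s \<in> {a..b} \<longrightarrow> P C \<tau> s"
proof -
  obtain r C where rC: "\<And>s0. s0 \<in> {a..b} \<Longrightarrow> r s0 > 0 \<and>
      (\<forall>\<tau> s. \<bar>\<tau>\<bar> < r s0 \<longrightarrow> s \<in> {a..b} \<longrightarrow> \<bar>s - s0\<bar> < r s0 \<longrightarrow> P (C s0) \<tau> s)"
    using loc by metis
  have "{a..b} \<subseteq> (\<Union>c\<in>{a..b}. ball c (r c))" using rC by force
  then obtain F where F: "F \<subseteq> {a..b}" "finite F" "{a..b} \<subseteq> (\<Union>c\<in>F. ball c (r c))"
    by (rule compactE_image[OF compact_Icc, rotated]) auto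
  \<comment> \<open>The inserted values 1 and 0 keep minimum and maximum defined when the interval
    is empty.\<close>
  define R where "R = Min (insert 1 (r ` F))"
  define K where "K = Max (insert 0 (C ` F))"
  have R: "R > 0" using F rC by (auto simp: R_def)
  have "P K \<tau> s" if t: "\<bar>\<tau>\<bar> < R" and s: "s \<in> {a..b}" for \<tau> s
  proof -
    obtain c where c: "c \<in> F" "s \<in> ball c (r c)" using F(3) s by blast
    have "R \<le> r c" "C c \<le> K" using c(1) F(2) by (auto simp: R_def K_def)
    moreover have "\<bar>s - c\<bar> < r c" using c(2) by (simp add: dist_real_def)
    ultimately have "P (C c) \<tau> s" using rC[of c] c(1) F(1) t s by auto
    then show ?thesis using mono \<open>C c \<le> K\<close> by blast
  qed
  with R show ?thesis by blast
qed

text \<open>At \<tau> = 0 the family is constant in s, so both \<open>x - e\<close> and the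
  derivative in s vanish there. Locally both are restrictions of Lipschitz functions of (\<tau>, s),
  hence of order \<tau>; compactness makes this uniform in s. The set \<open>N\<close> stands for
  the part of the domain on which the chart can be applied.\<close>

lemma smooth_family_near_constant:
  fixes x :: "real \<times> real \<Rightarrow> 'e::euclidean_space" and a b :: real
  defines "y \<equiv> \<lambda>\<tau> s. vector_derivative (\<lambda>s. x (\<tau>, s)) (at s within {a..b})"
  assumes ab: "a < b" and \<epsilon>: "\<epsilon> > 0" and N: "open N" and sm: "smooth_on (({-\<epsilon><..<\<epsilon>} \<times> {a..b}) \<inter> N) x"
    and base: "\<And>s. s \<in> {a..b} \<Longrightarrow> (0, s) \<in> N \<and> x (0, s) = e"
  obtains r C where "r > 0" "r \<le> \<epsilon>" "C \<ge> 0"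
    "\<And>\<tau> s. \<bar>\<tau>\<bar> < r \<Longrightarrow> s \<in> {a..b} \<Longrightarrow> (\<tau>, s) \<in> N \<and> norm (x (\<tau>, s) - e) \<le> C * \<bar>\<tau>\<bar>"
    "\<And>\<tau> s. \<bar>\<tau>\<bar> < r \<Longrightarrow> s \<in> {a..b} \<Longrightarrow>
      ((\<lambda>s. x (\<tau>, s)) has_vector_derivative y \<tau> s) (at s within {a..b}) \<and> norm (y \<tau> s) \<le> C * \<bar>\<tau>\<bar>"
    "\<And>\<tau>. \<bar>\<tau>\<bar> < r \<Longrightarrow> continuous_on {a..b} (y \<tau>)"
proof -
  define P where "P C \<tau> s \<longleftrightarrow> \<bar>\<tau>\<bar> < \<epsilon> \<and> (\<tau>, s) \<in> N \<and> norm (x (\<tau>, s) - e) \<le> C * \<bar>\<tau>\<bar> \<and>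
     ((\<lambda>s. x (\<tau>, s)) has_vector_derivative y \<tau> s) (at s within {a..b}) \<and> norm (y \<tau> s) \<le> C * \<bar>\<tau>\<bar> \<and>
     continuous (at s within {a..b}) (y \<tau>)" for C \<tau> s
  have ntriv: "at s within {a..b} \<noteq> bot" if "s \<in> {a..b}" for s
    using ab that by (simp add: trivial_limit_within islimpt_Icc)
  have "\<exists>r>0. \<exists>C. \<forall>\<tau> s. \<bar>\<tau>\<bar> < r \<longrightarrow> s \<in> {a..b} \<longrightarrow> P C \<tau> s"
  proof (rule compact_interval_uniform)
    show "P C' \<tau> s" if "C \<le> C'" "P C \<tau> s" for C C' \<tau> s
      using that mult_right_mono[OF that(1), of "\<bar>\<tau>\<bar>"] unfolding P_def by fastforce
    fix s0 assume s0: "s0 \<in> {a..b}"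
    have "(0, s0) \<in> ({-\<epsilon><..<\<epsilon>} \<times> {a..b}) \<inter> N" using s0 \<epsilon> base by auto
    from smooth_onE[OF sm this] obtain U F where U: "open U" "(0, s0) \<in> U" "\<forall>k. Ck_on k F U"
      "\<forall>z\<in>({-\<epsilon><..<\<epsilon>} \<times> {a..b}) \<inter> N \<inter> U. F z = x z" .
    define W where "W = U \<inter> N"
    have W: "open W" "(0, s0) \<in> W" using U N base s0 by (auto simp: W_def)
    have F_sm: "smooth_on W F"
      using smooth_on_open[OF U(1), of F] U(3) by (auto intro: smooth_on_subset simp: W_def)
    \<comment> \<open>The derivative in s of the smooth extension \<open>F\<close>; it also gives
      the one-sided derivatives of \<open>x\<close> at the two ends of the interval.\<close>
    define D where "D z = frechet_derivative F (at z) (0, 1)" for z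
    have "smooth_on W D"
      unfolding D_def by (rule smooth_on_frechet_derivative[OF W(1) F_sm])
    then have D_cont: "continuous_on W D" and D_sm: "smooth_on W D" using smooth_on_imp_continuous_on by auto
    obtain r1 C1 where 1: "r1 > 0" "C1 \<ge> 0" "cball (0, s0) r1 \<subseteq> W"
      "\<And>z z'. z \<in> cball (0, s0) r1 \<Longrightarrow> z' \<in> cball (0, s0) r1 \<Longrightarrow> norm (F z - F z') \<le> C1 * norm (z - z')"
      using smooth_on_locally_Lipschitz[OF W(1) F_sm W(2)] by blast
    obtain r2 C2 where 2: "r2 > 0" "C2 \<ge> 0" "cball (0, s0) r2 \<subseteq> W"
      "\<And>z z'. z \<in> cball (0, s0) r2 \<Longrightarrow> z' \<in> cball (0, s0) r2 \<Longrightarrow> norm (D z - D z') \<le> C2 * norm (z - z')"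
      using smooth_on_locally_Lipschitz[OF W(1) D_sm W(2)] by blast
    \<comment> \<open>The radii are halved because the distance from (0, s0) is estimated by the sum
      of the two coordinate distances.\<close>
    define r where "r = min \<epsilon> (min r1 r2 / 2)"
    define C where "C = max C1 C2"
    have r: "r > 0" "r \<le> \<epsilon>" using \<epsilon> 1 2 by (auto simp: r_def)
    have near: "(\<tau>, s) \<in> cball (0, s0) r1" "(\<tau>, s) \<in> cball (0, s0) r2" if "\<bar>\<tau>\<bar> < r" "\<bar>s - s0\<bar> < r" for \<tau> s
    proof -
      have "dist (0, s0) (\<tau>, s) \<le> \<bar>\<tau>\<bar> + \<bar>s - s0\<bar>"
        using norm_Pair_le[of "\<tau>" "s - s0"] by (simp add: dist_norm norm_Pair power2_commute)
      also have "\<dots> \<le> min r1 r2" using that by (simp add: r_def)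
      finally show "(\<tau>, s) \<in> cball (0, s0) r1" "(\<tau>, s) \<in> cball (0, s0) r2" by auto
    qed
    have eq: "F (\<tau>, s) = x (\<tau>, s)" if "\<bar>\<tau>\<bar> < \<epsilon>" "s \<in> {a..b}" "(\<tau>, s) \<in> W" for \<tau> s
      by (rule U(4)[rule_format]) (use that in \<open>auto simp: W_def\<close>)
    have deriv: "((\<lambda>s. x (\<tau>, s)) has_vector_derivative D (\<tau>, s)) (at s within {a..b})"
      if t: "\<bar>\<tau>\<bar> < \<epsilon>" and s: "s \<in> {a..b}" and w: "(\<tau>, s) \<in> W" for \<tau> s
    proof -
      have "((\<lambda>s. (\<tau>, s)) has_vector_derivative (0, 1)) (at s within {a..b})"
        by (auto intro!: has_vector_derivative_Pair derivative_eq_intros)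
      moreover have "(F has_derivative frechet_derivative F (at (\<tau>, s))) (at (\<tau>, s))"
        by (rule smooth_on_open_has_derivative[OF W(1) F_sm w])
      ultimately have "((\<lambda>s. F (\<tau>, s)) has_vector_derivative D (\<tau>, s)) (at s within {a..b})"
        unfolding D_def using has_vector_derivative_compose_frechet[of F _ "\<lambda>s. (\<tau>, s)"] by blast
      then show ?thesis
      proof (rule has_vector_derivative_localize)
        show "open ((\<lambda>s. (\<tau>, s)) -` W)" by (intro open_vimage W(1) continuous_intros)
      qed (use s w eq t in auto)
    qed
    have y_eq: "y \<tau> s = D (\<tau>, s)" if "\<bar>\<tau>\<bar> < \<epsilon>" "s \<in> {a..b}" "(\<tau>, s) \<in> W" for \<tau> s
      unfolding y_def by (rule vector_derivative_within[OF ntriv[OF that(2)] deriv[OF that]])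
    have D0: "D (0, s) = 0" if s: "s \<in> {a..b}" and w: "(0, s) \<in> W" for s
    proof -
      have "((\<lambda>s. x (0, s)) has_vector_derivative 0) (at s within {a..b})"
        by (rule has_vector_derivative_localize[of "\<lambda>_. e" _ _ _ UNIV]) (use s base in \<open>auto intro!: derivative_eq_intros\<close>)
      then show ?thesis
        using vector_derivative_unique_within[OF ntriv[OF s] deriv[OF _ s w]] \<epsilon> by simp
    qed
    have "P C \<tau> s" if t: "\<bar>\<tau>\<bar> < r" and s: "s \<in> {a..b}" and ss: "\<bar>s - s0\<bar> < r" for \<tau> s
    proof -
      have t\<epsilon>: "\<bar>\<tau>\<bar> < \<epsilon>" using t r by simp
      have z1: "(\<tau>, s) \<in> cball (0, s0) r1" "(0::real, s) \<in> cball (0, s0) r1"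
        and z2: "(\<tau>, s) \<in> cball (0, s0) r2" "(0::real, s) \<in> cball (0, s0) r2" using near[OF t ss] near[of 0, OF _ ss] r by simp_all
      have w: "(\<tau>, s) \<in> W" "(0, s) \<in> W" using z1 1(3) by auto
      have nrm: "norm ((\<tau>, s) - (0, s)) = \<bar>\<tau>\<bar>" by (simp add: norm_Pair)
      have le: "C1 * \<bar>\<tau>\<bar> \<le> C * \<bar>\<tau>\<bar>" "C2 * \<bar>\<tau>\<bar> \<le> C * \<bar>\<tau>\<bar>" by (auto simp: C_def intro: mult_right_mono)
      have "norm (x (\<tau>, s) - e) \<le> C1 * \<bar>\<tau>\<bar>"
        using 1(4)[OF z1] eq[OF t\<epsilon> s w(1)] eq[OF _ s w(2)] base[OF s] \<epsilon> nrm by simp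
      moreover have "norm (y \<tau> s) \<le> C2 * \<bar>\<tau>\<bar>"
        using 2(4)[OF z2] y_eq[OF t\<epsilon> s w(1)] D0[OF s w(2)] nrm by simp
      moreover have "((\<lambda>s. x (\<tau>, s)) has_vector_derivative y \<tau> s) (at s within {a..b})"
        using deriv[OF t\<epsilon> s w(1)] y_eq[OF t\<epsilon> s w(1)] by simp
      moreover have "continuous (at s within {a..b}) (y \<tau>)"
      proof -
        have "continuous_on ((\<lambda>s. (\<tau>, s)) -` W) (\<lambda>s. D (\<tau>, s))"
          by (rule continuous_on_compose2[OF D_cont]) (auto intro!: continuous_intros)
        moreover have o: "open ((\<lambda>s. (\<tau>, s)) -` W)" by (intro open_vimage W(1) continuous_intros)
        ultimately have "isCont (\<lambda>s. D (\<tau>, s)) s" using w(1) by (simp add: continuous_on_eq_continuous_at)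
        then have c: "continuous (at s within {a..b}) (\<lambda>s. D (\<tau>, s))" by (rule continuous_at_imp_continuous_at_within)
        obtain d where d: "d > 0" "ball s d \<subseteq> (\<lambda>s. (\<tau>, s)) -` W" using o w(1) open_contains_ball by blast
        show ?thesis
        proof (rule continuous_transform_within[OF c d(1) s])
          fix s' assume "s' \<in> {a..b}" "dist s' s < d"
          then show "D (\<tau>, s') = y \<tau> s'" using d(2) y_eq[OF t\<epsilon>, of s'] by (auto simp: dist_commute subset_iff)
        qed
      qed
      moreover have "(\<tau>, s) \<in> N" using w(1) by (simp add: W_def)
      ultimately show ?thesis using t\<epsilon> le unfolding P_def by linarith
    qed
    then show "\<exists>r>0. \<exists>C. \<forall>\<tau> s. \<bar>\<tau>\<bar> < r \<longrightarrow> s \<in> {a..b} \<longrightarrow> \<bar>s - s0\<bar> < r \<longrightarrow> P C \<tau> s" using r(1) by blast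
  qed
  then obtain r C where r: "r > 0" and P: "\<And>\<tau> s. \<bar>\<tau>\<bar> < r \<Longrightarrow> s \<in> {a..b} \<Longrightarrow> P C \<tau> s" by blast
  have P': "P (max C 0) \<tau> s" if "\<bar>\<tau>\<bar> < min r \<epsilon>" "s \<in> {a..b}" for \<tau> s
    using P[of \<tau> s] that mult_right_mono[of C "max C 0" "\<bar>\<tau>\<bar>"] unfolding P_def by auto
  show thesis
  proof (rule that[of "min r \<epsilon>" "max C 0"])
    show "continuous_on {a..b} (y \<tau>)" if "\<bar>\<tau>\<bar> < min r \<epsilon>" for \<tau>
      unfolding continuous_on_eq_continuous_within using P'[OF that] unfolding P_def by blast
  qed (use P' r \<epsilon> in \<open>auto simp: P_def\<close>)
qed

section \<open>Criticality of closed one-parameter subgroups\<close>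

lemma partition01_bounds:
  assumes p: "partition01 n t"
  shows "i \<le> n \<Longrightarrow> 0 \<le> t i" "i \<le> n \<Longrightarrow> t i \<le> 1"
proof -
  show "i \<le> n \<Longrightarrow> 0 \<le> t i"
    using p by (induction i) (auto simp: partition01_def, smt (verit) Suc_le_lessD)
  show "i \<le> n \<Longrightarrow> t i \<le> 1"
  proof (induction "n - i" arbitrary: i)
    case 0
    then show ?case using p by (simp add: partition01_def)
  next
    case (Suc k)
    then have "t i < t (Suc i)" "t (Suc i) \<le> 1" using p by (auto simp: partition01_def)
    then show ?case by simp
  qed
qed

context Lie_group
begin

text \<open>\<open>Afield e0\<close> is the identity; linearity reduces the uniform bound to
  continuity at the finitely many basis vectors.\<close>

lemma Afield_near_ident:
  assumes "\<eta> > 0"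
  obtains d where "d > 0" "cball e0 d \<subseteq> E1" "\<And>p v. p \<in> cball e0 d \<Longrightarrow> norm (Afield p v - v) \<le> \<eta> * norm v"
proof -
  define S where "S p = (\<Sum>b\<in>Basis. norm (Afield p b - b))" for p
  have "continuous_on E1 (\<lambda>p. Afield p b)" for b by (rule smooth_on_imp_continuous_on[OF smooth_Afield])
  then have "continuous_on E1 S" unfolding S_def by (intro continuous_intros)
  then have o: "open (E1 \<inter> S -` {..<\<eta>})" using open_E1 by (intro continuous_open_preimage) auto
  have "e0 \<in> E1 \<inter> S -` {..<\<eta>}" using e0_E1 assms by (simp add: S_def Afield_e0)
  then obtain d where d: "d > 0" "cball e0 d \<subseteq> E1 \<inter> S -` {..<\<eta>}" using o unfolding open_contains_cball by blast
  have "norm (Afield p v - v) \<le> \<eta> * norm v" if p: "p \<in> cball e0 d" for p v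
  proof -
    have pE: "p \<in> E1" and pS: "S p < \<eta>" using p d by auto
    note lin = linear_Afield[OF pE]
    have "Afield p v = (\<Sum>b\<in>Basis. (v \<bullet> b) *\<^sub>R Afield p b)"
      by (rule linear_Basis_sum[OF lin])
    moreover have "v = (\<Sum>b\<in>Basis. (v \<bullet> b) *\<^sub>R b)" by (simp add: euclidean_representation)
    ultimately have "Afield p v - v = (\<Sum>b\<in>Basis. (v \<bullet> b) *\<^sub>R (Afield p b - b))"
      by (metis (no_types, lifting) scaleR_diff_right sum.cong sum_subtractf)
    also have "norm \<dots> \<le> (\<Sum>b\<in>Basis. norm v * norm (Afield p b - b))"
      by (intro sum_norm_le) (simp add: Basis_le_norm mult_right_mono)
    also have "\<dots> = S p * norm v" by (simp add: S_def sum_distrib_left mult.commute)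
    also have "\<dots> \<le> \<eta> * norm v" using pS by (intro mult_right_mono) auto
    finally show ?thesis .
  qed
  with d show thesis using that by blast
qed

end

text \<open>The translating element \<open>h\<close> is a parameter, so that the subgroup itself and
  its left translate are two instances of the same statement.\<close>

locale closed_one_param = kropina_group G T \<A> g \<omega>
  for G :: "('a, 'm) monoid_scheme" (structure)
    and T :: "'a topology" and \<A> :: "('a, 'e::euclidean_space) chart set"
    and g :: "'a \<Rightarrow> ('a, 'e) tvec \<Rightarrow> ('a, 'e) tvec \<Rightarrow> real"
    and \<omega> :: "'a \<Rightarrow> ('a, 'e) tvec \<Rightarrow> real" +
  fixes \<gamma> :: "real \<Rightarrow> 'a" and l :: 'e and h :: 'a
  assumes \<gamma>: "one_param \<gamma> l" and \<gamma>1: "\<gamma> 1 = \<one>" and neg: "wh l < 0"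
    and Ad_inv: "\<And>s v. wh (Ad (\<gamma> s) v) = wh v" and h: "h \<in> carrier G"
begin

definition curve where "curve s = h \<otimes> \<gamma> s"

text \<open>The energy density as a function of the deviation \<open>w\<close> of a logarithmic
  derivative from \<open>l\<close>.\<close>

definition Q where "Q w = 1/2 * (kh (l + w))\<^sup>2"

text \<open>The \<Delta> of the overview, with \<gamma>(-s) for the inverse of \<gamma>(s). It is
  constantly the identity if \<Gamma> is the curve itself.\<close>

definition disp where "disp \<Gamma> s = inv h \<otimes> \<Gamma> s \<otimes> \<gamma> (- s)"

lemma gamma_carrier [simp]: "\<gamma> s \<in> carrier G"
  by (rule one_param_carrier[OF \<gamma>])

lemma Ad_l: "Ad (\<gamma> s) l = l"
  using Ad_lder_of_commuting[OF gamma_carrier one_param_curve[OF \<gamma>] one_param_zero[OF \<gamma>], of UNIV s]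
    one_param_commute[OF \<gamma>] one_param_lder[OF \<gamma>, of 0 UNIV] by simp

text \<open>\<open>Ad (\<gamma> s)\<close> fixes \<open>l\<close> and preserves \<open>gh\<close>
  and \<open>wh\<close>, so it can be pulled out of the whole sum.\<close>

lemma kh_Ad: "kh (Ad (\<gamma> s) u + l) = kh (l + u)"
proof -
  have "Ad (\<gamma> s) u + l = Ad (\<gamma> s) (l + u)"
    using linear_add[OF linear_Ad[OF gamma_carrier], of s l u] Ad_l[of s] by simp
  then show ?thesis by (simp add: kh_def gh_Ad[OF gamma_carrier] Ad_inv)
qed

lemma bounded_bilinear_gh: "bounded_bilinear gh"
  using linear_gh linear_gh' bilinear_conv_bounded_bilinear[of gh] unfolding bilinear_def by blast

lemma bounded_linear_wh: "bounded_linear wh"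
  using linear_wh linear_conv_bounded_linear by blast

text \<open>\<open>kh\<close> is a quotient by \<open>wh\<close>; this keeps the denominator nonzero
  near \<open>l\<close>.\<close>

lemma wh_near: "\<exists>\<rho>>0. \<forall>w. norm w < \<rho> \<longrightarrow> wh (l + w) < 0"
proof -
  obtain K where K: "K > 0" "\<And>v. norm (wh v) \<le> K * norm v"
    using linear_bounded_pos[OF linear_wh] by blast
  have "wh (l + w) < 0" if "norm w < - wh l / K" for w
  proof -
    have "wh w \<le> K * norm w" using K(2)[of w] by simp
    also have "\<dots> < - wh l" using that pos_less_divide_eq[OF K(1), of "norm w" "- wh l"] by (simp add: mult.commute)
    finally show ?thesis by (simp add: linear_add[OF linear_wh])
  qed
  moreover have "- wh l / K > 0" using divide_neg_pos[OF neg K(1)] by simp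
  ultimately show ?thesis by blast
qed

lemma Q_continuous: "(\<And>w. w \<in> A \<Longrightarrow> wh (l + w) \<noteq> 0) \<Longrightarrow> continuous_on A Q"
  unfolding Q_def kh_def
  by (intro continuous_intros bounded_bilinear.continuous_on[OF bounded_bilinear_gh]
      bounded_linear.continuous_on[OF bounded_linear_wh]) auto

lemma Q_differentiable: "Q differentiable (at 0)"
proof -
  have "((\<lambda>w. gh (l + w) (l + w)) has_derivative (\<lambda>v. gh (l + 0) v + gh v (l + 0))) (at 0)"
    by (rule bounded_bilinear.FDERIV[OF bounded_bilinear_gh]) (auto intro!: derivative_eq_intros)
  then have g: "(\<lambda>w. gh (l + w) (l + w)) differentiable (at 0)" unfolding differentiable_def by blast
  have "((\<lambda>w. wh (l + w)) has_derivative wh) (at 0)"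
    by (rule bounded_linear.has_derivative[OF bounded_linear_wh]) (auto intro!: derivative_eq_intros)
  then have w: "(\<lambda>w. wh (l + w)) differentiable (at 0)" unfolding differentiable_def by blast
  show ?thesis unfolding Q_def kh_def using neg g w
    by (intro differentiable_mult differentiable_power differentiable_minus differentiable_divide differentiable_const) auto
qed

definition q where "q = frechet_derivative Q (at 0)"

lemma q_derivative: "(Q has_derivative q) (at 0)"
  unfolding q_def using Q_differentiable frechet_derivative_works by blast

lemma bounded_linear_q: "bounded_linear q"
  using q_derivative has_derivative_bounded_linear by blast

lemma Q_linearization:
  assumes "\<eta> > 0"
  obtains d where "d > 0" "\<And>w. norm w < d \<Longrightarrow> norm (Q w - Q 0 - q w) \<le> \<eta> * norm w"
proof -
  obtain d where "d > 0" "\<forall>w. norm (w - 0) < d \<longrightarrow> norm (Q w - Q 0 - q (w - 0)) \<le> \<eta> * norm (w - 0)"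
    using q_derivative assms unfolding has_derivative_at_alt by meson
  then show thesis using that by simp
qed

text \<open>The product rule for \<Gamma> = h \<Delta> \<gamma> gives the logarithmic derivative of
  \<Delta>, twisted by Ad(\<gamma>(-s)), plus \<open>l\<close>; invariance of \<open>kh\<close>
  removes the twist.\<close>

lemma integrand_eq:
  assumes \<Gamma>: "smooth_curve_at \<Gamma> s J"
  shows "1/2 * (kropina g \<omega> (\<Gamma> s) (velocity \<A> \<Gamma> s (at s within J)))\<^sup>2 = Q (lder (disp \<Gamma>) s J)"
proof -
  have s: "s \<in> J" "at s within J \<noteq> bot" using \<Gamma> by (auto simp: smooth_curve_at_def)
  have \<gamma>c: "smooth_curve_at \<gamma> s J" by (rule one_param_curve[OF \<gamma> s])
  have "smooth_map_from J T \<A> (\<lambda>s. \<gamma> (- s))"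
    by (rule smooth_map_from_compose[OF one_param_smooth[OF \<gamma>, of UNIV] smooth_on_bounded_linear[OF bounded_linear_minus[OF bounded_linear_ident]]]) simp
  then have "smooth_curve_at (\<lambda>s. \<gamma> (- s)) s J" using s by (simp add: smooth_curve_at_def)
  then have dc: "smooth_curve_at (disp \<Gamma>) s J"
    unfolding disp_def[abs_def] using h by (intro smooth_curve_at_mult smooth_curve_at_left \<Gamma>) auto
  have eq: "\<Gamma> t = h \<otimes> (disp \<Gamma> t \<otimes> \<gamma> t)" if "t \<in> J" for t
  proof -
    have c: "\<Gamma> t \<in> carrier G" by (rule smooth_curve_at_carrier[OF \<Gamma> that])
    have "disp \<Gamma> t \<otimes> \<gamma> t = inv h \<otimes> \<Gamma> t"
      using c h by (simp add: disp_def one_param_minus[OF \<gamma>] m_assoc)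
    then show ?thesis using c h by (simp add: m_assoc[symmetric])
  qed
  have cv: "smooth_curve_at (\<lambda>t. h \<otimes> (disp \<Gamma> t \<otimes> \<gamma> t)) s J"
    by (intro smooth_curve_at_left smooth_curve_at_mult dc \<gamma>c h)
  have "lder \<Gamma> s J = lder (\<lambda>t. h \<otimes> (disp \<Gamma> t \<otimes> \<gamma> t)) s J"
    by (rule lder_cong[OF \<Gamma> cv]) (use eq s in metis)
  also have "\<dots> = lder (\<lambda>t. disp \<Gamma> t \<otimes> \<gamma> t) s J"
    by (rule lder_left_translation[OF h smooth_curve_at_mult[OF dc \<gamma>c]])
  also have "\<dots> = Ad (\<gamma> (- s)) (lder (disp \<Gamma>) s J) + l"
    using lder_mult[OF dc \<gamma>c] by (simp add: one_param_minus[OF \<gamma>] one_param_lder[OF \<gamma> s])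
  finally show ?thesis by (simp add: kropina_lder[OF \<Gamma>] kh_Ad Q_def)
qed

lemma curve_lder: "s \<in> J \<Longrightarrow> at s within J \<noteq> bot \<Longrightarrow> lder curve s J = l"
  unfolding curve_def[abs_def] using lder_left_translation[OF h one_param_curve[OF \<gamma>]] one_param_lder[OF \<gamma>] by simp

lemma curve_smooth: "smooth_map_from J T \<A> curve"
  unfolding curve_def[abs_def] using h
  by (intro smooth_map_from_mult smooth_map_from_const one_param_smooth[OF \<gamma>]) (simp flip: carrier_topspace)

lemma curve_carrier: "curve s \<in> carrier G"
  using h by (simp add: curve_def)

lemma curve_in_domain:
  assumes s: "s \<in> J" "at s within J \<noteq> bot"
  shows "(curve s, velocity \<A> curve s (at s within J)) \<in> kropina_domain T \<A> \<omega>"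
proof -
  have "smooth_curve_at curve s J" using s curve_smooth by (simp add: smooth_curve_at_def)
  from form_lder[OF this] have "\<omega> (curve s) (velocity \<A> curve s (at s within J)) < 0"
    using neg curve_lder[OF s] by simp
  then show ?thesis
    using velocity_tangent_space[OF curve_smooth s] curve_carrier[of s]
    by (simp add: kropina_domain_def carrier_topspace)
qed

lemma curve_admissible: "curve \<in> admissible_loops T \<A> (kropina_domain T \<A> \<omega>)"
proof -
  have "piecewise_smooth T \<A> curve"
    unfolding piecewise_smooth_def
    by (intro exI[of _ "1::nat"] exI[of _ real]) (simp add: partition01_def curve_smooth)
  moreover have "curve 0 = curve 1" using \<gamma>1 one_param_zero[OF \<gamma>] by (simp add: curve_def)
  moreover have "(curve s, velocity \<A> curve s (at_right s)) \<in> kropina_domain T \<A> \<omega>"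
    "(curve s, velocity \<A> curve s (at_left s)) \<in> kropina_domain T \<A> \<omega>" for s
  proof -
    have r: "at_right s = at s within {s..s + 1}" and l: "at_left s = at s within {s - 1..s}"
      by (simp_all add: at_within_Icc_at_right at_within_Icc_at_left)
    have nt: "at s within {s..s + 1} \<noteq> bot" "at s within {s - 1..s} \<noteq> bot"
      by (simp_all flip: r l)
    show "(curve s, velocity \<A> curve s (at_right s)) \<in> kropina_domain T \<A> \<omega>"
      unfolding r by (rule curve_in_domain[OF _ nt(1)]) simp
    show "(curve s, velocity \<A> curve s (at_left s)) \<in> kropina_domain T \<A> \<omega>"
      unfolding l by (rule curve_in_domain[OF _ nt(2)]) simp
  qed
  ultimately show ?thesis
    using smooth_map_from_imp_continuous_map[OF curve_smooth] by (simp add: admissible_loops_def)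
qed

definition integrand where
  "integrand \<Gamma> s = 1/2 * (kropina g \<omega> (\<Gamma> s) (velocity \<A> \<Gamma> s (at_right s)))\<^sup>2"

text \<open>On a smooth piece, \<open>q\<close> of the coordinate velocity of \<open>disp\<close>
  integrates to a difference of end point terms, kept here so that pieces can be added. What remains
  is of lower order: linearizing \<open>Q\<close> and replacing \<open>Afield\<close> by the
  identity cost a small multiple of the coordinate velocity, which is itself of order
  \<tau>.\<close>

lemma piece_estimate:
  fixes \<Gamma> :: "real \<Rightarrow> real \<Rightarrow> 'a"
  assumes \<epsilon>: "\<epsilon> > 0" and ab: "0 \<le> a" "a < b" "b \<le> 1"
    and base: "\<And>s. s \<in> {0..1} \<Longrightarrow> \<Gamma> 0 s = curve s"
    and sm: "smooth_map_from ({-\<epsilon><..<\<epsilon>} \<times> {a..b}) T \<A> (\<lambda>(\<tau>, s). \<Gamma> \<tau> s)"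
    and \<eta>: "\<eta> > 0"
  shows "\<exists>\<delta>>0. \<forall>\<tau>. \<bar>\<tau>\<bar> < \<delta> \<longrightarrow> (\<exists>I. (integrand (\<Gamma> \<tau>) has_integral I) {a..b} \<and>
    \<bar>I - Q 0 * (b - a) - q (\<kappa> (disp (\<Gamma> \<tau>) b) - \<kappa> (disp (\<Gamma> \<tau>) a))\<bar> \<le> \<eta> * \<bar>\<tau>\<bar> * (b - a))"
proof -
  define D where "D = {-\<epsilon><..<\<epsilon>} \<times> {a..b}"
  define F where "F z = disp (\<Gamma> (fst z)) (snd z)" for z
  have "smooth_map_from D T \<A> (\<lambda>z. \<gamma> (- snd z))"
    by (rule smooth_map_from_compose[OF one_param_smooth[OF \<gamma>, of UNIV] smooth_on_bounded_linear[OF bounded_linear_minus[OF bounded_linear_snd]]]) simp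
  moreover have "smooth_map_from D T \<A> (\<lambda>z. \<Gamma> (fst z) (snd z))" using sm by (simp add: D_def case_prod_unfold)
  ultimately have F: "smooth_map_from D T \<A> F"
    unfolding F_def disp_def using h
    by (intro smooth_map_from_mult smooth_map_from_const) (auto simp flip: carrier_topspace)
  obtain N where N: "open N" "{z \<in> D. F z \<in> U1} = D \<inter> N"
    using continuous_map_preimage_Int_open[OF smooth_map_from_imp_continuous_map[OF F] openin_U1] .
  define x where "x z = \<kappa> (F z)" for z
  have x: "smooth_on (D \<inter> N) x" using smooth_on_kappa[OF F] unfolding N(2) x_def .
  have F0: "F (0, s) = \<one>" if "s \<in> {a..b}" for s
  proof -
    have "inv h \<otimes> (h \<otimes> \<gamma> s) = \<gamma> s" using h by (simp add: m_assoc[symmetric])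
    then show ?thesis using that ab base[of s] h by (simp add: F_def disp_def curve_def one_param_minus[OF \<gamma>])
  qed
  have base': "(0, s) \<in> N \<and> x (0, s) = e0" if s: "s \<in> {a..b}" for s
  proof -
    have "(0, s) \<in> {z \<in> D. F z \<in> U1}" using s \<epsilon> F0[OF s] one_U1 by (simp add: D_def)
    then show ?thesis using F0[OF s] unfolding N(2) by (simp add: x_def e0_def)
  qed
  define y where "y \<tau> s = vector_derivative (\<lambda>s. x (\<tau>, s)) (at s within {a..b})" for \<tau> s
  obtain r C where r: "r > 0" "r \<le> \<epsilon>" and C: "C \<ge> 0"
    and N': "\<And>\<tau> s. \<bar>\<tau>\<bar> < r \<Longrightarrow> s \<in> {a..b} \<Longrightarrow> (\<tau>, s) \<in> N \<and> norm (x (\<tau>, s) - e0) \<le> C * \<bar>\<tau>\<bar>"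
    and y: "\<And>\<tau> s. \<bar>\<tau>\<bar> < r \<Longrightarrow> s \<in> {a..b} \<Longrightarrow>
      ((\<lambda>s. x (\<tau>, s)) has_vector_derivative y \<tau> s) (at s within {a..b}) \<and> norm (y \<tau> s) \<le> C * \<bar>\<tau>\<bar>"
    and y_cont: "\<And>\<tau>. \<bar>\<tau>\<bar> < r \<Longrightarrow> continuous_on {a..b} (y \<tau>)"
    unfolding y_def
    by (rule smooth_family_near_constant[OF ab(2) \<epsilon> N(1) x[unfolded D_def], of e0]) (use base' in \<open>blast+\<close>)
  obtain K where K: "K > 0" "\<And>v. norm (q v) \<le> K * norm v"
    using linear_bounded_pos[OF bounded_linear.linear[OF bounded_linear_q]] by blast
  obtain \<rho> where \<rho>: "\<rho> > 0" "\<And>w. norm w < \<rho> \<Longrightarrow> wh (l + w) < 0" using wh_near by blast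
  \<comment> \<open>Linearizing \<open>Q\<close> contributes 2 \<eta>' and comparing
    \<open>u\<close> with \<open>y\<close> contributes K \<eta>', each times
    \<open>norm (y \<tau> s)\<close>, which is at most (C + 1) |\<tau>|.\<close>
  define \<eta>' where "\<eta>' = \<eta> / ((2 + K) * (C + 1))"
  have \<eta>': "\<eta>' > 0" using \<eta> K C by (simp add: \<eta>'_def)
  obtain d1 where d1: "d1 > 0" "\<And>w. norm w < d1 \<Longrightarrow> norm (Q w - Q 0 - q w) \<le> \<eta>' * norm w"
    by (rule Q_linearization[OF \<eta>']) blast
  \<comment> \<open>The bound 1 gives \<open>norm (u s)\<close> at most twice
    \<open>norm (y \<tau> s)\<close>, the bound \<eta>' gives the small error.\<close>
  have "min 1 \<eta>' > 0" using \<eta>' by simp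
  then obtain d2 where d2: "d2 > 0" "cball e0 d2 \<subseteq> E1"
    "\<And>p v. p \<in> cball e0 d2 \<Longrightarrow> norm (Afield p v - v) \<le> min 1 \<eta>' * norm v"
    by (rule Afield_near_ident) blast
  \<comment> \<open>Within these radii \<open>Afield\<close> is close to the identity,
    \<open>Q\<close> close to its linearization and \<omega> negative; the two halves pay for the
    factor 2 between \<open>u\<close> and \<open>y\<close>.\<close>
  define m where "m = min d2 (min (d1 / 2) (\<rho> / 2))"
  have m: "m > 0" using d1 d2 \<rho> by (simp add: m_def)
  define \<delta> where "\<delta> = min r (m / (C + 1))"
  have \<delta>: "\<delta> > 0" using r m C by (simp add: \<delta>_def)
  show ?thesis
  proof (rule exI[of _ \<delta>], intro conjI \<delta> allI impI)
    fix \<tau> assume \<tau>: "\<bar>\<tau>\<bar> < \<delta>"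
    then have \<tau>r: "\<bar>\<tau>\<bar> < r" by (simp add: \<delta>_def)
    have "\<bar>\<tau>\<bar> < m / (C + 1)" using \<tau> by (simp add: \<delta>_def)
    then have "(C + 1) * \<bar>\<tau>\<bar> < m" using C by (simp add: pos_less_divide_eq mult.commute)
    then have C\<tau>: "C * \<bar>\<tau>\<bar> < m" by (simp add: distrib_right)
    define u where "u s = Afield (x (\<tau>, s)) (y \<tau> s)" for s
    have near: "x (\<tau>, s) \<in> cball e0 d2" if "s \<in> {a..b}" for s
      using N'[OF \<tau>r that] C\<tau> by (simp add: dist_norm norm_minus_commute m_def)
    have xE1: "x (\<tau>, s) \<in> E1" if "s \<in> {a..b}" for s using near[OF that] d2(2) by blast
    have u_y: "norm (u s - y \<tau> s) \<le> min 1 \<eta>' * norm (y \<tau> s)" if "s \<in> {a..b}" for s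
      unfolding u_def by (rule d2(3)[OF near[OF that]])
    have u_le: "norm (u s) \<le> 2 * norm (y \<tau> s)" if "s \<in> {a..b}" for s
    proof -
      have "norm (u s) \<le> norm (u s - y \<tau> s) + norm (y \<tau> s)" using norm_triangle_ineq[of "u s - y \<tau> s" "y \<tau> s"] by simp
      also have "norm (u s - y \<tau> s) \<le> 1 * norm (y \<tau> s)"
        by (rule order_trans[OF u_y[OF that]]) (intro mult_right_mono, auto)
      finally show ?thesis by simp
    qed
    have u_small: "norm (u s) < d1" "norm (u s) < \<rho>" if "s \<in> {a..b}" for s
      using u_le[OF that] y[OF \<tau>r that] C\<tau> by (auto simp: m_def)
    have bound: "norm (Q (u s) - Q 0 - q (y \<tau> s)) \<le> \<eta> * \<bar>\<tau>\<bar>" if s: "s \<in> {a..b}" for s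
    proof -
      have "Q (u s) - Q 0 - q (y \<tau> s) = (Q (u s) - Q 0 - q (u s)) + q (u s - y \<tau> s)"
        by (simp add: linear_diff[OF bounded_linear.linear[OF bounded_linear_q]])
      also have "norm \<dots> \<le> \<eta>' * norm (u s) + K * norm (u s - y \<tau> s)"
        using d1(2)[OF u_small(1)[OF s]] K(2)[of "u s - y \<tau> s"] norm_triangle_ineq by (meson add_mono order_trans)
      also have "\<dots> \<le> \<eta>' * (2 * norm (y \<tau> s)) + K * (\<eta>' * norm (y \<tau> s))"
      proof (intro add_mono mult_left_mono u_le s)
        show "norm (u s - y \<tau> s) \<le> \<eta>' * norm (y \<tau> s)"
          by (rule order_trans[OF u_y[OF s]]) (intro mult_right_mono, auto)
      qed (use \<eta>' K in auto)
      also have "\<dots> = \<eta>' * (2 + K) * norm (y \<tau> s)" by (simp add: algebra_simps)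
      also have "\<dots> \<le> \<eta>' * (2 + K) * ((C + 1) * \<bar>\<tau>\<bar>)"
      proof (rule mult_left_mono)
        have "norm (y \<tau> s) \<le> C * \<bar>\<tau>\<bar>" using y[OF \<tau>r s] by simp
        also have "\<dots> \<le> (C + 1) * \<bar>\<tau>\<bar>" by (intro mult_right_mono) auto
        finally show "norm (y \<tau> s) \<le> (C + 1) * \<bar>\<tau>\<bar>" .
      qed (use \<eta>' K in auto)
      also have "\<dots> = \<eta> * \<bar>\<tau>\<bar>"
      proof -
        have "\<eta>' * ((2 + K) * (C + 1)) = \<eta>" using K C by (simp add: \<eta>'_def)
        then show ?thesis by (metis mult.assoc)
      qed
      finally show ?thesis .
    qed
    have x_cont: "continuous_on {a..b} (\<lambda>s. x (\<tau>, s))"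
      unfolding continuous_on_eq_continuous_within using y[OF \<tau>r] has_vector_derivative_continuous by blast
    have u_cont: "continuous_on {a..b} u"
    proof -
      \<comment> \<open>Continuity of \<open>Afield\<close> is known for a fixed direction, hence
        the expansion of the moving direction in the basis.\<close>
      have "continuous_on {a..b} (\<lambda>s. \<Sum>b\<in>Basis. (y \<tau> s \<bullet> b) *\<^sub>R Afield (x (\<tau>, s)) b)"
        by (intro continuous_intros y_cont \<tau>r continuous_on_compose2[OF smooth_on_imp_continuous_on[OF smooth_Afield] x_cont])
          (use xE1 in auto)
      then show ?thesis
      proof (rule continuous_on_eq)
        fix s assume "s \<in> {a..b}"
        note lin = linear_Afield[OF xE1[OF this]]
        show "(\<Sum>b\<in>Basis. (y \<tau> s \<bullet> b) *\<^sub>R Afield (x (\<tau>, s)) b) = u s"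
          unfolding u_def by (rule linear_Basis_sum[OF lin, symmetric])
      qed
    qed
    have Qu_cont: "continuous_on {a..b} (\<lambda>s. Q (u s))"
      by (rule continuous_on_compose2[OF Q_continuous[of "ball 0 \<rho>"] u_cont]) (use \<rho>(2) u_small(2) in force)+
    define I where "I = integral {a..b} (\<lambda>s. Q (u s))"
    have I: "((\<lambda>s. Q (u s)) has_integral I) {a..b}"
      unfolding I_def by (intro integrable_integral integrable_continuous_real Qu_cont)
    have qy: "((\<lambda>s. q (y \<tau> s)) has_integral q (x (\<tau>, b) - x (\<tau>, a))) {a..b}"
    proof -
      have "(y \<tau> has_integral x (\<tau>, b) - x (\<tau>, a)) {a..b}"
        by (rule fundamental_theorem_of_calculus) (use ab y[OF \<tau>r] in auto)
      from has_integral_linear[OF this bounded_linear_q] show ?thesis by (simp add: comp_def)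
    qed
    have Q0: "((\<lambda>s. Q 0) has_integral Q 0 * (b - a)) {a..b}"
      using has_integral_const_real[of "Q 0" a b] ab by (simp add: mult.commute)
    have "norm (I - Q 0 * (b - a) - q (x (\<tau>, b) - x (\<tau>, a))) \<le> (\<eta> * \<bar>\<tau>\<bar>) * measure lborel (cbox a b)"
      by (rule has_integral_bound[of _ "\<lambda>s. Q (u s) - Q 0 - q (y \<tau> s)"])
        (use \<eta> bound has_integral_diff[OF has_integral_diff[OF I Q0] qy] in auto)
    then have "\<bar>I - Q 0 * (b - a) - q (x (\<tau>, b) - x (\<tau>, a))\<bar> \<le> \<eta> * \<bar>\<tau>\<bar> * (b - a)"
      using ab by simp
    moreover have "(integrand (\<Gamma> \<tau>) has_integral I) {a..b}"
    \<comment> \<open>At the end point \<open>b\<close> the right derivative belongs to the next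
      piece; a single point does not affect the integral.\<close>
    proof (rule has_integral_spike_finite[OF _ _ I, of "{b}"])
      fix s assume "s \<in> {a..b} - {b}"
      then have s: "s \<in> {a..b}" "s < b" "s \<in> {s..b}" by auto
      have tr: "at_right s = at s within {s..b}" using s by (simp add: at_within_Icc_at_right)
      have nt: "at s within {s..b} \<noteq> bot" using tr trivial_limit_at_right_real by metis
      have \<tau>\<epsilon>: "\<tau> \<in> {-\<epsilon><..<\<epsilon>}" using \<tau>r r by auto
      have pair: "smooth_on {s..b} (\<lambda>s. (\<tau>, s))"
        by (intro smooth_on_Pair smooth_on_const smooth_on_bounded_linear[OF bounded_linear_ident])
      have "smooth_map_from {s..b} T \<A> (\<lambda>s. (\<lambda>(\<tau>, s). \<Gamma> \<tau> s) (\<tau>, s))"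
        by (rule smooth_map_from_compose[OF sm pair]) (use s \<tau>\<epsilon> in auto)
      then have \<Gamma>c: "smooth_curve_at (\<Gamma> \<tau>) s {s..b}" using s nt by (simp add: smooth_curve_at_def)
      have "smooth_map_from {s..b} T \<A> (\<lambda>s. F (\<tau>, s))"
        by (rule smooth_map_from_compose[OF F pair]) (use s \<tau>\<epsilon> in \<open>auto simp: D_def\<close>)
      then have dc: "smooth_curve_at (disp (\<Gamma> \<tau>)) s {s..b}" using s nt by (simp add: smooth_curve_at_def F_def)
      have "(\<tau>, s) \<in> D \<inter> N" using N'[OF \<tau>r s(1)] s \<tau>\<epsilon> by (simp add: D_def)
      then have U: "disp (\<Gamma> \<tau>) s \<in> U1" unfolding N(2)[symmetric] by (simp add: F_def)
      have "((\<lambda>s. x (\<tau>, s)) has_vector_derivative y \<tau> s) (at s within {s..b})"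
        using y[OF \<tau>r s(1)] s by (auto intro: has_vector_derivative_within_subset[of _ _ _ "{a..b}"])
      then have "lder (disp (\<Gamma> \<tau>)) s {s..b} = u s"
        using lder_eq_Afield[OF dc U] by (simp add: u_def x_def F_def)
      then show "integrand (\<Gamma> \<tau>) s = Q (u s)"
        using integrand_eq[OF \<Gamma>c] tr by (simp add: integrand_def)
    qed simp
    ultimately show "\<exists>I. (integrand (\<Gamma> \<tau>) has_integral I) {a..b} \<and>
        \<bar>I - Q 0 * (b - a) - q (\<kappa> (disp (\<Gamma> \<tau>) b) - \<kappa> (disp (\<Gamma> \<tau>) a))\<bar> \<le> \<eta> * \<bar>\<tau>\<bar> * (b - a)"
      by (auto simp: x_def F_def)
  qed
qed

text \<open>Adding the pieces telescopes the end point terms. What is left is \<open>q\<close> of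
  the difference of \<open>disp\<close> at 1 and at 0 in coordinates, and it vanishes because both
  \<Gamma> \<tau> and \<gamma> close up.\<close>

lemma energy_estimate:
  fixes \<Gamma> :: "real \<Rightarrow> real \<Rightarrow> 'a"
  assumes var: "admissible_variation T \<A> (kropina_domain T \<A> \<omega>) curve \<epsilon> \<Gamma>" and \<eta>: "\<eta> > 0"
  shows "\<exists>\<delta>>0. \<forall>\<tau>. \<bar>\<tau>\<bar> < \<delta> \<longrightarrow> \<bar>energy \<A> (kropina g \<omega>) (\<Gamma> \<tau>) - Q 0\<bar> \<le> \<eta> * \<bar>\<tau>\<bar>"
proof -
  have \<epsilon>: "\<epsilon> > 0" and base: "\<And>s. s \<in> {0..1} \<Longrightarrow> \<Gamma> 0 s = curve s"
    and adm: "\<And>\<tau>. \<tau> \<in> {-\<epsilon><..<\<epsilon>} \<Longrightarrow> \<Gamma> \<tau> \<in> admissible_loops T \<A> (kropina_domain T \<A> \<omega>)"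
    using var by (auto simp: admissible_variation_def)
  obtain n t where p: "partition01 n t"
    and sm: "\<And>i. i < n \<Longrightarrow> smooth_map_from ({-\<epsilon><..<\<epsilon>} \<times> {t i..t (Suc i)}) T \<A> (\<lambda>(\<tau>, s). \<Gamma> \<tau> s)"
    using var by (auto simp: admissible_variation_def)
  note tb = partition01_bounds[OF p]
  note lq = bounded_linear.linear[OF bounded_linear_q]
  have "\<exists>\<delta>>0. \<forall>\<tau>. \<bar>\<tau>\<bar> < \<delta> \<longrightarrow> (\<exists>I. (integrand (\<Gamma> \<tau>) has_integral I) {0..t j} \<and>
    \<bar>I - Q 0 * t j - q (\<kappa> (disp (\<Gamma> \<tau>) (t j)) - \<kappa> (disp (\<Gamma> \<tau>) 0))\<bar> \<le> \<eta> * \<bar>\<tau>\<bar> * t j)" if "j \<le> n" for j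
    using that
  proof (induction j)
    case 0
    have "t 0 = 0" using p by (simp add: partition01_def)
    then show ?case using has_integral_refl(2) linear_0[OF lq] by (intro exI[of _ 1]) (auto intro!: exI[of _ 0])
  next
    case (Suc j)
    then obtain \<delta>1 where \<delta>1: "\<delta>1 > 0" "\<And>\<tau>. \<bar>\<tau>\<bar> < \<delta>1 \<Longrightarrow> \<exists>I. (integrand (\<Gamma> \<tau>) has_integral I) {0..t j} \<and>
      \<bar>I - Q 0 * t j - q (\<kappa> (disp (\<Gamma> \<tau>) (t j)) - \<kappa> (disp (\<Gamma> \<tau>) 0))\<bar> \<le> \<eta> * \<bar>\<tau>\<bar> * t j"
      by (meson Suc_leD)
    have j: "j < n" "0 \<le> t j" "t j < t (Suc j)" "t (Suc j) \<le> 1"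
      using Suc.prems tb p by (auto simp: partition01_def)
    obtain \<delta>2 where \<delta>2: "\<delta>2 > 0" "\<And>\<tau>. \<bar>\<tau>\<bar> < \<delta>2 \<Longrightarrow> \<exists>I. (integrand (\<Gamma> \<tau>) has_integral I) {t j..t (Suc j)} \<and>
      \<bar>I - Q 0 * (t (Suc j) - t j) - q (\<kappa> (disp (\<Gamma> \<tau>) (t (Suc j))) - \<kappa> (disp (\<Gamma> \<tau>) (t j)))\<bar>
        \<le> \<eta> * \<bar>\<tau>\<bar> * (t (Suc j) - t j)"
      using piece_estimate[OF \<epsilon> j(2-4) base sm[OF j(1)] \<eta>] by blast
    show ?case
    proof (rule exI[of _ "min \<delta>1 \<delta>2"], intro conjI allI impI)
      fix \<tau> assume "\<bar>\<tau>\<bar> < min \<delta>1 \<delta>2"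
      then have lt: "\<bar>\<tau>\<bar> < \<delta>1" "\<bar>\<tau>\<bar> < \<delta>2" by auto
      define A where "A = \<kappa> (disp (\<Gamma> \<tau>) 0)"
      define B where "B = \<kappa> (disp (\<Gamma> \<tau>) (t j))"
      define C where "C = \<kappa> (disp (\<Gamma> \<tau>) (t (Suc j)))"
      obtain I where I: "(integrand (\<Gamma> \<tau>) has_integral I) {0..t j}" "\<bar>I - Q 0 * t j - q (B - A)\<bar> \<le> \<eta> * \<bar>\<tau>\<bar> * t j"
        using \<delta>1(2)[OF lt(1)] unfolding A_def B_def by blast
      obtain I' where I': "(integrand (\<Gamma> \<tau>) has_integral I') {t j..t (Suc j)}"
        "\<bar>I' - Q 0 * (t (Suc j) - t j) - q (C - B)\<bar> \<le> \<eta> * \<bar>\<tau>\<bar> * (t (Suc j) - t j)"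
        using \<delta>2(2)[OF lt(2)] unfolding C_def B_def by blast
      have "q (C - A) = q (C - B) + q (B - A)" by (simp flip: linear_add[OF lq])
      then have "I + I' - Q 0 * t (Suc j) - q (C - A) = (I - Q 0 * t j - q (B - A)) + (I' - Q 0 * (t (Suc j) - t j) - q (C - B))"
        by (simp add: right_diff_distrib)
      moreover have "\<eta> * \<bar>\<tau>\<bar> * t j + \<eta> * \<bar>\<tau>\<bar> * (t (Suc j) - t j) = \<eta> * \<bar>\<tau>\<bar> * t (Suc j)"
        by (simp add: right_diff_distrib)
      ultimately have "\<bar>I + I' - Q 0 * t (Suc j) - q (C - A)\<bar> \<le> \<eta> * \<bar>\<tau>\<bar> * t (Suc j)"
        using I(2) I'(2) by linarith
      moreover have "(integrand (\<Gamma> \<tau>) has_integral I + I') {0..t (Suc j)}"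
        using has_integral_combine[OF _ _ I(1) I'(1)] j by simp
      ultimately show "\<exists>I. (integrand (\<Gamma> \<tau>) has_integral I) {0..t (Suc j)} \<and>
        \<bar>I - Q 0 * t (Suc j) - q (\<kappa> (disp (\<Gamma> \<tau>) (t (Suc j))) - \<kappa> (disp (\<Gamma> \<tau>) 0))\<bar> \<le> \<eta> * \<bar>\<tau>\<bar> * t (Suc j)"
        unfolding A_def C_def by blast
    qed (use \<delta>1 \<delta>2 in auto)
  qed
  from this[of n] obtain \<delta> where \<delta>: "\<delta> > 0" "\<And>\<tau>. \<bar>\<tau>\<bar> < \<delta> \<Longrightarrow> \<exists>I. (integrand (\<Gamma> \<tau>) has_integral I) {0..1} \<and>
    \<bar>I - Q 0 - q (\<kappa> (disp (\<Gamma> \<tau>) 1) - \<kappa> (disp (\<Gamma> \<tau>) 0))\<bar> \<le> \<eta> * \<bar>\<tau>\<bar>"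
    using p by (auto simp: partition01_def)
  have "\<bar>energy \<A> (kropina g \<omega>) (\<Gamma> \<tau>) - Q 0\<bar> \<le> \<eta> * \<bar>\<tau>\<bar>" if \<tau>: "\<bar>\<tau>\<bar> < min \<delta> \<epsilon>" for \<tau>
  proof -
    obtain I where I: "(integrand (\<Gamma> \<tau>) has_integral I) {0..1}"
      "\<bar>I - Q 0 - q (\<kappa> (disp (\<Gamma> \<tau>) 1) - \<kappa> (disp (\<Gamma> \<tau>) 0))\<bar> \<le> \<eta> * \<bar>\<tau>\<bar>"
      using \<delta>(2)[of \<tau>] \<tau> by auto
    have "\<tau> \<in> {-\<epsilon><..<\<epsilon>}" using \<tau> by (simp add: abs_less_iff)
    from adm[OF this] have "\<Gamma> \<tau> 0 = \<Gamma> \<tau> 1" by (simp add: admissible_loops_def)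
    then have "disp (\<Gamma> \<tau>) 1 = disp (\<Gamma> \<tau>) 0"
      using one_param_minus[OF \<gamma>, of 1] one_param_zero[OF \<gamma>] \<gamma>1 by (simp add: disp_def)
    moreover have "energy \<A> (kropina g \<omega>) (\<Gamma> \<tau>) = integral {0..1} (integrand (\<Gamma> \<tau>))"
      by (simp add: energy_def integrand_def[abs_def])
    ultimately show ?thesis using I linear_0[OF lq] by (simp add: integral_unique)
  qed
  then show ?thesis using \<delta>(1) \<epsilon> by (intro exI[of _ "min \<delta> \<epsilon>"]) auto
qed

text \<open>The energy estimate holds for every \<eta> > 0, which is differentiability with
  derivative 0; at \<tau> = 0 it also gives the energy of the curve itself.\<close>

lemma closed_geodesic_curve: "closed_geodesic T \<A> (kropina_domain T \<A> \<omega>) (kropina g \<omega>) curve"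
  unfolding closed_geodesic_def
proof (intro conjI allI impI curve_admissible)
  fix \<epsilon> \<Gamma> assume var: "admissible_variation T \<A> (kropina_domain T \<A> \<omega>) curve \<epsilon> \<Gamma>"
  let ?E = "\<lambda>\<tau>. energy \<A> (kropina g \<omega>) (\<Gamma> \<tau>)"
  note est = energy_estimate[OF var]
  have E0: "?E 0 = Q 0"
  proof -
    obtain \<delta> where "\<delta> > 0" "\<forall>\<tau>. \<bar>\<tau>\<bar> < \<delta> \<longrightarrow> \<bar>?E \<tau> - Q 0\<bar> \<le> 1 * \<bar>\<tau>\<bar>" using est[of 1] by auto
    from this(2)[rule_format, of 0] this(1) show ?thesis by simp
  qed
  show "(?E has_real_derivative 0) (at 0)"
    unfolding has_field_derivative_def has_derivative_at_alt
  proof (intro conjI allI impI)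
    fix e :: real assume "e > 0"
    then obtain \<delta> where "\<delta> > 0" "\<And>\<tau>. \<bar>\<tau>\<bar> < \<delta> \<Longrightarrow> \<bar>?E \<tau> - Q 0\<bar> \<le> e * \<bar>\<tau>\<bar>" using est by blast
    then show "\<exists>d>0. \<forall>\<tau>. norm (\<tau> - 0) < d \<longrightarrow> norm (?E \<tau> - ?E 0 - 0 * (\<tau> - 0)) \<le> e * norm (\<tau> - 0)"
      using E0 by auto
  qed (simp add: bounded_linear_mult_right)
qed

text \<open>A constant curve has logarithmic derivative 0, whereas \<open>wh l\<close> is
  negative.\<close>

lemma curve_nonconstant: "\<not> curve constant_on {0..1}"
proof
  assume "curve constant_on {0..1}"
  then obtain p where p: "\<And>s. s \<in> {0..1} \<Longrightarrow> curve s = p" unfolding constant_on_def by blast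
  have nt: "at 0 within {0..1::real} \<noteq> bot" by (simp add: at_within_Icc_at_right)
  have cv: "smooth_curve_at curve 0 {0..1}" using curve_smooth nt by (simp add: smooth_curve_at_def)
  have "lder curve 0 {0..1} = 0"
    by (rule lder_eqI[OF cv has_vector_derivative_const open_UNIV]) (auto simp: p)
  then show False using curve_lder[OF _ nt] neg linear_0[OF linear_wh] by simp
qed

text \<open>Seen in the chart, a curve covering the group would cover the nonempty open set
  \<open>E1\<close> by a differentiable image of a subset of the line, which is negligible in
  dimension at least 2.\<close>

lemma curve_image_proper:
  assumes dim: "DIM('e) \<ge> 2"
  shows "\<exists>p\<in>carrier G. p \<notin> curve ` {0..1}"
proof (rule ccontr)
  assume "\<not> ?thesis"
  then have all: "carrier G \<subseteq> curve ` {0..1}" by blast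
  define S where "S = {s \<in> {0..1}. curve s \<in> U1}"
  have "smooth_on S (\<lambda>s. \<kappa> (curve s))" unfolding S_def by (rule smooth_on_kappa[OF curve_smooth])
  then have "(\<lambda>s. \<kappa> (curve s)) differentiable_on S"
    unfolding differentiable_on_def
    using smooth_on_has_vector_derivative differentiableI_vector by blast
  then have "negligible ((\<lambda>s. \<kappa> (curve s)) ` S)"
    using dim by (intro negligible_differentiable_image_lowdim) auto
  moreover have "E1 \<subseteq> (\<lambda>s. \<kappa> (curve s)) ` S"
    using all U1_carrier unfolding E1_def S_def by (force simp: subset_iff)
  ultimately have "negligible E1" using negligible_subset by blast
  then show False using open_not_negligible[OF open_E1] e0_E1 by blast
qed

end

section \<open>Two closed geodesics\<close>

text \<open>The parameter \<phi> grows by m \<ge> 1, so by the intermediate value theorem it meets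
  every class modulo 1. The image is therefore an invariant that separates loops.\<close>

lemma reparametrizes_image:
  assumes "reparametrizes \<gamma> c"
  shows "\<gamma> ` {0..1} = c ` {0..<1}"
proof -
  obtain \<phi> :: "real \<Rightarrow> real" and m :: nat where m: "m \<ge> 1" and cont: "continuous_on {0..1} \<phi>"
    and \<phi>1: "\<phi> 1 = \<phi> 0 + real m" and \<gamma>: "\<And>s. s \<in> {0..1} \<Longrightarrow> \<gamma> s = c (frac (\<phi> s))"
    using assms unfolding reparametrizes_def by blast
  have "c u \<in> \<gamma> ` {0..1}" if u: "u \<in> {0..<1}" for u
  proof -
    \<comment> \<open>The representative of \<open>u\<close> modulo 1 in the first unit interval
      that \<phi> runs through.\<close>
    define v where "v = u + of_int \<lceil>\<phi> 0 - u\<rceil>"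
    have "\<phi> 0 \<le> v" "v \<le> \<phi> 0 + 1" unfolding v_def by linarith+
    then have "\<phi> 0 \<le> v" "v \<le> \<phi> 1" using m \<phi>1 by auto
    then obtain s where s: "0 \<le> s" "s \<le> 1" "\<phi> s = v" using IVT'[of \<phi> 0 v 1] cont by auto
    moreover have "frac v = u" using u by (simp add: v_def frac_eq)
    ultimately show ?thesis using \<gamma>[of s] by (intro image_eqI[of _ _ s]) auto
  qed
  moreover have "\<gamma> s \<in> c ` {0..<1}" if "s \<in> {0..1}" for s
    unfolding \<gamma>[OF that] by (rule imageI) (simp add: frac_lt_1)
  ultimately show ?thesis by blast
qed

theorem corollary5p9:
  fixes G :: "('a, 'm) monoid_scheme"
    and T :: "'a topology"
    and \<A> :: "('a, 'e::euclidean_space) chart set"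
    and g\<^sub>0 :: "'a \<Rightarrow> ('a, 'e) tvec \<Rightarrow> ('a, 'e) tvec \<Rightarrow> real"
    and \<omega> :: "'a \<Rightarrow> ('a, 'e) tvec \<Rightarrow> real"
  assumes "Lie_group G T \<A>"
    and "compact_space T"
    and "connected_space T"
    and "DIM('e) \<ge> 2"
    and "riemannian_metric T \<A> g\<^sub>0"
    and "bi_invariant_metric G \<A> g\<^sub>0"
    and "one_form T \<A> \<omega>"
    and "left_invariant_form G \<A> \<omega>"
    and "\<exists>p\<in>topspace T. \<exists>v\<in>tangent_space \<A> p. \<omega> p v \<noteq> 0"
  shows "\<exists>\<gamma>\<^sub>1 \<gamma>\<^sub>2.
    closed_geodesic T \<A> (kropina_domain T \<A> \<omega>) (kropina g\<^sub>0 \<omega>) \<gamma>\<^sub>1 \<and> \<not> \<gamma>\<^sub>1 constant_on {0..1} \<and>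
    closed_geodesic T \<A> (kropina_domain T \<A> \<omega>) (kropina g\<^sub>0 \<omega>) \<gamma>\<^sub>2 \<and> \<not> \<gamma>\<^sub>2 constant_on {0..1} \<and>
    \<not> same_up_to_reparametrization \<gamma>\<^sub>1 \<gamma>\<^sub>2"
proof -
  interpret Lie_group G T \<A> by fact
  interpret kropina_group G T \<A> g\<^sub>0 \<omega>
    by unfold_locales (use assms in blast)+
  obtain \<gamma> l where \<gamma>: "one_param \<gamma> l" "\<gamma> 1 = \<one>\<^bsub>G\<^esub>" "wh l < 0" "\<And>s v. wh (Ad (\<gamma> s) v) = wh v"
    using closed_one_param_exists by blast
  interpret c1: closed_one_param G T \<A> g\<^sub>0 \<omega> \<gamma> l "\<one>\<^bsub>G\<^esub>"
    by unfold_locales (use \<gamma> in auto)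
  obtain p where p: "p \<in> carrier G" "p \<notin> c1.curve ` {0..1}"
    using c1.curve_image_proper assms(4) by blast
  interpret c2: closed_one_param G T \<A> g\<^sub>0 \<omega> \<gamma> l p
    by unfold_locales (use \<gamma> p in auto)
  \<comment> \<open>The translate starts at a point that the first curve misses.\<close>
  have "c2.curve 0 = p" using p(1) by (simp add: c2.curve_def one_param_zero[OF \<gamma>(1)])
  then have "c2.curve ` {0..1} \<noteq> c1.curve ` {0..1}" using p(2) by force
  then have "\<not> same_up_to_reparametrization c1.curve c2.curve"
    using reparametrizes_image unfolding same_up_to_reparametrization_def by metis
  then show ?thesis
    using c1.closed_geodesic_curve c1.curve_nonconstant c2.closed_geodesic_curve c2.curve_nonconstant by blast
qed

end
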